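(* There is a canonical isomorphism $\mathfrak{krv}^{(1,1)}\simeq \mathfrak{krv}_{ell}$ between the two elliptic Kashiwara-Vergne Lie algebras defined in the context.
   Context: **Free Lie algebra.** Let $L=\mathrm{Lie}[a,b]$ be the free Lie algebra over $\mathbb{Q}$ on $a,b$, viewed inside $\mathbb{Q}\langle a,b\rangle$, and let $c=[a,b]$. The weight is the total degree in $a,b$ and the depth is the degree in $b$. Let $L_n$ be the weight $n$ part and $L_{n,r}$ the weight $n$, depth $r$ part. **Derivations.** Let $\mathfrak{der}^{(1,1)}$ be the Lie algebra of derivations $u$ of $L$ with $u(c)=0$, and let $\mathfrak{der}_n^{(1,1)}$ be the subspace of those with $u(a),u(b)\in L_n$. **Divergence.** For $f\in\mathbb{Q}\langle a,b\rangle$ without constant term, write uniquely $f=f_a a+f_b b$. Let $Tr_2$ be the quotient of $\mathbb{Q}\langle a,b\rangle$ obtained by identifying any two words that are cyclic permutations of one another, and let $tr$ be the projection to $Tr_2$. For $u\in\mathfrak{der}^{(1,1)}$ with $u(a)=f$, $u(b)=g$, set $div(u)=tr(f_a+g_b)$. **Definition of $\mathfrak{krv}^{(1,1)}$.** It is the $\mathbb{Q}$-vector space spanned by the derivations $u\in\mathfrak{der}_n^{(1,1)}$, $n\ge 3$, such that $div(u)=K\,tr\big(c^{(n-1)/2}\big)$ for some $K\in\mathbb{Q}$ if $n$ is odd, and $div(u)=0$ if $n$ is even. It is closed under the bracket of derivations. **Moulds.** A (rational-function) mould is a family $A=(A_r)_{r\ge0}$ with $A_r(u_1,\ldots,u_r)\in\mathbb{Q}(u_1,\ldots,u_r)$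 in commutative variables; one writes $A(u_1,\ldots,u_r)$ for $A_r(u_1,\ldots,u_r)$. It is polynomial-valued if every $A_r$ is a polynomial. The index $r$ is called the depth. $A$ is alternal if $A(\emptyset)=0$ and, for all $r\ge2$ and $1\le k\le r-1$, $\sum_{w} A_r(w)=0$, where $w$ runs over all shuffles of $(u_1,\ldots,u_k)$ and $(u_{k+1},\ldots,u_r)$. **Operators.** - $swap(A)(v_1,\ldots,v_r)=A(v_r,v_{r-1}-v_r,\ldots,v_1-v_2)$; - $push(A)(u_1,\ldots,u_r)=A(u_2,\ldots,u_r,-u_1-\cdots-u_r)$; - $circ(A)(v_1,\ldots,v_r)=A(v_r,v_1,\ldots,v_{r-1})$; - $\Delta(A)(u_1,\ldots,u_r)=(u_1+\cdots+u_r)\,u_1\cdots u_r\,A(u_1,\ldots,u_r)$. $A$ is push-invariant if $push(A)=A$. $A$ is circ-constant if there exists $K\in\mathbb{Q}$ such that for all $r\ge2$, $\sum_{i=0}^{r-1}circ^i(A)(v_1,\ldots,v_r)=Kr$. **Definition of $\mathfrak{krv}_{ell}$.** It consists of all polynomial-valued moulds $F$ that are alternal and push-invariant and such that $swap(\Delta^{-1}(F))$ is circ-constant. It is bigraded for the depth and the degree. **Identification with derivations and bracket on $\mathfrak{krv}_{ell}$.** Let $c_i=\mathrm{ad}(a)^{i-1}(b)$ for $i\ge1$. The linear map $c_{a_1}\cdots c_{a_r}\mapsto(-1)^{n+r}u_1^{a_1-1}\cdots u_r^{a_r-1}$, $n=a_1+\cdots+a_r$, is a bijection from polynomials in the $c_i$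 to polynomial-valued moulds, and it sends $\mathrm{Lie}[c_1,c_2,\ldots]$ (the Lie polynomials in $L$ with no linear term in $a$) bijectively onto the alternal polynomial-valued moulds. A mould $F\in\mathfrak{krv}_{ell}$ of depth $r$ and degree $d$ thus corresponds to some $f\in L_{n,r}$ with $n=d+r$; by push-invariance there is a unique $g\in L_{n,r+1}$ such that $u(a)=f$, $u(b)=g$ defines a derivation $u\in\mathfrak{der}_n^{(1,1)}$. The Lie bracket on $\mathfrak{krv}_{ell}$ is the one corresponding to bracketing of the derivations $u$. The isomorphism is the one given by this correspondence $F\leftrightarrow u$.
   Formalization: In krv_ell, moulds have finitely many nonzero depths, the circ-constant K may depend on the depth r (one K contradicts the bigrading), and weight (degree+depth) is at least 3; otherwise F_1=1, i.e. a→b, b→0, lies in krv_ell but not in krv^(1,1). *)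

theory Defs
  imports
    Complex_Main
    "HOL-Library.Poly_Mapping"
    "HOL-Library.Function_Algebras"
    "HOL-Computational_Algebra.Fraction_Field"
begin

section \<open>The free associative algebra and the free Lie algebra on two letters\<close>

text \<open>
  Words form a monoid under concatenation, so that \<^typ>\<open>'k list \<Rightarrow>\<^sub>0 rat\<close> with the convolution
  product of \<^theory>\<open>HOL-Library.Poly_Mapping\<close> is the free associative \<open>\<rat>\<close>-algebra on \<^typ>\<open>'k\<close>.
\<close>

instantiation list :: (type) monoid_add
begin

definition zero_list :: "'a list" where "zero_list = []"

definition plus_list :: "'a list \<Rightarrow> 'a list \<Rightarrow> 'a list" where "plus_list = (@)"

instance
  by standard (simp_all add: zero_list_def plus_list_def)

end

datatype letter = La | Lb

type_synonym freealg = "letter list \<Rightarrow>\<^sub>0 rat"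

definition qscale :: "rat \<Rightarrow> ('k \<Rightarrow>\<^sub>0 rat) \<Rightarrow> ('k \<Rightarrow>\<^sub>0 rat)" where
  "qscale k f = Poly_Mapping.map ((*) k) f"

definition gen_a :: freealg where "gen_a = Poly_Mapping.single [La] 1"
definition gen_b :: freealg where "gen_b = Poly_Mapping.single [Lb] 1"

definition comm :: "freealg \<Rightarrow> freealg \<Rightarrow> freealg" where
  "comm x y = x * y - y * x"

definition gen_c :: freealg where "gen_c = comm gen_a gen_b"

text \<open>\<open>L = Lie[a,b]\<close>, as the \<open>\<rat>\<close>-Lie subalgebra of \<open>\<rat>\<langle>a,b\<rangle>\<close> generated by \<open>a\<close> and \<open>b\<close>.\<close>

inductive_set lieL :: "freealg set" where
  gen_a: "gen_a \<in> lieL"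
| gen_b: "gen_b \<in> lieL"
| add: "x \<in> lieL \<Longrightarrow> y \<in> lieL \<Longrightarrow> x + y \<in> lieL"
| scale: "x \<in> lieL \<Longrightarrow> qscale k x \<in> lieL"
| comm: "x \<in> lieL \<Longrightarrow> y \<in> lieL \<Longrightarrow> comm x y \<in> lieL"

definition lieL_wt :: "nat \<Rightarrow> freealg set" where
  "lieL_wt n = {x \<in> lieL. \<forall>w \<in> Poly_Mapping.keys x. length w = n}"

definition lieL_bi :: "nat \<Rightarrow> nat \<Rightarrow> freealg set" where
  "lieL_bi n r = {x \<in> lieL_wt n. \<forall>w \<in> Poly_Mapping.keys x. count_list w Lb = r}"


section \<open>Derivations, divergence and \<open>krv^(1,1)\<close>\<close>

text \<open>
  A derivation of \<open>L\<close> is a map defined on \<open>L\<close> only; it is represented by its extension by zero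
  to \<open>\<rat>\<langle>a,b\<rangle>\<close>, so that equality, linear combinations and brackets of derivations are those of
  the representing functions.
\<close>

definition derivations :: "(freealg \<Rightarrow> freealg) set" where
  "derivations = {u.
     (\<forall>x. x \<notin> lieL \<longrightarrow> u x = 0) \<and>
     (\<forall>x \<in> lieL. u x \<in> lieL) \<and>
     (\<forall>x \<in> lieL. \<forall>y \<in> lieL. u (x + y) = u x + u y) \<and>
     (\<forall>k. \<forall>x \<in> lieL. u (qscale k x) = qscale k (u x)) \<and>
     (\<forall>x \<in> lieL. \<forall>y \<in> lieL. u (comm x y) = comm (u x) y + comm x (u y))}"

definition der11 :: "(freealg \<Rightarrow> freealg) set" where
  "der11 = {u \<in> derivations. u gen_c = 0}"

definition der11_wt :: "nat \<Rightarrow> (freealg \<Rightarrow> freealg) set" where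
  "der11_wt n = {u \<in> der11. u gen_a \<in> lieL_wt n \<and> u gen_b \<in> lieL_wt n}"

definition der_scale :: "rat \<Rightarrow> (freealg \<Rightarrow> freealg) \<Rightarrow> freealg \<Rightarrow> freealg" where
  "der_scale k u = (\<lambda>x. qscale k (u x))"

definition der_bracket :: "(freealg \<Rightarrow> freealg) \<Rightarrow> (freealg \<Rightarrow> freealg) \<Rightarrow> freealg \<Rightarrow> freealg" where
  "der_bracket u v = (\<lambda>x. u (v x) - v (u x))"

lemma lookup_qscale: "Poly_Mapping.lookup (qscale k f) w = k * Poly_Mapping.lookup f w"
  by (simp add: qscale_def map.rep_eq when_def)

interpretation der: vector_space der_scale
  by standard
    (auto simp: der_scale_def fun_eq_iff lookup_qscale lookup_add algebra_simps
      intro!: poly_mapping_eqI)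

text \<open>The unique \<open>f_a\<close> and \<open>f_b\<close> with \<open>f = f_a a + f_b b\<close>, for \<open>f\<close> without constant term.\<close>

definition right_a :: "freealg \<Rightarrow> freealg" where
  "right_a f = (THE p. \<exists>q. f = p * gen_a + q * gen_b)"

definition right_b :: "freealg \<Rightarrow> freealg" where
  "right_b f = (THE q. \<exists>p. f = p * gen_a + q * gen_b)"

quotient_type cyclic_word = "letter list" / "\<lambda>v w. \<exists>k. w = rotate k v"
proof (rule equivpI)
  show "reflp (\<lambda>v w. \<exists>k. w = rotate k (v :: letter list))"
    by (rule reflpI) (metis rotate0 id_apply)
  show "symp (\<lambda>v w. \<exists>k. w = rotate k (v :: letter list))"
  proof (rule sympI)
    fix v w :: "letter list"
    assume "\<exists>k. w = rotate k v"
    then obtain k where k: "w = rotate k v" ..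
    show "\<exists>k. v = rotate k w"
    proof (cases "v = []")
      case True
      then show ?thesis using k by simp
    next
      case False
      have "rotate (length v - k mod length v) w =
            rotate (length v - k mod length v + k mod length v) v"
        unfolding k by (subst rotate_conv_mod) (simp add: rotate_rotate)
      also have "length v - k mod length v + k mod length v = length v"
        using False by (simp add: less_imp_le)
      finally show ?thesis
        by (metis rotate_id mod_self)
    qed
  qed
  show "transp (\<lambda>v w. \<exists>k. w = rotate k (v :: letter list))"
    by (rule transpI) (metis rotate_rotate)
qed

text \<open>\<open>Tr_2\<close>: identifying words up to cyclic permutation in \<open>\<rat>\<langle>a,b\<rangle>\<close> leaves the
  \<open>\<rat>\<close>-vector space with basis the cyclic words.\<close>

type_synonym tr2 = "cyclic_word \<Rightarrow>\<^sub>0 rat"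

definition tr :: "freealg \<Rightarrow> tr2" where
  "tr f = (\<Sum>w \<in> Poly_Mapping.keys f.
             Poly_Mapping.single (abs_cyclic_word w) (Poly_Mapping.lookup f w))"

definition divergence :: "(freealg \<Rightarrow> freealg) \<Rightarrow> tr2" where
  "divergence u = tr (right_a (u gen_a) + right_b (u gen_b))"

definition krv11 :: "(freealg \<Rightarrow> freealg) set" where
  "krv11 = der.span {u. \<exists>n \<ge> 3. u \<in> der11_wt n \<and>
     (if odd n then \<exists>K. divergence u = qscale K (tr (gen_c ^ ((n - 1) div 2)))
      else divergence u = 0)}"


section \<open>Moulds\<close>

text \<open>
  Polynomials in commuting variables indexed by \<^typ>\<open>nat\<close>; a monomial is its exponent vector.
  A depth \<open>r\<close> component uses the variables with indices \<open>1, \<dots>, r\<close>, and the same variables serve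
  as \<open>u_1, \<dots>, u_r\<close> and as \<open>v_1, \<dots>, v_r\<close>.
\<close>

type_synonym mpoly = "(nat \<Rightarrow>\<^sub>0 nat) \<Rightarrow>\<^sub>0 rat"
type_synonym ratfun = "mpoly fract"
type_synonym mould = "nat \<Rightarrow> ratfun"

definition mvars :: "mpoly \<Rightarrow> nat set" where
  "mvars p = (\<Union>m \<in> Poly_Mapping.keys p. Poly_Mapping.keys m)"

definition mdeg :: "(nat \<Rightarrow>\<^sub>0 nat) \<Rightarrow> nat" where
  "mdeg m = (\<Sum>i \<in> Poly_Mapping.keys m. Poly_Mapping.lookup m i)"

definition rf_const :: "rat \<Rightarrow> ratfun" where
  "rf_const k = Fract (Poly_Mapping.single 0 k) 1"

definition uvar :: "nat \<Rightarrow> ratfun" where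
  "uvar i = Fract (Poly_Mapping.single (Poly_Mapping.single i 1) 1) 1"

definition poly_eval :: "(nat \<Rightarrow> ratfun) \<Rightarrow> mpoly \<Rightarrow> ratfun" where
  "poly_eval s p = (\<Sum>m \<in> Poly_Mapping.keys p. rf_const (Poly_Mapping.lookup p m) *
     (\<Prod>i \<in> Poly_Mapping.keys m. s i ^ Poly_Mapping.lookup m i))"

text \<open>Substitution in a rational function: computed on any representation as a fraction whose
  denominator does not vanish under the substitution, the result being independent of that
  choice.\<close>

definition rf_eval :: "(nat \<Rightarrow> ratfun) \<Rightarrow> ratfun \<Rightarrow> ratfun" where
  "rf_eval s x = (THE y. \<exists>p q. x = Fract p q \<and> poly_eval s q \<noteq> 0 \<and>
                          y = poly_eval s p / poly_eval s q)"

text \<open>\<open>mapply A [x\<^sub>1, \<dots>, x\<^sub>r]\<close> is \<open>A(x\<^sub>1, \<dots>, x\<^sub>r)\<close>. The variables not occurring in \<open>A\<^sub>r\<close> are left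
  fixed, which keeps all the substitutions used below invertible.\<close>

definition mapply :: "mould \<Rightarrow> ratfun list \<Rightarrow> ratfun" where
  "mapply A xs = rf_eval (\<lambda>i. if 1 \<le> i \<and> i \<le> length xs then xs ! (i - 1) else uvar i)
                         (A (length xs))"

text \<open>Polynomial-valued moulds. As in the bijection with polynomials in the \<open>c_i\<close>, a mould has
  only finitely many nonzero components (direct sum, not product, over the depth).\<close>

definition poly_moulds :: "mould set" where
  "poly_moulds = {A. (\<forall>r. \<exists>p. A r = Fract p 1 \<and> mvars p \<subseteq> {1..r}) \<and> finite {r. A r \<noteq> 0}}"

definition poly_of :: "ratfun \<Rightarrow> mpoly" where
  "poly_of x = (THE p. x = Fract p 1)"

definition mould_scale :: "rat \<Rightarrow> mould \<Rightarrow> mould" where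
  "mould_scale k A = (\<lambda>r. rf_const k * A r)"

definition alternal :: "mould \<Rightarrow> bool" where
  "alternal A \<longleftrightarrow> A 0 = 0 \<and>
     (\<forall>r \<ge> 2. \<forall>k \<in> {1..r - 1}.
        (\<Sum>w \<in> shuffles [1..<k + 1] [k + 1..<r + 1]. mapply A (map uvar w)) = 0)"

definition swap :: "mould \<Rightarrow> mould" where
  "swap A = (\<lambda>r. if r = 0 then A 0 else
     mapply A (uvar r # map (\<lambda>i. uvar (r - i) - uvar (r - i + 1)) [1..<r]))"

definition push :: "mould \<Rightarrow> mould" where
  "push A = (\<lambda>r. if r = 0 then A 0 else
     mapply A (map uvar [2..<r + 1] @ [- (\<Sum>i = 1..r. uvar i)]))"

definition circ :: "mould \<Rightarrow> mould" where
  "circ A = (\<lambda>r. if r = 0 then A 0 else mapply A (uvar r # map uvar [1..<r]))"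

text \<open>\<open>\<Delta>\<close> is not injective in depth 0, where \<open>Delta_inv A 0 = 0\<close>; alternal moulds vanish there.\<close>

definition Delta_inv :: "mould \<Rightarrow> mould" where
  "Delta_inv A = (\<lambda>r. A r / ((\<Sum>i = 1..r. uvar i) * (\<Prod>i = 1..r. uvar i)))"

definition push_invariant :: "mould \<Rightarrow> bool" where
  "push_invariant A \<longleftrightarrow> push A = A"

text \<open>The constant is attached to each depth: with one constant for all depths at once the
  condition would not be compatible with the depth grading (a mould concentrated in a single
  depth would be forced to have constant 0).\<close>

definition circ_constant :: "mould \<Rightarrow> bool" where
  "circ_constant A \<longleftrightarrow>
     (\<forall>r \<ge> 2. \<exists>K. (\<Sum>i<r. (circ ^^ i) A r) = rf_const (K * of_nat r))"

text \<open>The last condition restricts to weights (degree plus depth) at least 3, as for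
  \<^const>\<open>krv11\<close>; it only excludes a constant term in depth 1, i.e. the derivation
  \<open>a \<mapsto> b, b \<mapsto> 0\<close> of weight 1.\<close>

definition krv_ell :: "mould set" where
  "krv_ell = {F \<in> poly_moulds. alternal F \<and> push_invariant F \<and>
     circ_constant (swap (Delta_inv F)) \<and>
     (\<forall>r. \<forall>m \<in> Poly_Mapping.keys (poly_of (F r)). mdeg m + r \<ge> 3)}"


section \<open>The correspondence between moulds and derivations\<close>

definition c_gen :: "nat \<Rightarrow> freealg" where
  "c_gen i = (comm gen_a ^^ (i - 1)) gen_b"

text \<open>The inverse of the linear bijection
  \<open>c_{a_1} \<dots> c_{a_r} \<mapsto> (-1)^(n+r) u_1^(a_1-1) \<dots> u_r^(a_r-1)\<close>, \<open>n = a_1 + \<dots> + a_r\<close>: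
  here \<open>a_i\<close> is one more than the exponent of \<open>u_i\<close>, so \<open>n = mdeg m + r\<close>.\<close>

definition lie_of_mould :: "mould \<Rightarrow> freealg" where
  "lie_of_mould F = (\<Sum>r \<in> {r. F r \<noteq> 0}. \<Sum>m \<in> Poly_Mapping.keys (poly_of (F r)).
     qscale ((-1) ^ ((mdeg m + r) + r) * Poly_Mapping.lookup (poly_of (F r)) m)
            (prod_list (map (\<lambda>i. c_gen (Poly_Mapping.lookup m i + 1)) [1..<r + 1])))"

definition hom_part :: "nat \<Rightarrow> mpoly \<Rightarrow> mpoly" where
  "hom_part d p = (\<Sum>m \<in> {m \<in> Poly_Mapping.keys p. mdeg m = d}.
                     Poly_Mapping.single m (Poly_Mapping.lookup p m))"

definition mould_part :: "nat \<Rightarrow> nat \<Rightarrow> mould \<Rightarrow> mould" where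
  "mould_part r d F = (\<lambda>s. if s = r then Fract (hom_part d (poly_of (F r))) 1 else 0)"

text \<open>\<open>corresponds r d F u\<close>: the derivation \<open>u\<close> is attached to the mould \<open>F\<close>, which is assumed to be
  of depth \<open>r\<close> and degree \<open>d\<close>.\<close>

definition corresponds :: "nat \<Rightarrow> nat \<Rightarrow> mould \<Rightarrow> (freealg \<Rightarrow> freealg) \<Rightarrow> bool" where
  "corresponds r d F u \<longleftrightarrow> u \<in> der11_wt (d + r) \<and>
     u gen_a = lie_of_mould F \<and> u gen_a \<in> lieL_bi (d + r) r \<and> u gen_b \<in> lieL_bi (d + r) (r + 1)"

definition der_of_mould :: "mould \<Rightarrow> freealg \<Rightarrow> freealg" where
  "der_of_mould F = (\<Sum>(r, d) \<in> {(r, d). mould_part r d F \<noteq> 0}.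
                       THE u. corresponds r d (mould_part r d F) u)"

definition mould_bracket :: "mould \<Rightarrow> mould \<Rightarrow> mould" where
  "mould_bracket F G = (THE H. H \<in> poly_moulds \<and>
     lie_of_mould H = der_bracket (der_of_mould F) (der_of_mould G) gen_a)"


section \<open>Lie algebras and their isomorphisms\<close>

definition lie_algebra_on ::
  "(rat \<Rightarrow> 'v \<Rightarrow> 'v) \<Rightarrow> 'v::ab_group_add set \<Rightarrow> ('v \<Rightarrow> 'v \<Rightarrow> 'v) \<Rightarrow> bool" where
  "lie_algebra_on sc V br \<longleftrightarrow>
     vector_space sc \<and> module.subspace sc V \<and>
     (\<forall>x \<in> V. \<forall>y \<in> V. br x y \<in> V) \<and>
     (\<forall>x \<in> V. \<forall>y \<in> V. \<forall>z \<in> V. br (x + y) z = br x z + br y z \<and> br x (y + z) = br x y + br x z) \<and>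
     (\<forall>k. \<forall>x \<in> V. \<forall>y \<in> V. br (sc k x) y = sc k (br x y) \<and> br x (sc k y) = sc k (br x y)) \<and>
     (\<forall>x \<in> V. br x x = 0) \<and>
     (\<forall>x \<in> V. \<forall>y \<in> V. \<forall>z \<in> V. br x (br y z) + br y (br z x) + br z (br x y) = 0)"

definition lie_iso_on ::
  "(rat \<Rightarrow> 'v \<Rightarrow> 'v) \<Rightarrow> 'v::ab_group_add set \<Rightarrow> ('v \<Rightarrow> 'v \<Rightarrow> 'v) \<Rightarrow>
   (rat \<Rightarrow> 'w \<Rightarrow> 'w) \<Rightarrow> 'w::ab_group_add set \<Rightarrow> ('w \<Rightarrow> 'w \<Rightarrow> 'w) \<Rightarrow> ('v \<Rightarrow> 'w) \<Rightarrow> bool" where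
  "lie_iso_on sc V br sc' W br' f \<longleftrightarrow>
     bij_betw f V W \<and>
     (\<forall>x \<in> V. \<forall>y \<in> V. f (x + y) = f x + f y) \<and>
     (\<forall>k. \<forall>x \<in> V. f (sc k x) = sc' k (f x)) \<and>
     (\<forall>x \<in> V. \<forall>y \<in> V. f (br x y) = br' (f x) (f y))"

end

theory Submission
  imports Defs
begin

text \<open>
  By Lazard elimination \<open>L\<close> is \<open>\<rat>a \<oplus> Lie[c\<^sub>1, c\<^sub>2, \<dots>]\<close>, and by Ree's theorem \<open>Lie[c\<^sub>1, c\<^sub>2, \<dots>]\<close>
  corresponds to the alternal polynomials. Identify \<open>a\<^bsup>e\<^sub>0\<^esup> b a\<^bsup>e\<^sub>1\<^esup> b \<dots> b a\<^bsup>e\<^sub>r\<^esup>\<close> with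
  \<open>z\<^sub>0\<^bsup>e\<^sub>0\<^esup> \<dots> z\<^sub>r\<^bsup>e\<^sub>r\<^esup>\<close>; the mould variables are \<open>u\<^sub>i = z\<^sub>i - z\<^sub>i\<^sub>-\<^sub>1\<close>. The equation \<open>[a,g] = [b,f]\<close> becomes
  \<open>(z\<^sub>0 - z\<^sub>r\<^sub>+\<^sub>1) g = f(z\<^sub>1, \<dots>, z\<^sub>r\<^sub>+\<^sub>1) - f(z\<^sub>0, \<dots>, z\<^sub>r)\<close>, so \<open>g\<close> exists exactly when \<open>f\<close> is
  invariant under cyclic permutation of \<open>z\<^sub>0, \<dots>, z\<^sub>r\<close>, which is push-invariance; and \<open>g\<close> is alternal
  with \<open>f\<close> because \<open>u\<^sub>1 + \<dots> + u\<^sub>r\<^sub>+\<^sub>1\<close> is symmetric.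

  A trace of depth \<open>r\<close> is determined by the sum over the cyclic permutations of \<open>z\<^sub>0, \<dots>, z\<^sub>r\<^sub>-\<^sub>1\<close> after
  setting \<open>z\<^sub>r = z\<^sub>0\<close>. For \<open>f\<^sub>a + g\<^sub>b\<close> this sum is \<open>\<Sum>\<^sub>i f(z\<^sub>i, \<dots>, z\<^sub>i\<^sub>-\<^sub>1, 0) (1/z\<^sub>i\<^sub>-\<^sub>1 - 1/z\<^sub>i)\<close>, which is
  the cyclic sum of \<open>swap (\<Delta>\<^sup>-\<^sup>1 F)\<close> times the cyclically invariant \<open>\<Prod>\<^sub>i (z\<^sub>i\<^sub>+\<^sub>1 - z\<^sub>i)\<close>; the latter is
  up to scalars the cyclic sum of \<open>c\<^sup>r\<close>. So circ-constancy is the divergence condition. Stability of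
  \<open>krv11\<close> under brackets holds because the divergence is a cocycle and the derivations kill \<open>c\<close>.
\<close>

section \<open>Linear maps on finitely supported functions\<close>

text \<open>The two sides are graded differently: \<open>krv11\<close> is spanned by derivations
  homogeneous in weight, while circ-constancy is imposed depth by depth. They match because c^r has
  depth r and weight 2r and the divergence lowers weight by one: a nonzero constant in depth r can
  only come from weight 2r+1. This weight is odd, so in even weight the constant is 0, as
  \<open>krv11\<close> demands. In depth 1 there is no circ condition, and the cyclic sum of the
  divergence vanishes there by itself, its only term having the factor 1/z_0 - 1/z_0. Evaluating
  words in a field of rational functions turns the noncommutative equations for g and for the
  divergence into commutative ones, where division by variables and by their differences is allowed.
  Nothing is lost: evaluation determines a polynomial in each depth (\<open>Psi_inj\<close>), and
  cyclic sums determine traces (\<open>tr_dpart_zero\<close>). The bracket of moulds is defined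
  through derivations. Once the correspondence is a linear bijection onto \<open>krv11\<close> and
  \<open>krv11\<close> is stable under brackets, the Lie axioms are transported.\<close>

abbreviation (input) "single \<equiv> Poly_Mapping.single"
abbreviation (input) "lookup \<equiv> Poly_Mapping.lookup"
abbreviation (input) "keys \<equiv> Poly_Mapping.keys"

text \<open>The coefficient maps \<open>h k\<close> need only be additive, so that one construction
  serves targets with different scalar actions: words, cyclic words, polynomials and rational
  functions.\<close>

definition lin_ext :: "('k \<Rightarrow> rat \<Rightarrow> 'm::ab_group_add) \<Rightarrow> ('k \<Rightarrow>\<^sub>0 rat) \<Rightarrow> 'm" where
  "lin_ext h x = (\<Sum>k\<in>keys x. h k (lookup x k))"

lemma lin_ext_superset:
  assumes "\<And>k. additive (h k)" "finite S" "keys x \<subseteq> S"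
  shows "lin_ext h x = (\<Sum>k\<in>S. h k (lookup x k))"
  unfolding lin_ext_def
  by (rule sum.mono_neutral_left) (use assms additive.zero in \<open>auto simp: in_keys_iff\<close>)

lemma lin_ext_additive:
  assumes "\<And>k. additive (h k)"
  shows "additive (lin_ext h)"
proof
  fix x y :: "'a \<Rightarrow>\<^sub>0 rat"
  let ?S = "keys x \<union> keys y"
  have "keys (x + y) \<subseteq> ?S" by (rule Poly_Mapping.keys_add)
  then show "lin_ext h (x + y) = lin_ext h x + lin_ext h y"
    by (simp add: lin_ext_superset[OF assms, of ?S] lookup_add additive.add[OF assms] sum.distrib)
qed

lemma lin_ext_single:
  assumes "\<And>k. additive (h k)"
  shows "lin_ext h (single k c) = h k c"
  by (simp add: lin_ext_superset[OF assms, of "{k}"])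

lemma sum_singles:
  fixes x :: "'k \<Rightarrow>\<^sub>0 'b::comm_monoid_add"
  shows "(\<Sum>k\<in>keys x. single k (lookup x k)) = x"
proof (rule poly_mapping_eqI)
  fix j
  have "lookup (\<Sum>k\<in>keys x. single k (lookup x k)) j
      = (\<Sum>k\<in>keys x. if k = j then lookup x k else 0)"
    by (simp add: lookup_sum lookup_single when_def)
  then show "lookup (\<Sum>k\<in>keys x. single k (lookup x k)) j
      = lookup x j"
    by (simp add: in_keys_iff)
qed

lemma additive_expand:
  assumes "additive F"
  shows "F x = (\<Sum>k\<in>keys x. F (single k (lookup x k)))"
  by (subst sum_singles[of x, symmetric]) (simp add: additive.sum[OF assms])

text \<open>Agreement is asked only on basis elements occurring in \<open>x\<close>, so that a
  hypothesis on \<open>x\<close> (its depth, its variables) can be used term by term.\<close>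

lemma additive_eqI:
  assumes "additive F" "additive G"
    and "\<And>k c. k \<in> keys x \<Longrightarrow> F (single k c) = G (single k c)"
  shows "F x = G x"
  unfolding additive_expand[OF assms(1), of x] additive_expand[OF assms(2), of x]
  by (rule sum.cong) (use assms(3) in auto)

lemma biadditive_eqI:
  assumes "\<And>y. additive (\<lambda>x. F x y)" "\<And>x. additive (F x)"
    and "\<And>y. additive (\<lambda>x. G x y)" "\<And>x. additive (G x)"
    and "\<And>v w c d. F (single v c) (single w d)
           = G (single v c) (single w d)"
  shows "F x y = G x y"
proof (rule additive_eqI[where F="\<lambda>x. F x y" and G="\<lambda>x. G x y"])
  fix v c
  show "F (single v c) y = G (single v c) y"
    by (rule additive_eqI[where F="F (single v c)" and G="G (single v c)"])
      (use assms in auto)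
qed (use assms in auto)

lemma additive_comp: "additive F \<Longrightarrow> additive G \<Longrightarrow> additive (\<lambda>x. F (G x))"
  by (simp add: additive_def)

lemma additive_plus: "additive F \<Longrightarrow> additive G \<Longrightarrow> additive (\<lambda>x. F x + G x)"
  by (simp add: additive_def algebra_simps)

lemma additive_minus: "additive F \<Longrightarrow> additive G \<Longrightarrow> additive (\<lambda>x. F x - G x)"
  by (simp add: additive_def algebra_simps)

lemma additive_sum: "(\<And>i. i \<in> I \<Longrightarrow> additive (F i)) \<Longrightarrow> additive (\<lambda>x. \<Sum>i\<in>I. F i x)"
  by (simp add: additive_def sum.distrib)

lemma additive_id: "additive (\<lambda>x. x)"
  by (simp add: additive_def)

lemma additive_zero_fun: "additive (\<lambda>x. 0)"
  by (simp add: additive_def)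

lemma additive_mult_left: "additive F \<Longrightarrow> additive (\<lambda>x. F x * (y :: 'r :: ring))"
  by (simp add: additive_def algebra_simps)

lemma additive_mult_right: "additive F \<Longrightarrow> additive (\<lambda>x. (y :: 'r :: ring) * F x)"
  by (simp add: additive_def algebra_simps)

lemma additive_single: "additive (single k)"
  by (simp add: additive_def single_add)

lemma additive_qscale: "additive (qscale k)"
  by (simp add: additive_def poly_mapping_eq_iff fun_eq_iff lookup_qscale lookup_add algebra_simps)

lemma additive_qscale_left: "additive (\<lambda>k. qscale k x)"
  by (simp add: additive_def poly_mapping_eq_iff fun_eq_iff lookup_qscale lookup_add algebra_simps)

lemmas additive_intros = additive_plus additive_minus additive_sum additive_id
  additive_zero_fun additive_mult_left additive_mult_right additive_single additive_qscale
  additive_qscale_left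

lemma qscale_add: "qscale k (x + y) = qscale k x + qscale k y"
  by (rule additive.add[OF additive_qscale])

lemma qscale_diff: "qscale k (x - y) = qscale k x - qscale k y"
  by (rule additive.diff[OF additive_qscale])

lemma qscale_sum: "qscale k (\<Sum>i\<in>I. f i) = (\<Sum>i\<in>I. qscale k (f i))"
  by (rule additive.sum[OF additive_qscale])

lemma qscale_zero_right [simp]: "qscale k 0 = 0"
  by (rule additive.zero[OF additive_qscale])

lemma qscale_uminus: "qscale k (- x) = - qscale k x"
  by (rule additive.minus[OF additive_qscale])

lemma qscale_zero [simp]: "qscale 0 x = 0"
  by (rule poly_mapping_eqI) (simp add: lookup_qscale)

lemma qscale_one [simp]: "qscale 1 x = x"
  by (rule poly_mapping_eqI) (simp add: lookup_qscale)

lemma qscale_neg_one: "qscale (-1) x = - x"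
  by (rule poly_mapping_eqI) (simp add: lookup_qscale)

lemma qscale_uminus_left: "qscale (- k) x = - qscale k x"
  by (rule poly_mapping_eqI) (simp add: lookup_qscale)

lemma qscale_qscale [simp]: "qscale k (qscale l x) = qscale (k * l) x"
  by (rule poly_mapping_eqI) (simp add: lookup_qscale)

lemma qscale_single [simp]: "qscale k (single w c) = single w (k * c)"
  by (rule poly_mapping_eqI) (simp add: lookup_qscale lookup_single when_def)

lemma qscale_left_add: "qscale (k + l) x = qscale k x + qscale l x"
  by (rule poly_mapping_eqI) (simp add: lookup_qscale lookup_add algebra_simps)

lemma qscale_conv_mult: "qscale k x = single 0 k * (x :: 'k::monoid_add \<Rightarrow>\<^sub>0 rat)"
  by (simp add: qscale_def mult_map_scale_conv_mult)

lemma qscale_mult_left: "qscale k x * y = qscale k (x * (y :: 'k::monoid_add \<Rightarrow>\<^sub>0 rat))"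
  by (simp add: qscale_conv_mult mult.assoc)

lemma qscale_mult_right: "x * qscale k y = qscale k (x * (y :: 'k::monoid_add \<Rightarrow>\<^sub>0 rat))"
proof (rule biadditive_eqI[where F="\<lambda>x y. x * qscale k y" and G="\<lambda>x y. qscale k (x * y)"])
  show "\<And>v w c d. single (v::'k) c * qscale k (single w d) =
       qscale k (single v c * single w d)"
    by (simp add: mult_single mult.left_commute)
qed (auto simp: additive_def algebra_simps qscale_add)

lemma lin_ext_qscale:
  assumes "\<And>k. additive (h k)" "additive S" "\<And>k l. h k (c * l) = S (h k l)"
  shows "lin_ext h (qscale c x) = S (lin_ext h x)"
proof (rule additive_eqI[where F="\<lambda>x. lin_ext h (qscale c x)" and G="\<lambda>x. S (lin_ext h x)"])
  show "additive (\<lambda>x. lin_ext h (qscale c x))" "additive (\<lambda>x. S (lin_ext h x))"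
    using additive_comp[OF lin_ext_additive[of h] additive_qscale]
      additive_comp[OF assms(2) lin_ext_additive[of h]] assms(1) by auto
qed (simp add: lin_ext_single[OF assms(1)] assms(3))

definition restr :: "('k \<Rightarrow> bool) \<Rightarrow> ('k \<Rightarrow>\<^sub>0 rat) \<Rightarrow> ('k \<Rightarrow>\<^sub>0 rat)" where
  "restr Q = lin_ext (\<lambda>k c. single k (if Q k then c else 0))"

lemma additive_if_single: "additive (\<lambda>c. single k (if Q then c else 0))"
  by (simp add: additive_def single_add)

lemma additive_restr: "additive (restr Q)"
  unfolding restr_def by (rule lin_ext_additive) (rule additive_if_single)

lemma restr_single: "restr Q (single k c) = (if Q k then single k c else 0)"
  by (simp add: restr_def lin_ext_single additive_if_single)

lemma lookup_additive: "additive (\<lambda>x. lookup x k)"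
  by (simp add: additive_def lookup_add)

lemma lookup_restr: "lookup (restr Q x) k = (if Q k then lookup x k else 0)"
  by (rule additive_eqI[where F="\<lambda>x. lookup (restr Q x) k" and
      G="\<lambda>x. if Q k then lookup x k else 0"])
    (auto simp: additive_def additive.add[OF additive_restr] lookup_add restr_single lookup_single when_def)

lemma keys_restr: "keys (restr Q x) = {k \<in> keys x. Q k}"
  by (auto simp: in_keys_iff lookup_restr split: if_splits)

lemma restr_id: "(\<And>k. k \<in> keys x \<Longrightarrow> Q k) \<Longrightarrow> restr Q x = x"
  by (rule poly_mapping_eqI) (auto simp: lookup_restr in_keys_iff)

lemma restr_0: "(\<And>k. k \<in> keys x \<Longrightarrow> \<not> Q k) \<Longrightarrow> restr Q x = 0"
  by (rule poly_mapping_eqI) (auto simp: lookup_restr in_keys_iff)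

lemma keys_uminus: "keys (- x) = keys (x :: 'k \<Rightarrow>\<^sub>0 'c::ab_group_add)"
  by (auto simp: in_keys_iff)

lemma keys_diff_subset:
  "keys (x - y) \<subseteq> keys x \<union> keys (y :: 'k \<Rightarrow>\<^sub>0 'c::ab_group_add)"
  by (auto simp: in_keys_iff lookup_minus)

lemma keys_qscale: "keys (qscale k x) \<subseteq> keys x"
  by (auto simp: in_keys_iff lookup_qscale)

lemma keys_sum_subset: "keys (\<Sum>i\<in>I. f i) \<subseteq> (\<Union>i\<in>I. keys (f i))"
proof
  fix k assume "k \<in> keys (\<Sum>i\<in>I. f i)"
  then have "(\<Sum>i\<in>I. lookup (f i) k) \<noteq> 0"
    by (simp add: in_keys_iff lookup_sum)
  then obtain i where "i \<in> I" "lookup (f i) k \<noteq> 0"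
    using sum.not_neutral_contains_not_neutral by blast
  then show "k \<in> (\<Union>i\<in>I. keys (f i))" by (auto simp: in_keys_iff)
qed

text \<open>The degree is an arbitrary function on the basis; it will be word length, number of
  letters b, or total degree of a monomial. Zero is homogeneous of every degree.\<close>

definition graded :: "('k \<Rightarrow> nat) \<Rightarrow> nat \<Rightarrow> ('k \<Rightarrow>\<^sub>0 rat) \<Rightarrow> bool" where
  "graded d n x \<longleftrightarrow> (\<forall>k\<in>keys x. d k = n)"

lemma graded_add: "graded d n x \<Longrightarrow> graded d n y \<Longrightarrow> graded d n (x + y)"
  using Poly_Mapping.keys_add[of x y] by (auto simp: graded_def)

lemma graded_diff: "graded d n x \<Longrightarrow> graded d n y \<Longrightarrow> graded d n (x - y)"
  using keys_diff_subset[of x y] by (auto simp: graded_def)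

lemma graded_uminus: "graded d n x \<Longrightarrow> graded d n (- x)"
  by (simp add: graded_def keys_uminus)

lemma graded_qscale: "graded d n x \<Longrightarrow> graded d n (qscale k x)"
  using keys_qscale[of k x] by (auto simp: graded_def)

lemma graded_zero [simp]: "graded d n 0"
  by (simp add: graded_def)

lemma graded_sum: "(\<And>i. i \<in> I \<Longrightarrow> graded d n (f i)) \<Longrightarrow> graded d n (\<Sum>i\<in>I. f i)"
  by (induction I rule: infinite_finite_induct) (auto intro: graded_add)

lemma graded_one: "d 0 = 0 \<Longrightarrow> graded d 0 1"
  by (simp add: graded_def)

lemma graded_mult:
  assumes "\<And>v w. d (v + w) = d v + d w" "graded d n x" "graded d m y"
  shows "graded d (n + m) (x * y)"
  using keys_mult[of x y] assms by (fastforce simp: graded_def)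

definition gpart :: "('k \<Rightarrow> nat) \<Rightarrow> nat \<Rightarrow> ('k \<Rightarrow>\<^sub>0 rat) \<Rightarrow> ('k \<Rightarrow>\<^sub>0 rat)" where
  "gpart d n = restr (\<lambda>k. d k = n)"

lemma additive_gpart: "additive (gpart d n)"
  unfolding gpart_def by (rule additive_restr)

lemma gpart_graded: "graded d m x \<Longrightarrow> gpart d n x = (if n = m then x else 0)"
  by (auto simp: gpart_def graded_def intro!: restr_id restr_0)

lemma gpart_idem: "graded d n x \<Longrightarrow> gpart d n x = x"
  by (simp add: gpart_graded)

lemma graded_gpart: "graded d n (gpart d n x)"
  by (simp add: graded_def gpart_def keys_restr)

lemma graded_gpart_other: "graded d n x \<Longrightarrow> graded d n (gpart e m x)"
  by (simp add: graded_def gpart_def keys_restr)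

section \<open>Derivations, divergence and stability of \<open>krv11\<close> under the
  bracket\<close>

section \<open>Derivations of the free algebra\<close>

lemma list_plus: "v + w = v @ w" for v w :: "'k list"
  by (simp add: plus_list_def)

lemma list_zero: "(0 :: 'k list) = []"
  by (simp add: zero_list_def)

abbreviation wrd :: "letter list \<Rightarrow> freealg" where
  "wrd w \<equiv> single w 1"

lemma single_mult_word:
  "single v c * single w d = single (v @ w) (c * d :: rat)"
  by (simp add: mult_single list_plus)

lemma comm_add_left: "comm (x + y) z = comm x z + comm y z"
  and comm_add_right: "comm x (y + z) = comm x y + comm x z"
  and comm_diff_left: "comm (x - y) z = comm x z - comm y z"
  and comm_diff_right: "comm x (y - z) = comm x y - comm x z"
  and comm_self: "comm x x = 0"
  and comm_antisym: "comm y x = - comm x y"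
  and comm_zero_left [simp]: "comm 0 x = 0"
  and comm_zero_right [simp]: "comm x 0 = 0"
  by (simp_all add: comm_def algebra_simps)

lemma comm_qscale_left: "comm (qscale k x) y = qscale k (comm x y)"
  and comm_qscale_right: "comm x (qscale k y) = qscale k (comm x y)"
  by (simp_all add: comm_def qscale_diff qscale_mult_left qscale_mult_right)

lemma comm_jacobi: "comm (comm x y) z = comm x (comm y z) - comm y (comm x z)"
  by (simp add: comm_def algebra_simps)

lemma additive_comm_right: "additive (comm x)"
  by (simp add: additive_def comm_add_right)

lemma lieL_zero: "0 \<in> lieL"
  using lieL.scale[OF lieL.gen_a, of 0] by simp

lemma lieL_uminus: "x \<in> lieL \<Longrightarrow> - x \<in> lieL"
  using lieL.scale[of x "-1"] by (simp add: qscale_neg_one)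

lemma lieL_diff: "x \<in> lieL \<Longrightarrow> y \<in> lieL \<Longrightarrow> x - y \<in> lieL"
  using lieL.add[of x "- y"] lieL_uminus by simp

lemma lieL_sum: "(\<And>i. i \<in> I \<Longrightarrow> f i \<in> lieL) \<Longrightarrow> (\<Sum>i\<in>I. f i) \<in> lieL"
  by (induction I rule: infinite_finite_induct) (auto simp: lieL_zero intro: lieL.add)

fun word_der :: "freealg \<Rightarrow> freealg \<Rightarrow> letter list \<Rightarrow> freealg" where
  "word_der f g [] = 0"
| "word_der f g (La # w) = f * wrd w + gen_a * word_der f g w"
| "word_der f g (Lb # w) = g * wrd w + gen_b * word_der f g w"

definition free_der :: "freealg \<Rightarrow> freealg \<Rightarrow> freealg \<Rightarrow> freealg" where
  "free_der f g = lin_ext (\<lambda>w c. qscale c (word_der f g w))"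

lemma additive_free_der: "additive (free_der f g)"
  unfolding free_der_def by (rule lin_ext_additive) (rule additive_qscale_left)

lemma free_der_single: "free_der f g (single w c) = qscale c (word_der f g w)"
  unfolding free_der_def by (rule lin_ext_single) (rule additive_qscale_left)

lemmas free_der_add = additive.add[OF additive_free_der]
lemmas free_der_diff = additive.diff[OF additive_free_der]

lemma free_der_qscale: "free_der f g (qscale k x) = qscale k (free_der f g x)"
  unfolding free_der_def by (rule lin_ext_qscale) (simp_all add: additive_intros)

lemma single_Nil_one [simp]: "single [] 1 = (1 :: 'k list \<Rightarrow>\<^sub>0 rat)"
  using single_one[where 'a="'k list" and 'b=rat] by (simp only: list_zero)

lemma word_der_append: "word_der f g (v @ w) = word_der f g v * wrd w + wrd v * word_der f g w"
proof (induction v)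
  case Nil
  then show ?case by simp
next
  case (Cons l v)
  have "wrd (v @ w) = wrd v * wrd w" "wrd (l # v) = wrd [l] * wrd v"
    by (simp_all add: single_mult_word)
  with Cons show ?case
    by (cases l) (simp_all add: algebra_simps gen_a_def gen_b_def)
qed

lemma single_conv_qscale: "single w c = qscale c (single w 1)"
  by simp

lemma free_der_mult: "free_der f g (x * y) = free_der f g x * y + x * free_der f g y"
proof (rule biadditive_eqI[where F="\<lambda>x y. free_der f g (x * y)"
      and G="\<lambda>x y. free_der f g x * y + x * free_der f g y"])
  fix v w :: "letter list" and c d :: rat
  show "free_der f g (single v c * single w d) =
     free_der f g (single v c) * single w d +
     single v c * free_der f g (single w d)"
    unfolding single_mult_word free_der_single word_der_append
    by (subst single_conv_qscale[of w d], subst single_conv_qscale[of v c])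
      (simp only: qscale_mult_left qscale_mult_right qscale_qscale qscale_add mult.commute)
qed (auto simp: additive_def algebra_simps free_der_add)

lemma free_der_comm: "free_der f g (comm x y) = comm (free_der f g x) y + comm x (free_der f g y)"
  by (simp add: comm_def free_der_diff free_der_mult)

lemma free_der_gen_a: "free_der f g gen_a = f"
  and free_der_gen_b: "free_der f g gen_b = g"
  by (simp_all add: gen_a_def gen_b_def free_der_single)

lemma free_der_lieL:
  assumes "x \<in> lieL" "f \<in> lieL" "g \<in> lieL"
  shows "free_der f g x \<in> lieL"
  using assms(1)
  by induction
    (auto simp: free_der_gen_a free_der_gen_b free_der_add free_der_qscale free_der_comm assms
      intro: lieL.intros)

section \<open>Derivations of the free Lie algebra\<close>

definition der_ext :: "freealg \<Rightarrow> freealg \<Rightarrow> freealg \<Rightarrow> freealg" where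
  "der_ext f g x = (if x \<in> lieL then free_der f g x else 0)"

lemma derivationsD:
  assumes "u \<in> derivations"
  shows "x \<notin> lieL \<Longrightarrow> u x = 0" "x \<in> lieL \<Longrightarrow> u x \<in> lieL"
    "x \<in> lieL \<Longrightarrow> y \<in> lieL \<Longrightarrow> u (x + y) = u x + u y"
    "x \<in> lieL \<Longrightarrow> u (qscale k x) = qscale k (u x)"
    "x \<in> lieL \<Longrightarrow> y \<in> lieL \<Longrightarrow> u (comm x y) = comm (u x) y + comm x (u y)"
  using assms by (auto simp: derivations_def)

lemma derivations_zero: "u \<in> derivations \<Longrightarrow> u 0 = 0"
  using derivationsD(4)[of u 0 0] lieL_zero by simp

lemma derivations_in: "u \<in> derivations \<Longrightarrow> u x \<in> lieL"
  using derivationsD(1,2)[of u x] lieL_zero by (cases "x \<in> lieL") auto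

lemma derivations_diff: "u \<in> derivations \<Longrightarrow> x \<in> lieL \<Longrightarrow> y \<in> lieL \<Longrightarrow> u (x - y) = u x - u y"
  using derivationsD(3)[of u x "- y"] derivationsD(4)[of u y "-1"] lieL_uminus[of y]
  by (simp add: qscale_neg_one)

lemma der_ext_derivations: "f \<in> lieL \<Longrightarrow> g \<in> lieL \<Longrightarrow> der_ext f g \<in> derivations"
  by (auto simp: derivations_def der_ext_def free_der_lieL lieL.intros
      free_der_add free_der_qscale free_der_comm)

text \<open>Induction over the generation of \<open>lieL\<close>: both sides obey the same rules for
  sums, multiples and brackets. Every derivation of L thus extends to the free algebra, where right
  coefficients and traces make sense.\<close>

lemma derivations_eq_der_ext:
  assumes "u \<in> derivations"
  shows "u = der_ext (u gen_a) (u gen_b)"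
proof
  fix x
  show "u x = der_ext (u gen_a) (u gen_b) x"
  proof (cases "x \<in> lieL")
    case True
    then show ?thesis
      by induction (auto simp: der_ext_def free_der_gen_a free_der_gen_b free_der_add
          free_der_qscale free_der_comm derivationsD[OF assms] lieL.intros)
  next
    case False
    then show ?thesis using derivationsD[OF assms] by (simp add: der_ext_def)
  qed
qed

lemma derivations_free_der: "u \<in> derivations \<Longrightarrow> x \<in> lieL \<Longrightarrow> u x = free_der (u gen_a) (u gen_b) x"
  using derivations_eq_der_ext[of u] by (metis der_ext_def)

lemma der_ext_gen [simp]: "der_ext f g gen_a = f" "der_ext f g gen_b = g"
  by (simp_all add: der_ext_def lieL.intros free_der_gen_a free_der_gen_b)

lemma gen_c_lieL: "gen_c \<in> lieL"
  by (simp add: gen_c_def lieL.intros)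

lemma derivations_gen_c: "u \<in> derivations \<Longrightarrow> u gen_c = comm (u gen_a) gen_b + comm gen_a (u gen_b)"
  by (simp add: gen_c_def derivationsD lieL.intros)

lemma derivations_eqI:
  "u \<in> derivations \<Longrightarrow> v \<in> derivations \<Longrightarrow> u gen_a = v gen_a \<Longrightarrow> u gen_b = v gen_b \<Longrightarrow> u = v"
  using derivations_eq_der_ext by metis

lemma derivations_add: "u \<in> derivations \<Longrightarrow> v \<in> derivations \<Longrightarrow> u + v \<in> derivations"
  by (auto simp: derivations_def lieL.intros qscale_add comm_add_left comm_add_right algebra_simps)

lemma derivations_scale: "u \<in> derivations \<Longrightarrow> der_scale k u \<in> derivations"
  by (auto simp: derivations_def der_scale_def lieL.intros qscale_add comm_qscale_left
      comm_qscale_right mult.commute)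

lemma derivations_zero_mem: "0 \<in> derivations"
  by (auto simp: derivations_def lieL_zero)

lemma derivations_bracket:
  assumes "u \<in> derivations" "v \<in> derivations"
  shows "der_bracket u v \<in> derivations"
proof -
  note d = derivationsD[OF assms(1)] derivationsD[OF assms(2)]
  show ?thesis
    by (auto simp: derivations_def der_bracket_def d lieL_diff lieL.intros derivations_zero assms
        qscale_diff comm_diff_left comm_diff_right comm_add_left comm_add_right algebra_simps)
qed

lemma der11_subspace: "der.subspace der11"
  unfolding der.subspace_def
  by (auto simp: der11_def derivations_zero_mem derivations_add derivations_scale)
    (simp add: der_scale_def)

lemma der11_bracket: "u \<in> der11 \<Longrightarrow> v \<in> der11 \<Longrightarrow> der_bracket u v \<in> der11"
  using derivations_bracket[of u v] by (auto simp: der11_def) (simp add: der_bracket_def derivations_zero)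

section \<open>Right coefficients\<close>

text \<open>A total, additive version of \<open>right_a\<close> and \<open>right_b\<close>: words
  that do not end in \<open>l\<close>, the empty word included, go to 0.\<close>

definition rcoef :: "letter \<Rightarrow> freealg \<Rightarrow> freealg" where
  "rcoef l = lin_ext (\<lambda>w c. single (butlast w) (if w \<noteq> [] \<and> last w = l then c else 0))"

lemma additive_rcoef: "additive (rcoef l)"
  unfolding rcoef_def by (rule lin_ext_additive) (rule additive_if_single)

lemma rcoef_single:
  "rcoef l (single w c) = (if w \<noteq> [] \<and> last w = l then single (butlast w) c else 0)"
  unfolding rcoef_def by (subst lin_ext_single) (auto simp: additive_if_single)

lemmas rcoef_add = additive.add[OF additive_rcoef]
lemmas rcoef_diff = additive.diff[OF additive_rcoef]
lemma rcoef_decomp: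
  "x = rcoef La x * gen_a + rcoef Lb x * gen_b + single [] (lookup x [])"
proof (rule additive_eqI[of "\<lambda>x. x"])
  fix w and c :: rat
  show "single w c = rcoef La (single w c) * gen_a +
     rcoef Lb (single w c) * gen_b +
     single [] (lookup (single w c) [])"
    by (cases w rule: rev_cases; cases "last w")
      (auto simp: rcoef_single gen_a_def gen_b_def single_mult_word lookup_single)
qed (auto simp: additive_def rcoef_add algebra_simps lookup_add single_add)

lemma lookup_mult_Nil:
  "lookup (x * y) [] = lookup x [] * lookup (y :: freealg) []"
  by (rule biadditive_eqI[where F="\<lambda>x y. lookup (x * y) []"
      and G="\<lambda>x y. lookup x [] * lookup y []"])
    (auto simp: additive_def algebra_simps lookup_add single_mult_word lookup_single when_def)

text \<open>The last letter of a product comes from \<open>y\<close>, except where \<open>y\<close>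
  contributes its constant term; this is Fox calculus on the right.\<close>

lemma rcoef_mult: "rcoef l (x * y) = x * rcoef l y + qscale (lookup y []) (rcoef l x)"
proof (rule biadditive_eqI[where F="\<lambda>x y. rcoef l (x * y)"
      and G="\<lambda>x y. x * rcoef l y + qscale (lookup y []) (rcoef l x)"])
  fix v w :: "letter list" and c d :: rat
  show "rcoef l (single v c * single w d) =
     single v c * rcoef l (single w d) +
     qscale (lookup (single w d) []) (rcoef l (single v c))"
    by (cases w rule: rev_cases)
      (auto simp: single_mult_word rcoef_single lookup_single butlast_append mult.commute)
qed (auto simp: additive_def algebra_simps rcoef_add lookup_add qscale_add qscale_left_add)

lemma lookup_gen_Nil [simp]: "lookup gen_a [] = 0" "lookup gen_b [] = 0"
  by (simp_all add: gen_a_def gen_b_def lookup_single)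

lemma rcoef_gen [simp]: "rcoef La gen_a = 1" "rcoef Lb gen_a = 0" "rcoef La gen_b = 0" "rcoef Lb gen_b = 1"
  by (simp_all add: gen_a_def gen_b_def rcoef_single)

lemma right_eq_rcoef:
  assumes "lookup f [] = 0"
  shows "right_a f = rcoef La f" "right_b f = rcoef Lb f"
proof -
  have ex: "f = rcoef La f * gen_a + rcoef Lb f * gen_b"
    using rcoef_decomp[of f] assms by simp
  have un: "p = rcoef La f \<and> q = rcoef Lb f" if "f = p * gen_a + q * gen_b" for p q
    unfolding that by (simp add: rcoef_add rcoef_mult)
  show "right_a f = rcoef La f"
    unfolding right_a_def by (rule the_equality) (use ex un in blast)+
  show "right_b f = rcoef Lb f"
    unfolding right_b_def by (rule the_equality) (use ex un in blast)+
qed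

lemma lieL_noconst: "x \<in> lieL \<Longrightarrow> lookup x [] = 0"
  by (induction rule: lieL.induct)
    (simp_all add: lookup_add lookup_qscale comm_def lookup_minus lookup_mult_Nil)

definition div_rep :: "freealg \<Rightarrow> freealg \<Rightarrow> freealg" where
  "div_rep f g = rcoef La f + rcoef Lb g"

lemma divergence_eq:
  "u \<in> derivations \<Longrightarrow> divergence u = tr (div_rep (u gen_a) (u gen_b))"
  by (simp add: divergence_def div_rep_def right_eq_rcoef lieL_noconst derivations_in)

section \<open>Cyclic words\<close>

lemma tr_eq_lin_ext: "tr = lin_ext (\<lambda>w c. single (abs_cyclic_word w) c)"
  by (rule ext) (simp add: tr_def lin_ext_def)

lemma additive_tr: "additive tr"
  unfolding tr_eq_lin_ext by (rule lin_ext_additive) (rule additive_single)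

lemma tr_single: "tr (single w c) = single (abs_cyclic_word w) c"
  unfolding tr_eq_lin_ext by (rule lin_ext_single) (rule additive_single)

lemmas tr_add = additive.add[OF additive_tr]
lemmas tr_diff = additive.diff[OF additive_tr]

lemma tr_qscale: "tr (qscale k x) = qscale k (tr x)"
  unfolding tr_eq_lin_ext by (rule lin_ext_qscale) (auto simp: additive_single additive_qscale)

lemma abs_cyclic_rotate: "abs_cyclic_word (rotate k w) = abs_cyclic_word w"
  using cyclic_word.abs_eq_iff by metis

lemma abs_cyclic_append: "abs_cyclic_word (v @ w) = abs_cyclic_word (w @ v)"
  by (metis abs_cyclic_rotate rotate_append)

lemma tr_mult_commute: "tr (x * y) = tr (y * x)"
  by (rule biadditive_eqI[where F="\<lambda>x y. tr (x * y)" and G="\<lambda>x y. tr (y * x)"])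
    (auto simp: additive_def algebra_simps tr_add single_mult_word tr_single abs_cyclic_append)

text \<open>Such an \<open>L\<close> is constant on cyclic classes, hence factors through
  \<open>tr\<close>: the factor \<open>h\<close> evaluates \<open>L\<close> at a representative of
  each class.\<close>

lemma rotation_invariant_tr_zero:
  assumes L: "additive L"
    and rot: "\<And>l w c. L (single (w @ [l]) c) = L (single (l # w) c)"
    and tr: "tr x = 0"
  shows "L x = 0"
proof -
  have rot1: "L (single (rotate1 w) c) = L (single w c)" for w c
    by (cases w) (simp_all add: rot)
  have rotk: "L (single (rotate k w) c) = L (single w c)" for k w c
    by (induction k) (simp_all add: rot1)
  define h where "h C c = L (single (rep_cyclic_word C) c)" for C c
  have h: "h (abs_cyclic_word w) c = L (single w c)" for w c
  proof -
    have "\<exists>k. rep_cyclic_word (abs_cyclic_word w) = rotate k w"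
      using rep_abs_rsp_left[OF Quotient3_cyclic_word] 
      by (metis (no_types, lifting) Quotient3_abs_rep Quotient3_cyclic_word cyclic_word.abs_eq_iff)
    then show ?thesis by (auto simp: h_def rotk)
  qed
  have ah: "additive (h C)" for C
    unfolding h_def using additive_comp[OF L additive_single] .
  have "L x = lin_ext h (tr x)"
    by (rule additive_eqI[OF L additive_comp[OF lin_ext_additive additive_tr]])
      (simp_all add: ah tr_single lin_ext_single h)
  then show ?thesis
    by (simp add: tr additive.zero[OF lin_ext_additive[OF ah]])
qed

text \<open>The words w l and l w differ by a commutator, and a derivation sends a commutator to a
  sum of commutators, which the trace kills.\<close>

lemma tr_free_der:
  assumes "tr x = 0"
  shows "tr (free_der f g x) = 0"
proof (rule rotation_invariant_tr_zero[OF additive_comp[OF additive_tr additive_free_der] _ assms])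
  fix l :: letter and w and c :: rat
  have "single (w @ [l]) c = single w c * single [l] 1"
    "single (l # w) c = single [l] 1 * single w c"
    using single_mult_word[of w "c :: rat" "[l]" 1] single_mult_word[of "[l]" 1 w c] by auto
  then show "tr (free_der f g (single (w @ [l]) c)) =
             tr (free_der f g (single (l # w) c))"
    by (simp add: free_der_mult tr_add tr_mult_commute add.commute)
qed

section \<open>The divergence cocycle\<close>

text \<open>Write y = y_a a + y_b b and apply the Leibniz rule; the right coefficients of f and g
  enter through the differentiated last letter.\<close>

lemma rcoef_free_der:
  assumes "lookup y [] = 0" "lookup f [] = 0" "lookup g [] = 0"
  shows "rcoef l (free_der f g y) = free_der f g (rcoef l y) + rcoef La y * rcoef l f + rcoef Lb y * rcoef l g"
proof -
  have "free_der f g y = free_der f g (rcoef La y * gen_a + rcoef Lb y * gen_b)"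
    using rcoef_decomp[of y] assms(1) by simp
  then show ?thesis
    by (cases l) (simp_all add: free_der_add free_der_mult free_der_gen_a free_der_gen_b rcoef_add
      rcoef_mult assms algebra_simps)
qed

text \<open>By \<open>rcoef_free_der\<close> the bracket also produces products of right
  coefficients of u and of v. Under the trace their sum is symmetric in u and v, so these terms
  cancel.\<close>

lemma div_rep_bracket:
  assumes "u \<in> derivations" "v \<in> derivations"
  defines "D w \<equiv> div_rep (w gen_a) (w gen_b)"
  shows "tr (D (der_bracket u v)) =
    tr (free_der (u gen_a) (u gen_b) (D v)) - tr (free_der (v gen_a) (v gen_b) (D u))"
proof -
  have n: "lookup (w x) [] = 0" if "w = u \<or> w = v" for w x
    using that assms(1,2) derivations_in lieL_noconst by blast
  have e: "u (v x) = free_der (u gen_a) (u gen_b) (v x)" "v (u x) = free_der (v gen_a) (v gen_b) (u x)" for x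
    using derivations_free_der derivations_in assms(1,2) by auto
  show ?thesis
    unfolding D_def div_rep_def der_bracket_def e rcoef_diff
    by (simp add: rcoef_free_der n free_der_add tr_add tr_diff tr_mult_commute algebra_simps)
qed

abbreviation weight :: "nat \<Rightarrow> freealg \<Rightarrow> bool" where
  "weight \<equiv> graded length"

lemma weight_mult: "weight n x \<Longrightarrow> weight m y \<Longrightarrow> weight (n + m) (x * y)"
  by (rule graded_mult) (simp_all add: list_plus)

lemma weight_gen: "weight 1 gen_a" "weight 1 gen_b"
  by (auto simp: graded_def gen_a_def gen_b_def)

text \<open>One letter is replaced by n letters. For the empty word the truncated subtraction is
  harmless, because \<open>word_der\<close> is 0 there.\<close>

lemma weight_word_der:
  assumes "weight n f" "weight n g"
  shows "weight (length w + n - 1) (word_der f g w)"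
proof (induction w)
  case Nil
  then show ?case by (simp add: graded_zero)
next
  case (Cons l w)
  have w: "weight (length w) (wrd w)" by (simp add: graded_def)
  have "weight (length (l # w) + n - 1) (h * wrd w)" if "weight n h" for h
    using weight_mult[OF that w] by (simp add: add.commute)
  moreover have "weight (length (l # w) + n - 1) (h * word_der f g w)" if "weight 1 h" for h
  proof (cases "w = []")
    case False
    then show ?thesis using weight_mult[OF that Cons.IH] by (cases w) auto
  qed (simp add: graded_zero)
  ultimately show ?case
    using assms weight_gen by (cases l) (auto intro!: graded_add)
qed

lemma weight_free_der:
  assumes "weight n f" "weight n g" "weight m x"
  shows "weight (m + n - 1) (free_der f g x)"
  unfolding free_der_def lin_ext_def
proof (rule graded_sum)
  fix k assume "k \<in> keys x"
  then have "length k = m" using assms(3) by (simp add: graded_def)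
  then show "weight (m + n - 1) (qscale (lookup x k) (word_der f g k))"
    using weight_word_der[OF assms(1,2), of k] by (simp add: graded_qscale)
qed

lemma lieL_wt_iff: "x \<in> lieL_wt n \<longleftrightarrow> x \<in> lieL \<and> weight n x"
  by (simp add: lieL_wt_def graded_def)

lemma der11_wt_bracket:
  assumes "u \<in> der11_wt n" "v \<in> der11_wt m"
  shows "der_bracket u v \<in> der11_wt (n + m - 1)"
proof -
  have d: "u \<in> derivations" "v \<in> derivations"
    using assms by (auto simp: der11_wt_def der11_def)
  have w: "weight n (u gen_a)" "weight n (u gen_b)" "weight m (v gen_a)" "weight m (v gen_b)"
    using assms by (auto simp: der11_wt_def lieL_wt_iff)
  have "weight (n + m - 1) (der_bracket u v x)" if "x = gen_a \<or> x = gen_b" for x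
    unfolding der_bracket_def
    using that w weight_free_der[OF w(1,2), of m "v x"] weight_free_der[OF w(3,4), of n "u x"]
    by (auto simp: derivations_free_der d derivations_in add.commute intro!: graded_diff)
  moreover have "der_bracket u v \<in> der11"
    using assms by (simp add: der11_wt_def der11_bracket)
  ultimately show ?thesis
    using derivations_in[OF derivations_bracket[OF d]] by (simp add: der11_wt_def lieL_wt_iff)
qed

lemma free_der_gen_c_power:
  assumes "free_der f g gen_c = 0"
  shows "free_der f g (gen_c ^ k) = 0"
proof (induction k)
  case 0
  have "free_der f g (single [] 1) = 0" by (simp only: free_der_single) simp
  then show ?case by simp
qed (simp add: free_der_mult assms)

text \<open>The parity split of the definition is folded into one clause: in even weight the
  constant is forced to be 0.\<close>

definition krv_gens :: "nat \<Rightarrow> (freealg \<Rightarrow> freealg) set" where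
  "krv_gens n = {u \<in> der11_wt n.
     \<exists>K. (even n \<longrightarrow> K = 0) \<and> divergence u = qscale K (tr (gen_c ^ ((n - 1) div 2)))}"

lemma krv11_eq: "krv11 = der.span (\<Union>n\<in>{3..}. krv_gens n)"
proof -
  have "(if odd n then \<exists>K. divergence u = qscale K (tr (gen_c ^ ((n - 1) div 2))) else divergence u = 0)
    \<longleftrightarrow> (\<exists>K. (even n \<longrightarrow> K = 0) \<and> divergence u = qscale K (tr (gen_c ^ ((n - 1) div 2))))" for n u
    by auto
  then have "{u. \<exists>n \<ge> 3. u \<in> der11_wt n \<and>
     (if odd n then \<exists>K. divergence u = qscale K (tr (gen_c ^ ((n - 1) div 2)))
      else divergence u = 0)} = (\<Union>n\<in>{3..}. krv_gens n)"
    by (auto simp: krv_gens_def)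
  then show ?thesis by (simp only: krv11_def)
qed

text \<open>The bracket even has divergence 0. Modulo traceless elements, which a derivation
  preserves, the divergence of v is a multiple of a power of c, and u kills c; the cocycle rule then
  leaves nothing.\<close>

lemma krv_gens_bracket:
  assumes "u \<in> krv_gens n" "v \<in> krv_gens m" "n \<ge> 3" "m \<ge> 3"
  shows "der_bracket u v \<in> krv_gens (n + m - 1)"
proof -
  have *: "tr (free_der (u gen_a) (u gen_b) (div_rep (v gen_a) (v gen_b))) = 0"
    if "u \<in> krv_gens n" "v \<in> krv_gens m" for u v n m
  proof -
    from that obtain K where d: "u \<in> derivations" "u gen_c = 0" "v \<in> derivations"
      and K: "divergence v = qscale K (tr (gen_c ^ ((m - 1) div 2)))"
      by (auto simp: krv_gens_def der11_wt_def der11_def)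
    let ?c = "gen_c ^ ((m - 1) div 2)"
    have "tr (div_rep (v gen_a) (v gen_b) - qscale K ?c) = 0"
      using K d by (simp add: divergence_eq tr_diff tr_qscale)
    then have "tr (free_der (u gen_a) (u gen_b) (div_rep (v gen_a) (v gen_b) - qscale K ?c)) = 0"
      by (rule tr_free_der)
    moreover have "free_der (u gen_a) (u gen_b) gen_c = 0"
      using d derivations_free_der[OF d(1) gen_c_lieL] by simp
    then have "free_der (u gen_a) (u gen_b) (qscale K ?c) = 0"
      by (simp add: free_der_qscale free_der_gen_c_power)
    ultimately show ?thesis by (simp add: free_der_diff tr_diff additive.zero[OF additive_tr])
  qed
  have d: "u \<in> der11_wt n" "v \<in> der11_wt m" "u \<in> derivations" "v \<in> derivations"
    using assms by (auto simp: krv_gens_def der11_wt_def der11_def)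
  have "divergence (der_bracket u v) = 0"
    using d *[OF assms(1,2)] *[OF assms(2,1)]
    by (simp add: divergence_eq derivations_bracket div_rep_bracket)
  then show ?thesis
    using der11_wt_bracket[OF d(1,2)] by (auto simp: krv_gens_def intro: exI[of _ 0])
qed

lemma krv11_der11: "krv11 \<subseteq> der11"
  unfolding krv11_eq by (rule der.span_minimal) (auto simp: krv_gens_def der11_wt_def der11_subspace)

lemma krv11_derivations: "u \<in> krv11 \<Longrightarrow> u \<in> derivations"
  using krv11_der11 by (auto simp: der11_def)

lemma der_bracket_add_left:
  "v \<in> derivations \<Longrightarrow> u \<in> derivations \<Longrightarrow> u' \<in> derivations \<Longrightarrow>
    der_bracket (u + u') v = der_bracket u v + der_bracket u' v"
  by (rule ext) (simp add: der_bracket_def derivationsD derivations_in)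

lemma der_bracket_scale_left:
  "v \<in> derivations \<Longrightarrow> u \<in> derivations \<Longrightarrow> der_bracket (der_scale k u) v = der_scale k (der_bracket u v)"
  by (rule ext) (simp add: der_bracket_def der_scale_def derivationsD derivations_in qscale_diff)

lemma der_bracket_antisym: "der_bracket v u = der_scale (-1) (der_bracket u v)"
  by (rule ext) (simp add: der_bracket_def der_scale_def qscale_neg_one)

lemma der_bracket_zero_left: "v \<in> derivations \<Longrightarrow> der_bracket 0 v = 0"
  by (rule ext) (simp add: der_bracket_def derivations_zero)

lemma krv11_bracket:
  assumes "u \<in> krv11" "v \<in> krv11"
  shows "der_bracket u v \<in> krv11"
proof -
  \<comment> \<open>Linearity in the first argument reduces to generators; together with
    antisymmetry it is used for each argument in turn.\<close>
  have lin: "der_bracket u v \<in> krv11"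
    if "u \<in> krv11" "v \<in> derivations" "\<And>u n. u \<in> krv_gens n \<Longrightarrow> n \<ge> 3 \<Longrightarrow> der_bracket u v \<in> krv11" for u v
  proof -
    let ?S = "{u \<in> derivations. der_bracket u v \<in> krv11}"
    have "der.subspace ?S"
      unfolding der.subspace_def using that(2)
      by (auto simp: derivations_zero_mem derivations_add derivations_scale der_bracket_add_left
          der_bracket_scale_left der_bracket_zero_left krv11_eq der.span_add der.span_scale der.span_zero)
    moreover have "(\<Union>n\<in>{3..}. krv_gens n) \<subseteq> ?S"
      using that(3) by (auto simp: krv_gens_def der11_wt_def der11_def)
    ultimately have "krv11 \<subseteq> ?S"
      unfolding krv11_eq by (rule der.span_minimal[rotated])
    then show ?thesis using that(1) by auto
  qed
  show ?thesis
  proof (rule lin[OF assms(1) krv11_derivations[OF assms(2)]])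
    fix u' n assume u': "u' \<in> krv_gens n" "n \<ge> (3::nat)"
    then have d: "u' \<in> derivations" by (auto simp: krv_gens_def der11_wt_def der11_def)
    have "der_bracket v u' \<in> krv11"
    proof (rule lin[OF assms(2) d])
      fix v' m assume "v' \<in> krv_gens m" "m \<ge> (3::nat)"
      then show "der_bracket v' u' \<in> krv11"
        using krv_gens_bracket[of v' m u' n] u' unfolding krv11_eq
        by (intro der.span_base) (auto intro!: bexI[of _ "m + n - 1"])
    qed
    then show "der_bracket u' v \<in> krv11"
      unfolding krv11_eq by (subst der_bracket_antisym) (rule der.span_scale)
  qed
qed

lemma lie_algebra_krv11: "lie_algebra_on der_scale krv11 der_bracket"
proof -
  have sub: "der.subspace krv11" by (simp add: krv11_eq)
  have r: "der_bracket u (v + w) = der_bracket u v + der_bracket u w"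
    if "u \<in> krv11" "v \<in> krv11" "w \<in> krv11" for u v w
    by (rule ext) (simp add: der_bracket_def that[THEN krv11_derivations] derivationsD derivations_in)
  have rs: "der_bracket u (der_scale k v) = der_scale k (der_bracket u v)"
    if "u \<in> krv11" "v \<in> krv11" for u v k
    by (rule ext) (simp add: der_bracket_def der_scale_def that[THEN krv11_derivations] derivationsD derivations_in qscale_diff)
  have j: "der_bracket u (der_bracket v w) + der_bracket v (der_bracket w u) + der_bracket w (der_bracket u v) = 0"
    if "u \<in> krv11" "v \<in> krv11" "w \<in> krv11" for u v w
    by (rule ext) (simp add: der_bracket_def that[THEN krv11_derivations] derivations_diff derivations_in)
  show ?thesis
    unfolding lie_algebra_on_def
    using sub krv11_bracket r rs j
    by (auto simp: der.vector_space_axioms der_bracket_add_left der_bracket_scale_left krv11_derivations)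
      (auto simp: der_bracket_def fun_eq_iff)
qed

section \<open>Commutative polynomials and substitution in rational functions\<close>

section \<open>Evaluation of polynomials\<close>

definition mpow :: "(nat \<Rightarrow> 'c::comm_ring_1) \<Rightarrow> (nat \<Rightarrow>\<^sub>0 nat) \<Rightarrow> 'c" where
  "mpow s m = (\<Prod>i\<in>keys m. s i ^ lookup m i)"

lemma mpow_superset:
  "finite S \<Longrightarrow> keys m \<subseteq> S \<Longrightarrow> mpow s m = (\<Prod>i\<in>S. s i ^ lookup m i)"
  unfolding mpow_def by (rule prod.mono_neutral_left) (auto simp: in_keys_iff)

lemma mpow_zero [simp]: "mpow s 0 = 1"
  by (simp add: mpow_def)

lemma mpow_add: "mpow s (m + n) = mpow s m * mpow s n"
proof -
  let ?S = "keys m \<union> keys n"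
  have "keys (m + n) \<subseteq> ?S" by (rule Poly_Mapping.keys_add)
  then show ?thesis
    by (simp add: mpow_superset[of ?S] lookup_add power_add prod.distrib)
qed

lemma mpow_single [simp]: "mpow s (single i k) = s i ^ k"
  by (simp add: mpow_superset[of "{i}"])

lemma mpow_cong: "(\<And>i. i \<in> keys m \<Longrightarrow> s i = t i) \<Longrightarrow> mpow s m = mpow t m"
  by (simp add: mpow_def)

definition Xv :: "nat \<Rightarrow> mpoly" where
  "Xv i = single (single i 1) 1"

abbreviation Cst :: "rat \<Rightarrow> mpoly" where
  "Cst c \<equiv> single 0 c"

lemma Xv_power: "Xv i ^ k = single (single i k) 1"
  by (induction k) (simp_all add: Xv_def mult_single flip: single_add)

lemma prod_single:
  "(\<Prod>i\<in>S. single (f i) 1) = (single (\<Sum>i\<in>S. f i) 1 :: mpoly)"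
  by (induction S rule: infinite_finite_induct) (simp_all add: mult_single)

lemma mpow_Xv: "mpow Xv m = single m 1"
  by (simp add: mpow_def Xv_power prod_single sum_singles)

text \<open>Two instances occur: constants in the field of rational functions, giving
  \<open>poly_eval\<close>, and constants in the polynomial ring, giving the substitution
  \<open>sub\<close>.\<close>

locale rat_hom =
  fixes h :: "rat \<Rightarrow> 'c::comm_ring_1"
  assumes h_add: "h (x + y) = h x + h y" and h_mult: "h (x * y) = h x * h y" and h_one: "h 1 = 1"
begin

definition evl :: "(nat \<Rightarrow> 'c) \<Rightarrow> mpoly \<Rightarrow> 'c" where
  "evl s = lin_ext (\<lambda>m c. h c * mpow s m)"

lemma additive_term: "additive (\<lambda>c. h c * mpow s m)"
  by (simp add: additive_def h_add algebra_simps)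

lemma additive_evl: "additive (evl s)"
  unfolding evl_def by (rule lin_ext_additive) (rule additive_term)

lemma evl_single: "evl s (single m c) = h c * mpow s m"
  unfolding evl_def by (rule lin_ext_single) (rule additive_term)

lemmas evl_add = additive.add[OF additive_evl]
lemmas evl_diff = additive.diff[OF additive_evl]
lemmas evl_uminus = additive.minus[OF additive_evl]
lemmas evl_sum = additive.sum[OF additive_evl]
lemmas evl_zero = additive.zero[OF additive_evl]

lemma evl_mult: "evl s (p * q) = evl s p * evl s q"
  by (rule biadditive_eqI[where F="\<lambda>p q. evl s (p * q)" and G="\<lambda>p q. evl s p * evl s q"])
    (auto simp: additive_def algebra_simps evl_add mult_single evl_single h_mult mpow_add)

lemma evl_Cst: "evl s (Cst c) = h c"
  by (simp add: evl_single)

lemma evl_Xv: "evl s (Xv i) = s i"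
  by (simp add: Xv_def evl_single h_one)

lemma evl_one: "evl s 1 = 1"
  using evl_Cst[of s 1] by (simp add: h_one)

lemma evl_prod: "evl s (\<Prod>i\<in>I. f i) = (\<Prod>i\<in>I. evl s (f i))"
  by (induction I rule: infinite_finite_induct) (auto simp: evl_one evl_mult)

lemma evl_qscale: "evl s (qscale c p) = h c * evl s p"
  by (simp add: qscale_conv_mult evl_mult evl_Cst)

text \<open>The universal property of the polynomial ring; every rule for composing evaluations and
  substitutions is an instance.\<close>

lemma evl_unique:
  assumes "additive G" "\<And>p q. G (p * q) = G p * G q" "\<And>c. G (Cst c) = h c"
  shows "G p = evl (\<lambda>i. G (Xv i)) p"
proof (rule additive_eqI[OF assms(1) additive_evl])
  fix m c
  have one: "G 1 = 1" using assms(3)[of 1] by (simp add: h_one)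
  have pow: "G (x ^ k) = G x ^ k" for x k
    by (induction k) (simp_all add: one assms(2))
  have "G (prod f S) = (\<Prod>i\<in>S. G (f i))" for f and S :: "nat set"
    by (induction S rule: infinite_finite_induct) (simp_all add: one assms(2))
  then have "G (mpow Xv m) = mpow (\<lambda>i. G (Xv i)) m"
    by (simp add: mpow_def pow)
  moreover have "single m c = Cst c * mpow Xv m"
    by (simp add: mpow_Xv mult_single)
  ultimately have "G (single m c) = h c * mpow (\<lambda>i. G (Xv i)) m"
    by (simp only: assms)
  then show "G (single m c) = evl (\<lambda>i. G (Xv i)) (single m c)"
    by (simp only: evl_single)
qed

lemma evl_cong:
  assumes "\<And>i. i \<in> mvars p \<Longrightarrow> s i = t i"
  shows "evl s p = evl t p"
proof (rule additive_eqI[OF additive_evl additive_evl])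
  fix m c assume "m \<in> keys p"
  then have "mpow s m = mpow t m"
    using assms by (intro mpow_cong) (auto simp: mvars_def)
  then show "evl s (single m c) = evl t (single m c)"
    by (simp add: evl_single)
qed

end

interpretation rf: rat_hom rf_const
  by standard (simp_all add: rf_const_def single_add mult_single One_fract_def)

interpretation cst: rat_hom Cst
  by standard (simp_all add: single_add mult_single)

lemma poly_eval_eq: "poly_eval = rf.evl"
  by (intro ext) (simp add: poly_eval_def rf.evl_def lin_ext_def mpow_def)

abbreviation sub :: "(nat \<Rightarrow> mpoly) \<Rightarrow> mpoly \<Rightarrow> mpoly" where
  "sub \<equiv> cst.evl"

lemmas poly_eval_simps = rf.evl_add[folded poly_eval_eq] rf.evl_diff[folded poly_eval_eq]
  rf.evl_uminus[folded poly_eval_eq] rf.evl_sum[folded poly_eval_eq] rf.evl_zero[folded poly_eval_eq]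
  rf.evl_mult[folded poly_eval_eq] rf.evl_Cst[folded poly_eval_eq] rf.evl_Xv[folded poly_eval_eq]
  rf.evl_one[folded poly_eval_eq] rf.evl_prod[folded poly_eval_eq]  rf.evl_qscale[folded poly_eval_eq]
lemmas additive_poly_eval = rf.additive_evl[folded poly_eval_eq]
lemmas poly_eval_single = rf.evl_single[folded poly_eval_eq]
lemmas poly_eval_unique = rf.evl_unique[folded poly_eval_eq]
lemmas poly_eval_cong = rf.evl_cong[folded poly_eval_eq]
lemmas sub_simps = cst.evl_add cst.evl_diff cst.evl_uminus cst.evl_sum cst.evl_zero
  cst.evl_mult cst.evl_Cst cst.evl_Xv cst.evl_one cst.evl_prod cst.evl_qscale

definition frp :: "mpoly \<Rightarrow> ratfun" where
  "frp p = Fract p 1"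

lemma frp_eq_iff [simp]: "frp p = frp q \<longleftrightarrow> p = q"
  by (simp add: eq_fract frp_def)

lemma frp_eq_0_iff [simp]: "frp p = 0 \<longleftrightarrow> p = 0"
  by (simp add: Zero_fract_def eq_fract frp_def)

lemma frp_add: "frp (p + q) = frp p + frp q"
  and frp_mult: "frp (p * q) = frp p * frp q"
  and frp_diff: "frp (p - q) = frp p - frp q"
  and frp_uminus: "frp (- p) = - frp p"
  and frp_zero: "frp 0 = 0"
  and frp_one: "frp 1 = 1"
  by (simp_all add: Zero_fract_def One_fract_def frp_def)

lemma additive_frp: "additive frp"
  by (simp add: additive_def frp_add)

lemmas frp_sum = additive.sum[OF additive_frp]

lemma frp_prod: "frp (\<Prod>i\<in>I. f i) = (\<Prod>i\<in>I. frp (f i))"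
  by (induction I rule: infinite_finite_induct) (simp_all add: frp_one frp_mult)

lemma frp_Cst: "frp (Cst c) = rf_const c"
  and frp_Xv: "frp (Xv i) = uvar i"
  by (simp_all add: rf_const_def uvar_def frp_def Xv_def)

lemma frp_qscale: "frp (qscale c p) = rf_const c * frp p"
  by (simp add: qscale_conv_mult frp_mult frp_Cst)

lemmas frp_simps = frp_add frp_mult frp_diff frp_uminus frp_zero frp_one frp_sum frp_prod frp_Cst
  frp_Xv frp_qscale

lemma poly_of_frp [simp]: "poly_of (frp p) = p"
  unfolding poly_of_def by (rule the_equality) (auto simp flip: frp_def)

lemma rf_const_simps: "rf_const 0 = 0" "rf_const 1 = 1" "rf_const (- c) = - rf_const c"
  by (simp_all add: rf_const_def Zero_fract_def One_fract_def single_uminus)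

lemma poly_eval_frp: "poly_eval (\<lambda>i. frp (s i)) p = frp (sub s p)"
  by (subst poly_eval_unique[where G="\<lambda>p. frp (sub s p)"])
    (simp_all add: additive_def sub_simps frp_simps)

lemma poly_eval_sub: "poly_eval t (sub s p) = poly_eval (\<lambda>i. poly_eval t (s i)) p"
  by (subst poly_eval_unique[where G="\<lambda>p. poly_eval t (sub s p)"])
    (simp_all add: additive_def sub_simps poly_eval_simps)

lemma sub_sub: "sub t (sub s p) = sub (\<lambda>i. sub t (s i)) p"
  by (subst cst.evl_unique[where G="\<lambda>p. sub t (sub s p)"])
    (simp_all add: additive_def sub_simps)

lemma sub_Xv: "sub Xv p = p"
  by (subst cst.evl_unique[where G="\<lambda>p. p", symmetric]) (simp_all add: additive_def)

lemma poly_eval_uvar: "poly_eval uvar p = frp p"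
  using poly_eval_frp[of Xv p] by (simp add: sub_Xv frp_Xv)

section \<open>Substitution in rational functions\<close>

text \<open>Two representations satisfy p q' = p' q; evaluating this identity shows that the
  quotients agree, so the definite description in \<open>rf_eval\<close> has exactly one
  solution.\<close>

lemma rf_eval_Fract:
  assumes "poly_eval s q \<noteq> 0"
  shows "rf_eval s (Fract p q) = poly_eval s p / poly_eval s q"
  unfolding rf_eval_def
proof (rule the_equality)
  show "\<exists>p' q'. Fract p q = Fract p' q' \<and> poly_eval s q' \<noteq> 0 \<and>
          poly_eval s p / poly_eval s q = poly_eval s p' / poly_eval s q'"
    using assms by blast
next
  fix y assume "\<exists>p' q'. Fract p q = Fract p' q' \<and> poly_eval s q' \<noteq> 0 \<and> y = poly_eval s p' / poly_eval s q'"
  then obtain p' q' where *: "Fract p q = Fract p' q'" "poly_eval s q' \<noteq> 0"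
    "y = poly_eval s p' / poly_eval s q'" by blast
  have "q \<noteq> 0" "q' \<noteq> 0" using assms *(2) by (auto simp: poly_eval_simps)
  then have "p * q' = p' * q" using *(1) by (simp add: eq_fract)
  then have "poly_eval s (p * q') = poly_eval s (p' * q)" by simp
  then show "y = poly_eval s p / poly_eval s q"
    using *(2,3) assms by (simp add: poly_eval_simps frac_eq_eq)
qed

lemma rf_eval_frp: "rf_eval s (frp p) = poly_eval s p"
  unfolding frp_def by (subst rf_eval_Fract) (simp_all add: poly_eval_simps)

text \<open>No nonzero denominator is sent to 0, so under such a substitution \<open>rf_eval\<close>
  is a field homomorphism.\<close>

definition good_subst :: "(nat \<Rightarrow> ratfun) \<Rightarrow> bool" where
  "good_subst s \<longleftrightarrow> (\<forall>q. q \<noteq> 0 \<longrightarrow> poly_eval s q \<noteq> 0)"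

text \<open>A polynomial substitution with a left inverse is injective, hence cannot annihilate a
  denominator.\<close>

lemma good_substI:
  assumes "\<And>i. s i = frp (s' i)" "\<And>i. sub t (s' i) = Xv i"
  shows "good_subst s"
  unfolding good_subst_def
proof (intro allI impI)
  fix q :: mpoly assume "q \<noteq> 0"
  have "sub t (sub s' q) = q" by (simp add: sub_sub assms(2) sub_Xv)
  with \<open>q \<noteq> 0\<close> have "sub s' q \<noteq> 0" by (auto simp: sub_simps)
  moreover have "poly_eval s q = frp (sub s' q)"
    using poly_eval_frp[of s' q] by (simp only: assms(1)[symmetric])
  ultimately show "poly_eval s q \<noteq> 0" by simp
qed

context
  fixes s assumes good: "good_subst s"
begin

lemma rf_eval_Fract_good: "q \<noteq> 0 \<Longrightarrow> rf_eval s (Fract p q) = poly_eval s p / poly_eval s q"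
  using good by (intro rf_eval_Fract) (auto simp: good_subst_def)

lemma rf_eval_add: "rf_eval s (x + y) = rf_eval s x + rf_eval s y"
proof (cases x; cases y)
  fix a b c d :: mpoly assume "x = Fract a b" "b \<noteq> 0" "y = Fract c d" "d \<noteq> 0"
  moreover from this good have "poly_eval s b \<noteq> 0" "poly_eval s d \<noteq> 0" by (auto simp: good_subst_def)
  ultimately show ?thesis by (simp add: rf_eval_Fract_good poly_eval_simps field_simps)
qed

lemma rf_eval_mult: "rf_eval s (x * y) = rf_eval s x * rf_eval s y"
proof (cases x; cases y)
  fix a b c d :: mpoly assume "x = Fract a b" "b \<noteq> 0" "y = Fract c d" "d \<noteq> 0"
  moreover from this good have "poly_eval s b \<noteq> 0" "poly_eval s d \<noteq> 0" by (auto simp: good_subst_def)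
  ultimately show ?thesis by (simp add: rf_eval_Fract_good poly_eval_simps field_simps)
qed

lemma additive_rf_eval: "additive (rf_eval s)"
  by (simp add: additive_def rf_eval_add)

lemma rf_eval_one: "rf_eval s 1 = 1"
  using rf_eval_frp[of s 1] by (simp add: frp_one poly_eval_simps)

lemma rf_eval_inverse: "rf_eval s (inverse x) = inverse (rf_eval s x)"
proof (cases "x = 0")
  case True
  then show ?thesis using additive.zero[OF additive_rf_eval] by simp
next
  case False
  then have "rf_eval s x * rf_eval s (inverse x) = 1"
    by (simp add: rf_eval_one flip: rf_eval_mult)
  then show ?thesis by (metis inverse_unique)
qed

lemma rf_eval_divide: "rf_eval s (x / y) = rf_eval s x / rf_eval s y"
  by (simp add: divide_inverse rf_eval_mult rf_eval_inverse)

lemma rf_eval_prod: "rf_eval s (\<Prod>i\<in>I. f i) = (\<Prod>i\<in>I. rf_eval s (f i))"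
  by (induction I rule: infinite_finite_induct) (simp_all add: rf_eval_one rf_eval_mult)

lemma rf_eval_poly_eval: "rf_eval s (poly_eval t p) = poly_eval (\<lambda>i. rf_eval s (t i)) p"
proof -
  have "rf_eval s (rf_const c) = rf_const c" for c
    using rf_eval_frp[of s "Cst c"] by (simp add: frp_Cst poly_eval_simps)
  then show ?thesis
    by (subst poly_eval_unique[where G="\<lambda>p. rf_eval s (poly_eval t p)"])
      (simp_all add: additive_def poly_eval_simps rf_eval_add rf_eval_mult)
qed

lemma rf_eval_uvar: "rf_eval s (uvar i) = s i"
  using rf_eval_frp[of s "Xv i"] by (simp add: frp_Xv poly_eval_simps)

end

section \<open>Variables and degrees\<close>

lemma mvars_add: "mvars (p + q) \<subseteq> mvars p \<union> mvars q"
  using Poly_Mapping.keys_add[of p q] by (auto simp: mvars_def)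

lemma mvars_uminus [simp]: "mvars (- p) = mvars p"
  by (simp add: mvars_def keys_uminus)

lemma mvars_diff: "mvars (p - q) \<subseteq> mvars p \<union> mvars q"
  using keys_diff_subset[of p q] by (auto simp: mvars_def)

lemma mvars_zero [simp]: "mvars 0 = {}"
  by (simp add: mvars_def)

lemma mvars_one [simp]: "mvars 1 = {}"
  by (simp add: mvars_def)

lemma mvars_Cst: "mvars (Cst c) = {}"
  by (auto simp: mvars_def)

lemma mvars_Xv [simp]: "mvars (Xv i) = {i}"
  by (auto simp: mvars_def Xv_def)

lemma mvars_sum: "mvars (\<Sum>i\<in>I. f i) \<subseteq> (\<Union>i\<in>I. mvars (f i))"
  using keys_sum_subset[of f I] by (fastforce simp: mvars_def)

lemma mvars_mult: "mvars (p * q) \<subseteq> mvars p \<union> mvars q"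
proof
  fix i assume "i \<in> mvars (p * q)"
  then obtain m n where "m \<in> keys p" "n \<in> keys q" "i \<in> keys (m + n)"
    using keys_mult[of p q] by (auto simp: mvars_def)
  then show "i \<in> mvars p \<union> mvars q"
    using Poly_Mapping.keys_add[of m n] by (auto simp: mvars_def)
qed

lemma mvars_mult_le: "mvars p \<subseteq> S \<Longrightarrow> mvars q \<subseteq> S \<Longrightarrow> mvars (p * q) \<subseteq> S"
  using mvars_mult[of p q] by blast

lemma mvars_power_le: "mvars p \<subseteq> S \<Longrightarrow> mvars (p ^ k) \<subseteq> S"
  by (induction k) (simp_all add: mvars_mult_le)

lemma mvars_prod_le: "(\<And>i. i \<in> I \<Longrightarrow> mvars (f i) \<subseteq> S) \<Longrightarrow> mvars (\<Prod>i\<in>I. f i) \<subseteq> S"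
  by (induction I rule: infinite_finite_induct) (simp_all add: mvars_mult_le)

lemma mvars_sum_le: "(\<And>i. i \<in> I \<Longrightarrow> mvars (f i) \<subseteq> S) \<Longrightarrow> mvars (\<Sum>i\<in>I. f i) \<subseteq> S"
  using mvars_sum[of f I] by blast

lemma mvars_qscale: "mvars (qscale c p) \<subseteq> mvars p"
  using keys_qscale[of c p] by (auto simp: mvars_def)

lemma mvars_sub: "mvars (sub s p) \<subseteq> (\<Union>i\<in>mvars p. mvars (s i))"
proof -
  have "mvars (Cst c * mpow s m) \<subseteq> (\<Union>i\<in>mvars p. mvars (s i))" if "m \<in> keys p" for m c
    unfolding mpow_def
    using that by (intro mvars_mult_le mvars_prod_le mvars_power_le) (auto simp: mvars_Cst mvars_def[of p])
  then show ?thesis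
    unfolding cst.evl_def lin_ext_def by (intro mvars_sum_le)
qed

lemma mdeg_superset:
  "finite S \<Longrightarrow> keys m \<subseteq> S \<Longrightarrow> mdeg m = (\<Sum>i\<in>S. lookup m i)"
  unfolding mdeg_def by (rule sum.mono_neutral_left) (auto simp: in_keys_iff)

lemma mdeg_add: "mdeg (m + n) = mdeg m + mdeg n"
proof -
  let ?S = "keys m \<union> keys n"
  have "keys (m + n) \<subseteq> ?S" by (rule Poly_Mapping.keys_add)
  then show ?thesis
    by (simp add: mdeg_superset[of ?S] lookup_add sum.distrib)
qed

lemma mdeg_zero [simp]: "mdeg 0 = 0"
  by (simp add: mdeg_def)

lemma mdeg_single [simp]: "mdeg (single i k) = k"
  by (simp add: mdeg_superset[of "{i}"])

abbreviation homog :: "nat \<Rightarrow> mpoly \<Rightarrow> bool" where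
  "homog \<equiv> graded mdeg"

lemma homog_mult: "homog d p \<Longrightarrow> homog e q \<Longrightarrow> homog (d + e) (p * q)"
  by (rule graded_mult) (simp_all add: mdeg_add)

lemma homog_Cst: "homog 0 (Cst c)"
  by (simp add: graded_def)

lemma homog_Xv [simp]: "homog (Suc 0) (Xv i)"
  by (simp add: graded_def Xv_def)

lemma homog_power: "homog d p \<Longrightarrow> homog (d * k) (p ^ k)"
  by (induction k) (auto simp: graded_one intro: homog_mult)

lemma homog_prod: "(\<And>i. i \<in> I \<Longrightarrow> homog (d i) (f i)) \<Longrightarrow> homog (\<Sum>i\<in>I. d i) (\<Prod>i\<in>I. f i)"
  by (induction I rule: infinite_finite_induct) (auto simp: graded_one intro: homog_mult)

lemma hom_part_eq_gpart: "hom_part d p = gpart mdeg d p"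
proof -
  let ?f = "\<lambda>m. single m (if mdeg m = d then lookup p m else 0)"
  have "hom_part d p = (\<Sum>m\<in>{m \<in> keys p. mdeg m = d}. ?f m)"
    by (simp add: hom_part_def)
  also have "\<dots> = (\<Sum>m\<in>keys p. ?f m)"
    by (rule sum.mono_neutral_left) auto
  finally show ?thesis by (simp add: gpart_def restr_def lin_ext_def)
qed

lemma additive_hom_part: "additive (hom_part d)"
  using additive_gpart[of mdeg d] by (simp add: additive_def hom_part_eq_gpart)

lemma hom_part_homog: "homog e p \<Longrightarrow> hom_part d p = (if d = e then p else 0)"
  by (simp add: hom_part_eq_gpart gpart_graded)

lemma homog_hom_part: "homog d (hom_part d p)"
  by (simp add: hom_part_eq_gpart graded_gpart)

lemma mvars_hom_part: "mvars (hom_part d p) \<subseteq> mvars p"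
  by (auto simp: mvars_def hom_part_eq_gpart gpart_def keys_restr)

lemma hom_part_single: "hom_part d (single m c) = (if mdeg m = d then single m c else 0)"
  by (simp add: hom_part_eq_gpart gpart_def restr_single)

lemma homog_mpow:
  assumes "\<And>i. i \<in> keys m \<Longrightarrow> homog 1 (s i)"
  shows "homog (mdeg m) (mpow s m)"
  unfolding mpow_def mdeg_def[of m]
  by (rule homog_prod) (use assms homog_power[where d=1] in fastforce)

text \<open>Substituting linear forms preserves degree; renaming of variables, \<open>shift\<close>
  and the push substitution are of this kind.\<close>

lemma hom_part_sub:
  assumes "\<And>i. i \<in> mvars p \<Longrightarrow> homog 1 (s i)"
  shows "hom_part d (sub s p) = sub s (hom_part d p)"
proof (rule additive_eqI[OF additive_comp[OF additive_hom_part cst.additive_evl]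
      additive_comp[OF cst.additive_evl additive_hom_part]])
  fix m c assume "m \<in> keys p"
  then have "homog (0 + mdeg m) (Cst c * mpow s m)"
    using assms by (intro homog_mult homog_Cst homog_mpow) (auto simp: mvars_def)
  then show "hom_part d (sub s (single m c)) = sub s (hom_part d (single m c))"
    by (auto simp: cst.evl_single hom_part_single hom_part_homog sub_simps)
qed

lemma hom_part_mult_homog:
  assumes "homog e l"
  shows "hom_part (e + d) (l * q) = l * hom_part d q"
proof (rule additive_eqI[of "\<lambda>q. hom_part (e + d) (l * q)" "\<lambda>q. l * hom_part d q"])
  fix m and c :: rat
  have "homog (e + mdeg m) (l * single m c)"
    using assms by (intro homog_mult) (simp_all add: graded_def)
  then show "hom_part (e + d) (l * single m c) = l * hom_part d (single m c)"
    by (auto simp: hom_part_single hom_part_homog)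
qed (auto simp: additive_def algebra_simps additive.add[OF additive_hom_part])

lemma sum_hom_part:
  assumes "finite D" "mdeg ` keys p \<subseteq> D"
  shows "(\<Sum>d\<in>D. hom_part d p) = p"
proof (rule poly_mapping_eqI)
  fix m
  have "lookup (\<Sum>d\<in>D. hom_part d p) m = (\<Sum>d\<in>D. if mdeg m = d then lookup p m else 0)"
    by (simp add: lookup_sum hom_part_eq_gpart gpart_def lookup_restr)
  also have "\<dots> = lookup p m"
    using assms by (cases "m \<in> keys p") (auto simp: in_keys_iff)
  finally show "lookup (\<Sum>d\<in>D. hom_part d p) m = lookup p m" .
qed

section \<open>Ree's theorem for alternal polynomials\<close>

section \<open>Shuffle sums\<close>

text \<open>\<open>shuffles\<close> is a set and loses multiplicities when letters repeat, as they
  do in exponent lists; the recursion counts every interleaving.\<close>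

fun shuffle_sum :: "('k list \<Rightarrow> rat) \<Rightarrow> 'k list \<Rightarrow> 'k list \<Rightarrow> rat" where
  "shuffle_sum P [] vs = P vs"
| "shuffle_sum P (x # us) [] = P (x # us)"
| "shuffle_sum P (x # us) (y # vs) =
     shuffle_sum (\<lambda>w. P (x # w)) us (y # vs) + shuffle_sum (\<lambda>w. P (y # w)) (x # us) vs"

lemma shuffle_sum_Nil2 [simp]: "shuffle_sum P us [] = P us"
  by (cases us) auto

lemma shuffle_sum_shuffles:
  assumes "distinct xs" "distinct ys" "set xs \<inter> set ys = {}"
  shows "shuffle_sum P (map e xs) (map e ys) = (\<Sum>w\<in>shuffles xs ys. P (map e w))"
  using assms
proof (induction xs ys arbitrary: P rule: shuffles.induct)
  case (3 x xs y ys)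
  have "(\<Sum>w\<in>shuffles (x # xs) (y # ys). P (map e w)) =
    (\<Sum>w\<in>(#) x ` shuffles xs (y # ys). P (map e w)) + (\<Sum>w\<in>(#) y ` shuffles (x # xs) ys. P (map e w))"
    using 3(5) by (simp only: shuffles.simps) (rule sum.union_disjoint, auto)
  also have "\<dots> = (\<Sum>w\<in>shuffles xs (y # ys). P (e x # map e w)) + (\<Sum>w\<in>shuffles (x # xs) ys. P (e y # map e w))"
    by (simp add: sum.reindex)
  finally show ?case using 3 by simp
qed auto

lemma shuffle_sum_cong:
  "(\<And>w. length w = length us + length vs \<Longrightarrow> P w = Q w) \<Longrightarrow> shuffle_sum P us vs = shuffle_sum Q us vs"
proof (induction P us vs arbitrary: Q rule: shuffle_sum.induct)
  case (3 P x us y vs)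
  show ?case
    using "3.IH"(1)[of "\<lambda>w. Q (x # w)"] "3.IH"(2)[of "\<lambda>w. Q (y # w)"] "3.prems" by simp
qed auto

lemma shuffle_sum_diff: "shuffle_sum (\<lambda>w. P w - Q w) us vs = shuffle_sum P us vs - shuffle_sum Q us vs"
  by (induction P us vs arbitrary: Q rule: shuffle_sum.induct) auto

lemma shuffle_sum_if:
  "shuffle_sum (\<lambda>w. if b then P w else 0) us vs = (if b then shuffle_sum P us vs else 0)"
  using shuffle_sum_diff[of "\<lambda>w. 0" "\<lambda>w. 0" us vs] by (cases b) auto

text \<open>The recursion seen from the last letter, needed for multiplication on the right.\<close>

lemma shuffle_sum_snoc:
  "shuffle_sum P (us @ [x]) (vs @ [y]) =
     shuffle_sum (\<lambda>w. P (w @ [x])) us (vs @ [y]) + shuffle_sum (\<lambda>w. P (w @ [y])) (us @ [x]) vs"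
proof (induction "length us + length vs" arbitrary: P us vs rule: less_induct)
  case less
  show ?case
  proof (cases us)
    case us: Nil
    show ?thesis
    proof (cases vs)
      case (Cons z vs')
      then show ?thesis using us less[of "[]" vs' "\<lambda>w. P (z # w)"] by simp
    qed (simp add: us)
  next
    case us: (Cons z us')
    show ?thesis
    proof (cases vs)
      case Nil
      then show ?thesis using us less[of us' "[]" "\<lambda>w. P (z # w)"] by simp
    next
      case (Cons z' vs')
      then show ?thesis
        using us less[of us' vs "\<lambda>w. P (z # w)"] less[of us vs' "\<lambda>w. P (z' # w)"] by simp
    qed
  qed
qed

definition word_alternal :: "('k list \<Rightarrow> rat) \<Rightarrow> nat \<Rightarrow> bool" where
  "word_alternal P r \<longleftrightarrow>
     (\<forall>us vs. us \<noteq> [] \<longrightarrow> vs \<noteq> [] \<longrightarrow> length us + length vs = r \<longrightarrow> shuffle_sum P us vs = 0)"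

text \<open>For alternal \<open>P\<close>, left and right multiplication by the letter \<open>0\<close> have the same shuffle sums.\<close>

lemma word_alternal_commutator:
  fixes P :: "nat list \<Rightarrow> rat"
  assumes P: "word_alternal P r" and r: "r \<ge> 1"
    and Q: "\<And>x w. length w = r \<Longrightarrow> Q (x # w) = (if x = 0 then P w else 0)"
    and R: "\<And>x w. length w = r \<Longrightarrow> R (w @ [x]) = (if x = 0 then P w else 0)"
  shows "word_alternal (\<lambda>w. Q w - R w) (Suc r)"
  unfolding word_alternal_def
proof (intro allI impI)
  fix U V :: "nat list"
  assume U: "U \<noteq> []" and V: "V \<noteq> []" and len: "length U + length V = Suc r"
  have alt: "shuffle_sum P us vs = (if us = [] then P vs else if vs = [] then P us else 0)"
    if "length us + length vs = r" for us vs
    using P that by (auto simp: word_alternal_def)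
  obtain x us y vs where uv: "U = x # us" "V = y # vs" using U V by (meson list.exhaust)
  have "shuffle_sum Q U V = shuffle_sum (\<lambda>w. if x = 0 then P w else 0) us (y # vs) +
      shuffle_sum (\<lambda>w. if y = 0 then P w else 0) (x # us) vs"
    unfolding uv shuffle_sum.simps
    by (intro arg_cong2[where f="(+)"] shuffle_sum_cong) (use len uv in \<open>simp_all add: Q\<close>)
  \<comment> \<open>Once the first letter is removed, alternality kills the remaining shuffle sum of
    \<open>P\<close> unless one of the two words has become empty, that is, unless U or V was the
    single letter 0.\<close>
  also have "\<dots> = (if U = [0] then P V else 0) + (if V = [0] then P U else 0)"
  proof -
    show ?thesis using len alt[of us "y # vs"] alt[of "x # us" vs] by (auto simp: uv shuffle_sum_if)
  qed
  finally have 1: "shuffle_sum Q U V = (if U = [0] then P V else 0) + (if V = [0] then P U else 0)" .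
  obtain x us y vs where uv: "U = us @ [x]" "V = vs @ [y]" using U V by (meson rev_exhaust)
  have "shuffle_sum R U V = shuffle_sum (\<lambda>w. if x = 0 then P w else 0) us (vs @ [y]) +
      shuffle_sum (\<lambda>w. if y = 0 then P w else 0) (us @ [x]) vs"
    unfolding uv shuffle_sum_snoc
    by (intro arg_cong2[where f="(+)"] shuffle_sum_cong) (use len uv in \<open>simp_all add: R\<close>)
  also have "\<dots> = (if U = [0] then P V else 0) + (if V = [0] then P U else 0)"
  proof -
    show ?thesis using len alt[of us "vs @ [y]"] alt[of "us @ [x]" vs] by (auto simp: uv shuffle_sum_if)
  qed
  finally show "shuffle_sum (\<lambda>w. Q w - R w) U V = 0" using 1 by (simp add: shuffle_sum_diff)
qed

section \<open>Alternal functions and Lie elements\<close>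

lemma sum_const_qscale: "(\<Sum>i\<in>I. x) = qscale (of_nat (card I)) x"
  by (induction I rule: infinite_finite_induct) (simp_all add: qscale_left_add)

definition words :: "'k set \<Rightarrow> nat \<Rightarrow> 'k list set" where
  "words K n = {w. set w \<subseteq> K \<and> length w = n}"

lemma finite_words: "finite K \<Longrightarrow> finite (words K n)"
  unfolding words_def by (rule finite_lists_length_eq)

lemma words_0 [simp]: "words K 0 = {[]}"
  by (auto simp: words_def)

lemma sum_words_Suc:
  assumes "finite K"
  shows "(\<Sum>w\<in>words K (Suc n). h w) = (\<Sum>x\<in>K. \<Sum>w\<in>words K n. h (x # w))"
proof -
  have "words K (Suc n) = (\<lambda>(x, w). x # w) ` (K \<times> words K n)"
    by (auto simp: words_def length_Suc_conv image_iff)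
  moreover have "inj_on (\<lambda>(x, w). x # w) (K \<times> words K n)"
    by (auto simp: inj_on_def)
  ultimately show ?thesis
    by (simp add: sum.reindex sum.cartesian_product case_prod_unfold)
qed

lemma sum_words_append:
  assumes "finite K"
  shows "(\<Sum>w\<in>words K (i + j). h w) = (\<Sum>s\<in>words K i. \<Sum>q\<in>words K j. h (s @ q))"
proof (induction i arbitrary: h)
  case (Suc i)
  then show ?case by (simp add: sum_words_Suc[OF assms])
qed auto

lemma sum_words_snoc:
  assumes "finite K"
  shows "(\<Sum>w\<in>words K (Suc i). h w) = (\<Sum>s\<in>words K i. \<Sum>x\<in>K. h (s @ [x]))"
proof -
  have "(\<Sum>w\<in>words K (i + Suc 0). h w) = (\<Sum>s\<in>words K i. \<Sum>x\<in>K. h (s @ [x]))"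
    by (simp only: sum_words_append[OF assms] sum_words_Suc[OF assms]) simp
  then show ?thesis by simp
qed

context
  fixes y :: "'k \<Rightarrow> freealg" and K :: "'k set"
  assumes K: "finite K"
begin

fun bracketing :: "freealg \<Rightarrow> 'k list \<Rightarrow> freealg" where
  "bracketing t [] = t"
| "bracketing t (x # w) = bracketing (comm t (y x)) w"

abbreviation (input) word_prod :: "'k list \<Rightarrow> freealg" where
  "word_prod w \<equiv> prod_list (map y w)"

lemma bracketing_lieL: "t \<in> lieL \<Longrightarrow> (\<And>x. y x \<in> lieL) \<Longrightarrow> bracketing t w \<in> lieL"
  by (induction w arbitrary: t) (auto intro: lieL.comm)

lemma bracketing_diff: "bracketing (s - t) w = bracketing s w - bracketing t w"
  by (induction w arbitrary: s t) (auto simp: comm_diff_left)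

text \<open>In the expansion of a left-normed bracket each letter goes to the right of t with sign +
  or to the left with sign -. Letters on the left pile up in reverse order, so the words leading to
  s t q are the shuffles of \<open>rev s\<close> and q.\<close>

lemma bracketing_sum:
  "(\<Sum>w\<in>words K n. qscale (P w) (bracketing t w)) =
   (\<Sum>i\<le>n. \<Sum>s\<in>words K i. \<Sum>q\<in>words K (n - i).
      qscale ((-1) ^ i * shuffle_sum P (rev s) q) (word_prod s * t * word_prod q))"
proof (induction n arbitrary: P t)
  case (Suc n)
  \<comment> \<open>\<open>?A\<close> and \<open>?B\<close> split the shuffle by its first letter,
    which is bracketed first: it heads q if it went to the right of t, and \<open>rev s\<close> if
    it went to the left. The induction hypothesis then applies with t times \<open>y x\<close>, or
    \<open>y x\<close> times t, in place of t.\<close>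
  let ?A = "\<lambda>s q. case q of [] \<Rightarrow> 0 | x # q' \<Rightarrow> shuffle_sum (\<lambda>w. P (x # w)) (rev s) q'"
  let ?B = "\<lambda>s q. case rev s of [] \<Rightarrow> 0 | x # s' \<Rightarrow> shuffle_sum (\<lambda>w. P (x # w)) s' q"
  have split: "shuffle_sum P (rev s) q = ?A s q + ?B s q" if "s \<noteq> [] \<or> q \<noteq> []" for s q
    using that by (cases "rev s"; cases q) auto
  let ?e = "\<lambda>i s q. word_prod s * t * word_prod q"
  have A: "(\<Sum>i\<le>Suc n. \<Sum>s\<in>words K i. \<Sum>q\<in>words K (Suc n - i). qscale ((-1) ^ i * ?A s q) (?e i s q))
     = (\<Sum>x\<in>K. \<Sum>w\<in>words K n. qscale (P (x # w)) (bracketing (t * y x) w))"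
  proof -
    have "(\<Sum>i\<le>Suc n. \<Sum>s\<in>words K i. \<Sum>q\<in>words K (Suc n - i). qscale ((-1) ^ i * ?A s q) (?e i s q))
      = (\<Sum>i\<le>n. \<Sum>s\<in>words K i. \<Sum>q\<in>words K (Suc n - i). qscale ((-1) ^ i * ?A s q) (?e i s q))"
      by simp
    also have "\<dots> = (\<Sum>i\<le>n. \<Sum>s\<in>words K i. \<Sum>x\<in>K. \<Sum>q\<in>words K (n - i).
        qscale ((-1) ^ i * shuffle_sum (\<lambda>w. P (x # w)) (rev s) q) (word_prod s * (t * y x) * word_prod q))"
      by (intro sum.cong refl) (simp add: Suc_diff_le sum_words_Suc[OF K] mult.assoc)
    also have "\<dots> = (\<Sum>x\<in>K. \<Sum>i\<le>n. \<Sum>s\<in>words K i. \<Sum>q\<in>words K (n - i).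
        qscale ((-1) ^ i * shuffle_sum (\<lambda>w. P (x # w)) (rev s) q) (word_prod s * (t * y x) * word_prod q))"
      by (simp only: sum.swap[of _ K])
    also have "\<dots> = (\<Sum>x\<in>K. \<Sum>w\<in>words K n. qscale (P (x # w)) (bracketing (t * y x) w))"
      by (simp only: Suc.IH)
    finally show ?thesis .
  qed
  have B: "(\<Sum>i\<le>Suc n. \<Sum>s\<in>words K i. \<Sum>q\<in>words K (Suc n - i). qscale ((-1) ^ i * ?B s q) (?e i s q))
     = - (\<Sum>x\<in>K. \<Sum>w\<in>words K n. qscale (P (x # w)) (bracketing (y x * t) w))"
  proof -
    have "(\<Sum>i\<le>Suc n. \<Sum>s\<in>words K i. \<Sum>q\<in>words K (Suc n - i). qscale ((-1) ^ i * ?B s q) (?e i s q))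
      = (\<Sum>i\<le>n. \<Sum>s\<in>words K (Suc i). \<Sum>q\<in>words K (n - i). qscale ((-1) ^ Suc i * ?B s q) (?e i s q))"
      by (subst sum.atMost_Suc_shift) simp
    also have "\<dots> = (\<Sum>i\<le>n. \<Sum>s\<in>words K i. \<Sum>x\<in>K. \<Sum>q\<in>words K (n - i).
        - qscale ((-1) ^ i * shuffle_sum (\<lambda>w. P (x # w)) (rev s) q) (word_prod s * (y x * t) * word_prod q))"
      unfolding sum_words_snoc[OF K]
      by (intro sum.cong refl) (simp add: mult.assoc qscale_uminus_left)
    also have "\<dots> = - (\<Sum>x\<in>K. \<Sum>i\<le>n. \<Sum>s\<in>words K i. \<Sum>q\<in>words K (n - i).
        qscale ((-1) ^ i * shuffle_sum (\<lambda>w. P (x # w)) (rev s) q) (word_prod s * (y x * t) * word_prod q))"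
      by (simp only: sum.swap[of _ K] sum_negf)
    also have "\<dots> = - (\<Sum>x\<in>K. \<Sum>w\<in>words K n. qscale (P (x # w)) (bracketing (y x * t) w))"
      by (simp only: Suc.IH)
    finally show ?thesis .
  qed
  have "(\<Sum>i\<le>Suc n. \<Sum>s\<in>words K i. \<Sum>q\<in>words K (Suc n - i).
      qscale ((-1) ^ i * shuffle_sum P (rev s) q) (?e i s q)) =
    (\<Sum>i\<le>Suc n. \<Sum>s\<in>words K i. \<Sum>q\<in>words K (Suc n - i).
      qscale ((-1) ^ i * ?A s q) (?e i s q) + qscale ((-1) ^ i * ?B s q) (?e i s q))"
  proof (intro sum.cong refl)
    fix i s q assume "i \<in> {..Suc n}" "s \<in> words K i" "q \<in> words K (Suc n - i)"
    then have "s \<noteq> [] \<or> q \<noteq> []" by (auto simp: words_def)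
    then show "qscale ((-1) ^ i * shuffle_sum P (rev s) q) (?e i s q) =
      qscale ((-1) ^ i * ?A s q) (?e i s q) + qscale ((-1) ^ i * ?B s q) (?e i s q)"
      by (simp only: split distrib_left qscale_left_add)
  qed
  also have "\<dots> = (\<Sum>x\<in>K. \<Sum>w\<in>words K n. qscale (P (x # w)) (bracketing (t * y x) w))
      - (\<Sum>x\<in>K. \<Sum>w\<in>words K n. qscale (P (x # w)) (bracketing (y x * t) w))"
    by (simp only: sum.distrib A B) simp
  also have "\<dots> = (\<Sum>w\<in>words K (Suc n). qscale (P w) (bracketing t w))"
    by (simp add: sum_words_Suc[OF K] comm_def bracketing_diff qscale_diff sum_subtractf)
  finally show ?case by simp
qed simp

text \<open>The shuffle of x' followed by \<open>rev s\<close> with x followed by q vanishes. Split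
  by its first letter, this relation trades a leading x for a leading x' with a sign and shortens s;
  iterated, it is the antipode identity for alternal functions.\<close>

lemma word_alternal_rev:
  assumes "word_alternal P (Suc (length s + length q))"
  shows "shuffle_sum (\<lambda>w. P (x # w)) (rev s) q = (-1) ^ length s * P (s @ x # q)"
  using assms
proof (induction s arbitrary: x q rule: rev_induct)
  case (snoc x' s)
  have "shuffle_sum P (x' # rev s) (x # q) = 0"
    using snoc.prems[unfolded word_alternal_def, rule_format, of "x' # rev s" "x # q"] by simp
  then show ?case using snoc.IH[of "x # q" x'] snoc.prems by simp
qed simp

text \<open>Ree's theorem by the Dynkin operator: alternality collapses each shuffle sum of
  \<open>bracketing_sum\<close> to a single coefficient, so that bracketing multiplies by the length \<open>n\<close>.\<close>

lemma word_alternal_lieL: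
  assumes alt: "word_alternal P n" and n: "n \<ge> 1" and y: "\<And>x. y x \<in> lieL"
  shows "(\<Sum>w\<in>words K n. qscale (P w) (word_prod w)) \<in> lieL"
proof -
  obtain m where m: "n = Suc m" using n by (cases n) auto
  let ?S = "\<Sum>w\<in>words K n. qscale (P w) (word_prod w)"
  have "(\<Sum>x\<in>K. \<Sum>w\<in>words K m. qscale (P (x # w)) (bracketing (y x) w)) =
    (\<Sum>x\<in>K. \<Sum>i\<le>m. \<Sum>s\<in>words K i. \<Sum>q\<in>words K (m - i).
      qscale ((-1) ^ i * shuffle_sum (\<lambda>w. P (x # w)) (rev s) q) (word_prod s * y x * word_prod q))"
    by (simp only: bracketing_sum)
  also have "\<dots> = (\<Sum>x\<in>K. \<Sum>i\<le>m. \<Sum>s\<in>words K i. \<Sum>q\<in>words K (m - i).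
      qscale (P (s @ x # q)) (word_prod (s @ x # q)))"
  proof (intro sum.cong refl)
    fix x i s q assume "i \<in> {..m}" "s \<in> words K i" "q \<in> words K (m - i)"
    then have "length s = i" "n = Suc (length s + length q)" by (auto simp: words_def m)
    then show "qscale ((-1) ^ i * shuffle_sum (\<lambda>w. P (x # w)) (rev s) q) (word_prod s * y x * word_prod q)
       = qscale (P (s @ x # q)) (word_prod (s @ x # q))"
      using word_alternal_rev[of P s q x] alt
      by (simp add: mult.assoc flip: power_mult_distrib)
  qed
  also have "\<dots> = (\<Sum>i\<le>m. \<Sum>s\<in>words K i. \<Sum>x\<in>K. \<Sum>q\<in>words K (m - i).
      qscale (P (s @ x # q)) (word_prod (s @ x # q)))"
    by (simp only: sum.swap[of _ K])
  \<comment> \<open>Cutting a word of length n at position i is a bijection, so each of the n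
    possible positions of the letter x yields the whole sum once.\<close>
  also have "\<dots> = (\<Sum>i\<le>m. ?S)"
  proof (rule sum.cong[OF refl])
    fix i assume "i \<in> {..m}"
    then have "n = i + Suc (m - i)" by (simp add: m)
    then show "(\<Sum>s\<in>words K i. \<Sum>x\<in>K. \<Sum>q\<in>words K (m - i).
      qscale (P (s @ x # q)) (word_prod (s @ x # q))) = ?S"
      using sum_words_append[OF K, where h="\<lambda>w. qscale (P w) (word_prod w)" and i=i and j="Suc (m - i)"]
      by (simp only: sum_words_Suc[OF K])
  qed
  also have "\<dots> = qscale (of_nat n) ?S"
    by (simp only: sum_const_qscale card_atMost m)
  finally have eq: "qscale (of_nat n) ?S = (\<Sum>x\<in>K. \<Sum>w\<in>words K m. qscale (P (x # w)) (bracketing (y x) w))" ..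
  have "qscale (of_nat n) ?S \<in> lieL"
    unfolding eq by (intro lieL_sum lieL.scale bracketing_lieL y)
  then have "qscale (1 / of_nat n) (qscale (of_nat n) ?S) \<in> lieL" by (rule lieL.scale)
  then show ?thesis using n by simp
qed

end

section \<open>Alternal polynomials\<close>

text \<open>The substitution is the one that \<open>mapply\<close> produces, with variables outside
  1..r fixed. For r at most 1 the range of k is empty and there is no condition.\<close>

definition alternal_poly :: "nat \<Rightarrow> mpoly \<Rightarrow> bool" where
  "alternal_poly r p \<longleftrightarrow> (\<forall>k\<in>{1..r - 1}. (\<Sum>w\<in>shuffles [1..<k + 1] [k + 1..<r + 1].
     poly_eval (\<lambda>i. if 1 \<le> i \<and> i \<le> r then uvar (w ! (i - 1)) else uvar i) p) = 0)"

definition expo :: "nat list \<Rightarrow> (nat \<Rightarrow>\<^sub>0 nat)" where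
  "expo e = (\<Sum>j<length e. single (Suc j) (e ! j))"

text \<open>Exponent lists are words over the alphabet of natural numbers. A polynomial becomes a
  function on words, to which \<open>word_alternal\<close> applies.\<close>

definition coef :: "mpoly \<Rightarrow> nat list \<Rightarrow> rat" where
  "coef p e = lookup p (expo e)"

definition exlist :: "nat \<Rightarrow> (nat \<Rightarrow>\<^sub>0 nat) \<Rightarrow> nat list" where
  "exlist r m = map (lookup m) [1..<r + 1]"

lemma lookup_expo: "lookup (expo e) i = (if 1 \<le> i \<and> i \<le> length e then e ! (i - 1) else 0)"
proof -
  have "lookup (expo e) i = (\<Sum>j<length e. if j = i - 1 then (if 1 \<le> i then e ! j else 0) else 0)"
    unfolding expo_def lookup_sum by (rule sum.cong) (auto simp: lookup_single when_def)
  then show ?thesis by auto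
qed

lemma length_exlist [simp]: "length (exlist r m) = r"
  by (simp add: exlist_def)

lemma nth_exlist: "i < r \<Longrightarrow> exlist r m ! i = lookup m (Suc i)"
  by (simp add: exlist_def del: upt_Suc)

lemma exlist_expo: "length e = r \<Longrightarrow> exlist r (expo e) = e"
  by (rule nth_equalityI) (auto simp: nth_exlist lookup_expo)

lemma expo_exlist: "keys m \<subseteq> {1..r} \<Longrightarrow> expo (exlist r m) = m"
  by (rule poly_mapping_eqI) (auto simp: lookup_expo nth_exlist in_keys_iff subset_iff)

lemma lookup_outside_mvars: "\<not> keys m \<subseteq> mvars p \<Longrightarrow> lookup p m = 0"
  by (auto simp: mvars_def in_keys_iff)

text \<open>Renaming variables along the permutation w permutes the exponents, which turns shuffles
  of variables into shuffles of exponent lists.\<close>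

lemma coef_rename:
  assumes w: "set w = {1..r}" "distinct w" "length w = r" and e: "length e = r"
    and p: "mvars p \<subseteq> {1..r}"
  shows "coef (sub (\<lambda>i. if 1 \<le> i \<and> i \<le> r then Xv (w ! (i - 1)) else Xv i) p) e =
         coef p (map (\<lambda>j. e ! (j - 1)) w)"
  unfolding coef_def
proof (rule additive_eqI[OF additive_comp[OF lookup_additive cst.additive_evl] lookup_additive])
  fix m c assume m: "m \<in> keys p"
  let ?s = "\<lambda>i. if 1 \<le> i \<and> i \<le> r then Xv (w ! (i - 1)) else Xv i"
  let ?m = "\<Sum>i\<in>{1..r}. single (w ! (i - 1)) (lookup m i)"
  have km: "keys m \<subseteq> {1..r}" using m p by (auto simp: mvars_def)
  have "mpow ?s m = (\<Prod>i\<in>{1..r}. ?s i ^ lookup m i)"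
    by (rule mpow_superset) (use km in auto)
  also have "\<dots> = (\<Prod>i\<in>{1..r}. single (single (w ! (i - 1)) (lookup m i)) 1)"
    by (rule prod.cong) (auto simp: Xv_power)
  finally have sub: "sub ?s (single m c) = single ?m c"
    by (simp add: cst.evl_single prod_single mult_single)
  have lk: "lookup ?m (w ! (i - 1)) = lookup m i" if i: "i \<in> {1..r}" for i
  proof -
    have "lookup ?m (w ! (i - 1)) = (\<Sum>j\<in>{1..r}. if j = i then lookup m j else 0)"
      unfolding lookup_sum using i w
      by (intro sum.cong) (auto simp: lookup_single when_def nth_eq_iff_index_eq)
    then show ?thesis using i by simp
  qed
  have lk0: "lookup ?m j = 0" if "j \<notin> {1..r}" for j
  proof -
    have "w ! (i - 1) \<noteq> j" if "i \<in> {1..r}" for i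
      using that \<open>j \<notin> {1..r}\<close> w nth_mem[of "i - 1" w] by auto
    then show ?thesis unfolding lookup_sum by (auto simp: lookup_single when_def intro!: sum.neutral)
  qed
  have ex: "\<exists>i\<in>{1..r}. j = w ! (i - 1)" if "j \<in> {1..r}" for j
  proof -
    have "j \<in> set w" using that w(1) by simp
    then obtain k where "k < r" "w ! k = j" using w(3) by (auto simp: in_set_conv_nth)
    then show ?thesis by (intro bexI[of _ "Suc k"]) auto
  qed
  have "?m = expo e \<longleftrightarrow> m = expo (map (\<lambda>j. e ! (j - 1)) w)"
  proof
    assume eq: "?m = expo e"
    show "m = expo (map (\<lambda>j. e ! (j - 1)) w)"
    proof (rule poly_mapping_eqI)
      fix i
      show "lookup m i = lookup (expo (map (\<lambda>j. e ! (j - 1)) w)) i"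
      proof (cases "i \<in> {1..r}")
        case True
        then have "w ! (i - 1) \<in> {1..r}" using w nth_mem[of "i - 1" w] by auto
        moreover have "i - 1 < length w" using True w(3) by auto
        ultimately show ?thesis using lk[OF True, unfolded eq] True w e by (simp add: lookup_expo)
      qed (use km w in \<open>auto simp: lookup_expo in_keys_iff\<close>)
    qed
  next
    assume eq: "m = expo (map (\<lambda>j. e ! (j - 1)) w)"
    show "?m = expo e"
    proof (rule poly_mapping_eqI)
      fix j
      show "lookup ?m j = lookup (expo e) j"
      proof (cases "j \<in> {1..r}")
        case True
        then obtain i where i: "i \<in> {1..r}" "j = w ! (i - 1)" using ex by blast
        have "lookup ?m j = lookup m i" using lk[OF i(1)] i(2) by simp
        also have "\<dots> = lookup (expo e) j"
          using i True w e by (subst eq) (auto simp: lookup_expo)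
        finally show ?thesis .
      qed (use lk0 e in \<open>auto simp: lookup_expo\<close>)
    qed
  qed
  then show "lookup (sub ?s (single m c)) (expo e) =
    lookup (single m c) (expo (map (\<lambda>j. e ! (j - 1)) w))"
    by (simp only: sub lookup_single)
qed

lemma shuffle_intervals:
  assumes "w \<in> shuffles [1..<k + 1] [k + 1..<r + 1]" "k \<in> {1..r - 1}"
  shows "set w = {1..r}" "distinct w" "length w = r"
proof -
  have "1 \<le> k" "k \<le> r" using assms(2) by auto
  then have "{1..<k + 1} \<union> {k + 1..<r + 1} = {1..r}"
    using ivl_disj_un_two(3)[of 1 "k + 1" "r + 1"] by (simp add: atLeastLessThanSuc_atLeastAtMost)
  then show "set w = {1..r}" using set_shuffles[OF assms(1)] by (simp only: set_upt)
  show "distinct w" by (rule distinct_disjoint_shuffles[OF _ _ _ assms(1)]) auto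
  show "length w = r" using length_shuffles[OF assms(1)] \<open>k \<le> r\<close> by (simp del: upt_Suc)
qed

text \<open>Cutting an exponent list at k gives the two words to be shuffled. All polynomials
  involved have their variables in 1..r, so their coefficients at lists of length r determine
  them.\<close>

lemma alternal_poly_iff:
  assumes p: "mvars p \<subseteq> {1..r}"
  shows "alternal_poly r p \<longleftrightarrow> word_alternal (coef p) r"
proof -
  let ?s = "\<lambda>w i. if 1 \<le> i \<and> i \<le> r then Xv (w ! (i - 1)) else Xv i"
  let ?Sh = "\<lambda>k. shuffles [1..<k + 1] [k + 1..<r + 1]"
  have ev: "poly_eval (\<lambda>i. if 1 \<le> i \<and> i \<le> r then uvar (w ! (i - 1)) else uvar i) p = frp (sub (?s w) p)" for w
    unfolding poly_eval_frp[symmetric] by (rule poly_eval_cong) (simp add: frp_Xv)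
  have split: "shuffle_sum (coef p) (take k e) (drop k e) = coef (\<Sum>w\<in>?Sh k. sub (?s w) p) e"
    if k: "k \<in> {1..r - 1}" and e: "length e = r" for k e
  proof -
    have "take k e = map (\<lambda>j. e ! (j - 1)) [1..<k + 1]" "drop k e = map (\<lambda>j. e ! (j - 1)) [k + 1..<r + 1]"
      using k e by (auto intro!: nth_equalityI simp: nth_append simp del: upt_Suc)
    then have "shuffle_sum (coef p) (take k e) (drop k e) = (\<Sum>w\<in>?Sh k. coef p (map (\<lambda>j. e ! (j - 1)) w))"
      by (simp only:) (rule shuffle_sum_shuffles, auto)
    also have "\<dots> = (\<Sum>w\<in>?Sh k. coef (sub (?s w) p) e)"
      by (intro sum.cong refl coef_rename[symmetric] shuffle_intervals[OF _ k] e p)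
    finally show ?thesis by (simp add: coef_def lookup_sum)
  qed
  have zero: "(\<Sum>w\<in>?Sh k. sub (?s w) p) = 0 \<longleftrightarrow> (\<forall>e. length e = r \<longrightarrow> coef (\<Sum>w\<in>?Sh k. sub (?s w) p) e = 0)"
    if k: "k \<in> {1..r - 1}" for k
  proof
    assume *: "\<forall>e. length e = r \<longrightarrow> coef (\<Sum>w\<in>?Sh k. sub (?s w) p) e = 0"
    show "(\<Sum>w\<in>?Sh k. sub (?s w) p) = 0"
    proof (rule poly_mapping_eqI)
      fix m
      have "mvars (sub (?s w) p) \<subseteq> {1..r}" if "w \<in> ?Sh k" for w
      proof -
        have "w ! (i - 1) \<in> {1..r}" if "1 \<le> i" "i \<le> r" for i
          using shuffle_intervals[OF \<open>w \<in> ?Sh k\<close> k] nth_mem[of "i - 1" w] that by auto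
        then have "mvars (?s w i) \<subseteq> {1..r}" if "i \<in> mvars p" for i
          using p that by auto
        then show ?thesis using mvars_sub[of "?s w" p] by blast
      qed
      then have mv: "mvars (\<Sum>w\<in>?Sh k. sub (?s w) p) \<subseteq> {1..r}"
        by (rule mvars_sum_le)
      show "lookup (\<Sum>w\<in>?Sh k. sub (?s w) p) m = lookup 0 m"
      proof (cases "keys m \<subseteq> {1..r}")
        case True
        then show ?thesis using *[rule_format, of "exlist r m"] by (simp add: coef_def expo_exlist)
      next
        case False
        then have "\<not> keys m \<subseteq> mvars (\<Sum>w\<in>?Sh k. sub (?s w) p)" using mv by blast
        then show ?thesis by (simp add: lookup_outside_mvars)
      qed
    qed
  qed (simp add: coef_def)
  have "alternal_poly r p \<longleftrightarrow> (\<forall>k\<in>{1..r - 1}. (\<Sum>w\<in>?Sh k. sub (?s w) p) = 0)"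
    unfolding alternal_poly_def ev by (simp flip: frp_sum)
  also have "\<dots> \<longleftrightarrow> (\<forall>k\<in>{1..r - 1}. \<forall>e. length e = r \<longrightarrow> shuffle_sum (coef p) (take k e) (drop k e) = 0)"
    using zero split by simp
  also have "\<dots> \<longleftrightarrow> word_alternal (coef p) r"
    unfolding word_alternal_def
  proof (intro iffI allI impI ballI)
    fix us vs :: "nat list"
    assume *: "\<forall>k\<in>{1..r - 1}. \<forall>e. length e = r \<longrightarrow> shuffle_sum (coef p) (take k e) (drop k e) = 0"
      and uv: "us \<noteq> []" "vs \<noteq> []" "length us + length vs = r"
    have "length us \<in> {1..r - 1}" using uv by (cases us; cases vs) auto
    then show "shuffle_sum (coef p) us vs = 0"
      using *[rule_format, of "length us" "us @ vs"] uv by simp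
  next
    fix k and e :: "nat list"
    assume *: "\<forall>us vs. us \<noteq> [] \<longrightarrow> vs \<noteq> [] \<longrightarrow> length us + length vs = r \<longrightarrow> shuffle_sum (coef p) us vs = 0"
      and k: "k \<in> {1..r - 1}" and e: "length e = r"
    have "k \<ge> 1" "k < r" using k by auto
    then show "shuffle_sum (coef p) (take k e) (drop k e) = 0"
      using *[rule_format, of "take k e" "drop k e"] e by (cases e) auto
  qed
  finally show ?thesis .
qed

lemma alternal_poly_add: "alternal_poly r p \<Longrightarrow> alternal_poly r q \<Longrightarrow> alternal_poly r (p + q)"
  by (simp add: alternal_poly_def poly_eval_simps sum.distrib)

lemma alternal_poly_zero: "alternal_poly r 0"
  by (simp add: alternal_poly_def poly_eval_simps)

lemma alternal_poly_qscale: "alternal_poly r p \<Longrightarrow> alternal_poly r (qscale c p)"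
  by (simp add: alternal_poly_def poly_eval_simps flip: sum_distrib_left)

lemma alternal_poly_uminus: "alternal_poly r p \<Longrightarrow> alternal_poly r (- p)"
  using alternal_poly_qscale[of r p "-1"] by (simp add: qscale_neg_one)

lemma alternal_poly_hom_part:
  assumes "alternal_poly r p"
  shows "alternal_poly r (hom_part d p)"
  unfolding alternal_poly_def
proof
  fix k assume k: "k \<in> {1..r - 1}"
  let ?s = "\<lambda>w i. if 1 \<le> i \<and> i \<le> r then Xv (w ! (i - 1)) else Xv i"
  have ev: "poly_eval (\<lambda>i. if 1 \<le> i \<and> i \<le> r then uvar (w ! (i - 1)) else uvar i) p = frp (sub (?s w) p)" for w p
    unfolding poly_eval_frp[symmetric] by (rule poly_eval_cong) (simp add: frp_Xv)
  have "(\<Sum>w\<in>shuffles [1..<k + 1] [k + 1..<r + 1]. sub (?s w) p) = 0"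
    using assms k unfolding alternal_poly_def ev by (simp flip: frp_sum)
  then have "hom_part d (\<Sum>w\<in>shuffles [1..<k + 1] [k + 1..<r + 1]. sub (?s w) p) = 0"
    using additive.zero[OF additive_hom_part] by simp
  moreover have "hom_part d (sub (?s w) p) = sub (?s w) (hom_part d p)" for w
    by (rule hom_part_sub) auto
  ultimately show "(\<Sum>w\<in>shuffles [1..<k + 1] [k + 1..<r + 1].
     poly_eval (\<lambda>i. if 1 \<le> i \<and> i \<le> r then uvar (w ! (i - 1)) else uvar i) (hom_part d p)) = 0"
    unfolding ev by (simp add: additive.sum[OF additive_hom_part] flip: frp_sum)
qed

text \<open>Up to sign, multiplication by this form is ad(a); see
  \<open>comm_gen_a_Psi\<close>.\<close>

definition Xsum :: "nat \<Rightarrow> mpoly" where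
  "Xsum r = (\<Sum>i=1..r. Xv i)"

lemma mvars_Xsum: "mvars (Xsum r) \<subseteq> {1..r}"
  unfolding Xsum_def by (rule mvars_sum_le) simp

lemma homog_Xsum: "homog 1 (Xsum r)"
  unfolding Xsum_def by (rule graded_sum) simp

lemma Xsum_nonzero: "r \<ge> 1 \<Longrightarrow> Xsum r \<noteq> 0"
proof
  assume r: "r \<ge> 1" and "Xsum r = 0"
  then have "poly_eval (\<lambda>i. if i = 1 then 1 else 0) (Xsum r) = 0" by (simp add: poly_eval_simps)
  moreover have "poly_eval (\<lambda>i. if i = 1 then 1 else 0) (Xsum r) = 1"
    using r by (simp add: Xsum_def poly_eval_simps)
  ultimately show False by simp
qed

text \<open>\<open>X\<^sub>1 + \<dots> + X\<^sub>r\<close> is symmetric, hence factors out of every shuffle sum.\<close>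

lemma alternal_poly_Xsum:
  assumes "r \<ge> 1"
  shows "alternal_poly r (Xsum r * p) \<longleftrightarrow> alternal_poly r p"
proof -
  have "poly_eval (\<lambda>i. if 1 \<le> i \<and> i \<le> r then uvar (w ! (i - 1)) else uvar i) (Xsum r * p) =
     frp (Xsum r) * poly_eval (\<lambda>i. if 1 \<le> i \<and> i \<le> r then uvar (w ! (i - 1)) else uvar i) p"
    if "w \<in> shuffles [1..<k + 1] [k + 1..<r + 1]" "k \<in> {1..r - 1}" for w k
  proof -
    note w = shuffle_intervals[OF that]
    have "(\<Sum>i=1..r. if 1 \<le> i \<and> i \<le> r then uvar (w ! (i - 1)) else uvar i) = (\<Sum>j<r. uvar (w ! j))"
      by (rule sum.reindex_bij_witness[of _ Suc "\<lambda>i. i - 1"]) auto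
    also have "\<dots> = sum_list (map uvar w)"
      using w(3) by (simp add: sum_list_sum_nth atLeast0LessThan)
    also have "\<dots> = (\<Sum>i\<in>{1..r}. uvar i)"
      using w by (simp add: sum_list_distinct_conv_sum_set)
    finally show ?thesis by (simp add: Xsum_def poly_eval_simps frp_simps)
  qed
  then show ?thesis
    using assms Xsum_nonzero[of r] unfolding alternal_poly_def
    by (simp flip: sum_distrib_left)
qed

text \<open>Left multiplication by b = c_1 prepends an exponent 0, which renames the variables;
  right multiplication appends an exponent 0, which leaves the polynomial unchanged. Hence ad(b) is
  \<open>shift p - p\<close>.\<close>

definition shift :: "mpoly \<Rightarrow> mpoly" where
  "shift p = sub (\<lambda>i. Xv (Suc i)) p"

lemma additive_shift: "additive shift"
  unfolding shift_def by (rule cst.additive_evl)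

lemma mvars_shift: "mvars p \<subseteq> {1..r} \<Longrightarrow> mvars (shift p) \<subseteq> {1..Suc r}"
  unfolding shift_def using mvars_sub[of "\<lambda>i. Xv (Suc i)" p] by fastforce

lemma shift_single:
  "shift (single m c) =
     single (\<Sum>i\<in>keys m. single (Suc i) (lookup m i)) c"
  by (simp add: shift_def cst.evl_single mpow_def Xv_power prod_single mult_single)

lemma lookup_shifted_expo:
  "lookup (\<Sum>i\<in>keys m. single (Suc i) (lookup m i)) j =
     (case j of 0 \<Rightarrow> 0 | Suc i \<Rightarrow> lookup (m :: nat \<Rightarrow>\<^sub>0 nat) i)"
  by (cases j) (auto simp: lookup_sum lookup_single when_def in_keys_iff)

lemma coef_shift:
  assumes p: "mvars p \<subseteq> {1..r}" and w: "length w = r"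
  shows "coef (shift p) (x # w) = (if x = 0 then coef p w else 0)"
  unfolding coef_def
proof (rule additive_eqI[OF additive_comp[OF lookup_additive additive_shift]])
  show "additive (\<lambda>p. if x = 0 then lookup p (expo w) else 0)"
    by (simp add: additive_def lookup_add)
  fix m c assume "m \<in> keys p"
  then have km: "keys m \<subseteq> {1..r}" using p by (auto simp: mvars_def)
  let ?m = "\<Sum>i\<in>keys m. single (Suc i) (lookup m i)"
  have "?m = expo (x # w) \<longleftrightarrow> x = 0 \<and> m = expo w"
  proof
    assume eq: "?m = expo (x # w)"
    have l: "lookup m i = lookup (expo (x # w)) (Suc i)" for i
      using lookup_shifted_expo[of m "Suc i"] eq by simp
    have "x = 0" using l[of 0] km by (auto simp: lookup_expo in_keys_iff subset_iff)
    moreover have "m = expo w"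
    proof (rule poly_mapping_eqI)
      fix i
      have "lookup m 0 = 0" using km by (auto simp: in_keys_iff subset_iff)
      then show "lookup m i = lookup (expo w) i"
        using l[of i] by (cases i) (auto simp: lookup_expo)
    qed
    ultimately show "x = 0 \<and> m = expo w" by simp
  next
    assume "x = 0 \<and> m = expo w"
    then show "?m = expo (x # w)"
      by (intro poly_mapping_eqI, subst lookup_shifted_expo)
        (auto simp: lookup_expo nth_Cons split: nat.splits)
  qed
  then show "lookup (shift (single m c)) (expo (x # w)) =
    (if x = 0 then lookup (single m c) (expo w) else 0)"
    by (auto simp: shift_single lookup_single when_def)
qed

lemma coef_snoc:
  assumes p: "mvars p \<subseteq> {1..r}" and w: "length w = r"
  shows "coef p (w @ [x]) = (if x = 0 then coef p w else 0)"
proof (cases "x = 0")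
  case True
  then have "expo (w @ [x]) = expo w"
    by (intro poly_mapping_eqI) (auto simp: lookup_expo nth_append)
  then show ?thesis using True by (simp add: coef_def)
next
  case False
  then have "Suc r \<in> keys (expo (w @ [x]))"
    using w by (simp add: in_keys_iff lookup_expo nth_append)
  then have "\<not> keys (expo (w @ [x])) \<subseteq> mvars p" using p by auto
  then show ?thesis using False by (simp add: coef_def lookup_outside_mvars)
qed

text \<open>The case of \<open>word_alternal_commutator\<close> by which ad(b) preserves
  alternality.\<close>

lemma alternal_poly_shift:
  assumes p: "mvars p \<subseteq> {1..r}" and r: "r \<ge> 1" and alt: "alternal_poly r p"
  shows "alternal_poly (Suc r) (shift p - p)"
proof -
  have "word_alternal (\<lambda>w. coef (shift p) w - coef p w) (Suc r)"
    using alt r by (intro word_alternal_commutator[where P="coef p"])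
      (auto simp: coef_shift[OF p] coef_snoc[OF p] alternal_poly_iff[OF p])
  moreover have "coef (shift p - p) = (\<lambda>w. coef (shift p) w - coef p w)"
    by (simp add: fun_eq_iff coef_def lookup_minus)
  moreover have "mvars (shift p - p) \<subseteq> {1..Suc r}"
  proof -
    have "{1..r} \<subseteq> {1..Suc r}" by auto
    then show ?thesis using mvars_diff[of "shift p" p] mvars_shift[OF p] p by blast
  qed
  ultimately show ?thesis by (simp add: alternal_poly_iff)
qed

section \<open>Polynomials as elements of the free algebra, evaluation, and Lazard
  elimination\<close>

section \<open>Depth\<close>

abbreviation depth :: "nat \<Rightarrow> freealg \<Rightarrow> bool" where
  "depth \<equiv> graded (\<lambda>w. count_list w Lb)"

lemma depth_mult: "depth n x \<Longrightarrow> depth m y \<Longrightarrow> depth (n + m) (x * y)"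
  by (rule graded_mult) (simp_all add: list_plus)

lemma depth_gen: "depth 0 gen_a" "depth 1 gen_b"
  by (auto simp: graded_def gen_a_def gen_b_def)

lemma lieL_bi_iff: "x \<in> lieL_bi n r \<longleftrightarrow> x \<in> lieL \<and> weight n x \<and> depth r x"
  by (auto simp: lieL_bi_def lieL_wt_iff graded_def)

abbreviation dpart :: "nat \<Rightarrow> freealg \<Rightarrow> freealg" where
  "dpart \<equiv> gpart (\<lambda>w. count_list w Lb)"

section \<open>Moulds as elements of the free algebra\<close>

text \<open>Modulo 2 the exponent n + r of the sign is the sum of the numbers a_i - 1, so the sign
  splits over the letters; absorbed here, it disappears from \<open>Psi\<close>.\<close>

definition cgen :: "nat \<Rightarrow> freealg" where
  "cgen x = qscale ((-1) ^ x) (c_gen (x + 1))"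

lemma cgen_0: "cgen 0 = gen_b"
  by (simp add: cgen_def c_gen_def)

lemma comm_gen_a_cgen: "comm gen_a (cgen x) = - cgen (Suc x)"
  by (simp add: cgen_def c_gen_def comm_qscale_right qscale_uminus_left)

lemma cgen_lieL: "cgen x \<in> lieL"
proof (induction x)
  case (Suc x)
  then show ?case
    using comm_gen_a_cgen[of x] lieL_uminus[OF lieL.comm[OF lieL.gen_a Suc]] by simp
qed (simp add: cgen_0 lieL.intros)

lemma cgen_Suc: "cgen (Suc x) = cgen x * gen_a - gen_a * cgen x"
  using comm_gen_a_cgen[of x] by (simp add: comm_def algebra_simps)

lemma depth_cgen: "depth 1 (cgen x)"
proof (induction x)
  case (Suc x)
  then show ?case
    using graded_diff[OF depth_mult[OF Suc depth_gen(1)]] depth_mult[OF depth_gen(1) Suc] by (simp add: cgen_Suc)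
qed (simp add: cgen_0 depth_gen[simplified])

lemma weight_cgen: "weight (Suc x) (cgen x)"
proof (induction x)
  case (Suc x)
  then show ?case
    using graded_diff[OF weight_mult[OF Suc weight_gen(1)]] weight_mult[OF weight_gen(1) Suc] by (simp add: cgen_Suc)
qed (simp add: cgen_0 weight_gen[simplified])

abbreviation cword :: "nat list \<Rightarrow> freealg" where
  "cword w \<equiv> prod_list (map cgen w)"

lemma depth_cword: "depth (length w) (cword w)"
proof (induction w)
  case (Cons x w)
  then show ?case using depth_mult[OF depth_cgen[of x] Cons] by simp
qed (simp add: graded_one list_zero)

lemma weight_cword: "weight (sum_list w + length w) (cword w)"
proof (induction w)
  case (Cons x w)
  then show ?case using weight_mult[OF weight_cgen[of x] Cons] by (simp add: ac_simps)
qed (simp add: graded_one list_zero)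

lemma comm_gen_a_cword:
  "comm gen_a (cword w) = - (\<Sum>j<length w. cword (w[j := Suc (w ! j)]))"
proof (induction w)
  case (Cons x w)
  have "comm gen_a (cword (x # w)) = comm gen_a (cgen x) * cword w + cgen x * comm gen_a (cword w)"
    by (simp add: comm_def algebra_simps)
  also have "\<dots> = - (\<Sum>j<length (x # w). cword ((x # w)[j := Suc ((x # w) ! j)]))"
    unfolding Cons comm_gen_a_cgen
    by (simp del: sum.lessThan_Suc add: sum.lessThan_Suc_shift sum_distrib_left)
  finally show ?case .
qed (simp add: comm_def)

text \<open>The depth r component of \<open>lie_of_mould\<close>, written on polynomials.\<close>

definition Psi :: "nat \<Rightarrow> mpoly \<Rightarrow> freealg" where
  "Psi r = lin_ext (\<lambda>m c. qscale c (cword (exlist r m)))"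

lemma additive_Psi: "additive (Psi r)"
  unfolding Psi_def by (rule lin_ext_additive) (rule additive_qscale_left)

lemma Psi_single: "Psi r (single m c) = qscale c (cword (exlist r m))"
  unfolding Psi_def by (rule lin_ext_single) (rule additive_qscale_left)

lemmas Psi_add = additive.add[OF additive_Psi]
lemmas Psi_diff = additive.diff[OF additive_Psi]
lemmas Psi_zero = additive.zero[OF additive_Psi]
lemmas Psi_uminus = additive.minus[OF additive_Psi]

lemma Psi_qscale: "Psi r (qscale c p) = qscale c (Psi r p)"
  unfolding Psi_def by (rule lin_ext_qscale) (simp_all add: additive_intros)

lemma sum_list_exlist:
  assumes "keys m \<subseteq> {1..r}"
  shows "sum_list (exlist r m) = mdeg m"
proof -
  have "sum_list (exlist r m) = (\<Sum>i\<in>{1..r}. lookup m i)"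
    unfolding exlist_def by (simp add: interv_sum_list_conv_sum_set_nat atLeastLessThanSuc_atLeastAtMost del: upt_Suc)
  then show ?thesis using assms by (simp add: mdeg_superset[of "{1..r}"])
qed

lemma depth_Psi: "depth r (Psi r p)"
  unfolding Psi_def lin_ext_def
  by (rule graded_sum) (use depth_cword[of "exlist r _"] in \<open>auto intro: graded_qscale\<close>)

lemma weight_Psi:
  assumes "homog d p" "mvars p \<subseteq> {1..r}"
  shows "weight (d + r) (Psi r p)"
  unfolding Psi_def lin_ext_def
proof (rule graded_sum)
  fix m assume m: "m \<in> keys p"
  then have "keys m \<subseteq> {1..r}" "mdeg m = d"
    using assms by (auto simp: mvars_def graded_def)
  then show "weight (d + r) (qscale (lookup p m) (cword (exlist r m)))"
    using weight_cword[of "exlist r m"] by (auto simp: sum_list_exlist intro: graded_qscale)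
qed

lemma exlist_add_single:
  assumes "i \<in> {1..r}"
  shows "exlist r (single i 1 + m) = (exlist r m)[i - 1 := Suc (exlist r m ! (i - 1))]"
proof (rule nth_equalityI)
  fix j assume "j < length (exlist r (single i 1 + m))"
  then have j: "j < r" by simp
  show "exlist r (single i 1 + m) ! j = (exlist r m)[i - 1 := Suc (exlist r m ! (i - 1))] ! j"
  proof (cases "j = i - 1")
    case True
    then show ?thesis using j assms by (simp add: nth_exlist lookup_add lookup_single)
  next
    case False
    then have "i \<noteq> Suc j" using assms by auto
    then show ?thesis using False j assms by (simp add: nth_exlist lookup_add lookup_single when_def)
  qed
qed simp

text \<open>By the Leibniz rule ad(a) raises one exponent of a word in the c_i at a time, which on
  monomials is multiplication by the sum of the variables.\<close>

lemma comm_gen_a_Psi: "comm gen_a (Psi r p) = - Psi r (Xsum r * p)"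
proof (rule additive_eqI[of "\<lambda>p. comm gen_a (Psi r p)" "\<lambda>p. - Psi r (Xsum r * p)"])
  fix m and c :: rat
  have "Xsum r * single m c = (\<Sum>i=1..r. single (single i 1 + m) c)"
    by (simp add: Xsum_def Xv_def sum_distrib_right mult_single)
  then have "Psi r (Xsum r * single m c) =
      qscale c (\<Sum>i=1..r. cword ((exlist r m)[i - 1 := Suc (exlist r m ! (i - 1))]))"
    by (simp add: additive.sum[OF additive_Psi] Psi_single exlist_add_single qscale_sum del: One_nat_def)
  also have "(\<Sum>i=1..r. cword ((exlist r m)[i - 1 := Suc (exlist r m ! (i - 1))])) =
      (\<Sum>j<r. cword ((exlist r m)[j := Suc (exlist r m ! j)]))"
    by (rule sum.reindex_bij_witness[of _ Suc "\<lambda>i. i - 1"]) auto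
  finally show "comm gen_a (Psi r (single m c)) = - Psi r (Xsum r * single m c)"
    by (simp add: Psi_single comm_qscale_right comm_gen_a_cword qscale_uminus)
qed (auto simp: additive_def Psi_add comm_add_right algebra_simps)

lemma gen_b_mult_Psi:
  assumes "mvars p \<subseteq> {1..r}"
  shows "gen_b * Psi r p = Psi (Suc r) (shift p)"
proof (rule additive_eqI[of "\<lambda>p. gen_b * Psi r p" "\<lambda>p. Psi (Suc r) (shift p)"])
  fix m and c :: rat assume "m \<in> keys p"
  then have "keys m \<subseteq> {1..r}" using assms by (auto simp: mvars_def)
  then have "lookup m 0 = 0" by (auto simp: in_keys_iff subset_iff)
  then have "exlist (Suc r) (\<Sum>i\<in>keys m. single (Suc i) (lookup m i)) = 0 # exlist r m"
    by (intro nth_equalityI)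
      (auto simp: nth_exlist lookup_shifted_expo nth_Cons split: nat.splits)
  then show "gen_b * Psi r (single m c) = Psi (Suc r) (shift (single m c))"
    by (simp add: shift_single Psi_single qscale_mult_right cgen_0)
qed (auto simp: additive_def Psi_add additive.add[OF additive_shift] algebra_simps)

lemma Psi_mult_gen_b:
  assumes "mvars p \<subseteq> {1..r}"
  shows "Psi r p * gen_b = Psi (Suc r) p"
proof (rule additive_eqI[of "\<lambda>p. Psi r p * gen_b" "Psi (Suc r)"])
  fix m and c :: rat assume "m \<in> keys p"
  then have "keys m \<subseteq> {1..r}" using assms by (auto simp: mvars_def)
  then have "lookup m (Suc r) = 0" by (auto simp: in_keys_iff subset_iff)
  then have "exlist (Suc r) m = exlist r m @ [0]"
    by (simp add: exlist_def)
  then show "Psi r (single m c) * gen_b = Psi (Suc r) (single m c)"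
    by (simp add: Psi_single qscale_mult_left cgen_0)
qed (auto simp: additive_def Psi_add algebra_simps)

lemma comm_gen_b_Psi:
  "mvars p \<subseteq> {1..r} \<Longrightarrow> comm gen_b (Psi r p) = Psi (Suc r) (shift p - p)"
  by (simp add: comm_def gen_b_mult_Psi Psi_mult_gen_b Psi_diff)

lemma Psi_lieL:
  assumes p: "mvars p \<subseteq> {1..r}" and r: "r \<ge> 1" and alt: "alternal_poly r p"
  shows "Psi r p \<in> lieL"
proof -
  \<comment> \<open>\<open>word_alternal_lieL\<close> asks for a finite alphabet; the exponents that
    occur in p suffice.\<close>
  define K where "K = (\<Union>m\<in>keys p. set (exlist r m))"
  have K: "finite K" by (simp add: K_def)
  have km: "keys m \<subseteq> {1..r}" if "m \<in> keys p" for m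
    using that p by (auto simp: mvars_def)
  have "Psi r p = (\<Sum>m\<in>keys p. qscale (coef p (exlist r m)) (cword (exlist r m)))"
    unfolding Psi_def lin_ext_def coef_def
    by (rule sum.cong) (simp_all add: expo_exlist[OF km])
  also have "\<dots> = (\<Sum>w\<in>exlist r ` keys p. qscale (coef p w) (cword w))"
    by (subst sum.reindex) (auto intro!: inj_onI dest: arg_cong[where f=expo] simp: expo_exlist[OF km])
  also have "\<dots> = (\<Sum>w\<in>words K r. qscale (coef p w) (cword w))"
  proof (rule sum.mono_neutral_left)
    show "finite (words K r)" by (rule finite_words[OF K])
    show "exlist r ` keys p \<subseteq> words K r" by (auto simp: words_def K_def)
    show "\<forall>w\<in>words K r - exlist r ` keys p. qscale (coef p w) (cword w) = 0"
    proof
      fix w assume w: "w \<in> words K r - exlist r ` keys p"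
      then have "exlist r (expo w) = w" by (simp add: words_def exlist_expo)
      then have "expo w \<notin> keys p" using w by (metis DiffD2 imageI)
      then show "qscale (coef p w) (cword w) = 0" by (simp add: coef_def in_keys_iff)
    qed
  qed
  finally show ?thesis
    using word_alternal_lieL[OF K, of "coef p" r cgen] alt r cgen_lieL by (simp add: alternal_poly_iff[OF p])
qed

section \<open>Evaluation of words\<close>

fun word_val :: "(nat \<Rightarrow> ratfun) \<Rightarrow> letter list \<Rightarrow> ratfun" where
  "word_val s [] = 1"
| "word_val s (La # w) = s 0 * word_val s w"
| "word_val s (Lb # w) = word_val (\<lambda>i. s (Suc i)) w"

text \<open>\<open>val s f\<close> is \<open>f(s\<^sub>0, s\<^sub>1, \<dots>)\<close> when \<open>a\<^bsup>e\<^sub>0\<^esup> b a\<^bsup>e\<^sub>1\<^esup> b \<dots> b a\<^bsup>e\<^sub>r\<^esup>\<close> is identified with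
  the monomial \<open>s\<^sub>0\<^bsup>e\<^sub>0\<^esup> \<dots> s\<^sub>r\<^bsup>e\<^sub>r\<^esup>\<close>.\<close>

definition val :: "(nat \<Rightarrow> ratfun) \<Rightarrow> freealg \<Rightarrow> ratfun" where
  "val s = lin_ext (\<lambda>w c. rf_const c * word_val s w)"

lemma additive_rf_const_mult: "additive (\<lambda>c. rf_const c * x)"
  by (simp add: additive_def rf.h_add algebra_simps)

lemma additive_val: "additive (val s)"
  unfolding val_def by (rule lin_ext_additive) (rule additive_rf_const_mult)

lemma val_single: "val s (single w c) = rf_const c * word_val s w"
  unfolding val_def by (rule lin_ext_single) (rule additive_rf_const_mult)

lemmas val_add = additive.add[OF additive_val]
lemmas val_diff = additive.diff[OF additive_val]
lemmas val_zero = additive.zero[OF additive_val]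

lemma val_qscale: "val s (qscale c x) = rf_const c * val s x"
  unfolding val_def
  by (rule lin_ext_qscale) (simp_all add: additive_rf_const_mult rf.h_mult mult.assoc additive_def algebra_simps)

lemma val_one: "val s 1 = 1"
  using val_single[of s "[]" 1] by (simp add: rf_const_simps)

lemma word_val_append: "word_val s (v @ w) = word_val s v * word_val (\<lambda>i. s (i + count_list v Lb)) w"
  by (induction s v rule: word_val.induct) (simp_all add: mult.assoc)

text \<open>The left factor has passed k letters b, so the right factor is read from index k
  on.\<close>

lemma val_mult:
  assumes "depth k x"
  shows "val s (x * y) = val s x * val (\<lambda>i. s (i + k)) y"
proof (rule additive_eqI[of "\<lambda>x. val s (x * y)" "\<lambda>x. val s x * val (\<lambda>i. s (i + k)) y"])
  fix v c assume "v \<in> keys x"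
  then have v: "count_list v Lb = k" using assms by (simp add: graded_def)
  show "val s (single v c * y) = val s (single v c) * val (\<lambda>i. s (i + k)) y"
    by (rule additive_eqI[of "\<lambda>y. val s (single v c * y)"])
      (simp_all add: additive_def val_add algebra_simps single_mult_word val_single word_val_append v rf.h_mult)
qed (auto simp: additive_def val_add algebra_simps)

lemma word_val_cong:
  "(\<And>i. i \<le> count_list w Lb \<Longrightarrow> s i = t i) \<Longrightarrow> word_val s w = word_val t w"
proof (induction w arbitrary: s t)
  case (Cons l w)
  show ?case
  proof (cases l)
    case La
    have "word_val s w = word_val t w" by (rule Cons.IH) (rule Cons.prems, simp add: La)
    then show ?thesis using Cons.prems[of 0] by (simp add: La)
  next
    case Lb
    have "word_val (\<lambda>i. s (Suc i)) w = word_val (\<lambda>i. t (Suc i)) w"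
      by (rule Cons.IH) (rule Cons.prems, simp add: Lb)
    then show ?thesis by (simp add: Lb)
  qed
qed simp

lemma val_cong:
  assumes "depth k x" "\<And>i. i \<le> k \<Longrightarrow> s i = t i"
  shows "val s x = val t x"
  by (rule additive_eqI[OF additive_val additive_val])
    (use assms in \<open>auto simp: val_single graded_def intro!: word_val_cong\<close>)

lemma val_gen: "val s gen_a = s 0" "val s gen_b = 1"
  by (simp_all add: gen_a_def gen_b_def val_single rf_const_simps)

lemma val_cgen: "val s (cgen x) = (s 1 - s 0) ^ x"
proof (induction x)
  case (Suc x)
  then show ?case
    by (simp add: cgen_Suc val_diff val_mult[OF depth_cgen] val_mult[OF depth_gen(1)] val_gen algebra_simps)
qed (simp add: cgen_0 val_gen)

lemma val_cword: "val s (cword w) = (\<Prod>j<length w. (s (Suc j) - s j) ^ (w ! j))"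
proof (induction w arbitrary: s)
  case (Cons x w)
  then show ?case
    by (simp add: val_mult[OF depth_cgen] val_cgen prod.lessThan_Suc_shift del: prod.lessThan_Suc)
qed (simp add: val_one)

text \<open>Each c_i sees only two neighbouring variables and evaluates to a power of their
  difference; this is the origin of u_i = z_i - z_{i-1}.\<close>

lemma val_Psi:
  assumes "mvars p \<subseteq> {1..r}"
  shows "val s (Psi r p) = poly_eval (\<lambda>i. s i - s (i - 1)) p"
proof (rule additive_eqI[OF additive_comp[OF additive_val additive_Psi] additive_poly_eval])
  fix m c assume "m \<in> keys p"
  then have km: "keys m \<subseteq> {1..r}" using assms by (auto simp: mvars_def)
  have "mpow (\<lambda>i. s i - s (i - 1)) m = (\<Prod>i\<in>{1..r}. (s i - s (i - 1)) ^ lookup m i)"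
    by (rule mpow_superset) (use km in auto)
  also have "\<dots> = (\<Prod>j<r. (s (Suc j) - s j) ^ lookup m (Suc j))"
    by (rule prod.reindex_bij_witness[of _ Suc "\<lambda>i. i - 1"]) auto
  finally show "val s (Psi r (single m c)) = poly_eval (\<lambda>i. s i - s (i - 1)) (single m c)"
    by (simp only: Psi_single val_qscale val_cword poly_eval_single length_exlist) (simp add: nth_exlist)
qed

lemma Psi_inj:
  assumes "mvars p \<subseteq> {1..r}" "Psi r p = 0"
  shows "p = 0"
proof -
  \<comment> \<open>With partial sums as values, the differences of neighbours are the variables
    themselves, and p can be read off.\<close>
  let ?s = "\<lambda>i. \<Sum>j=1..i. uvar j"
  have "poly_eval (\<lambda>i. ?s i - ?s (i - 1)) p = poly_eval uvar p"
  proof (rule poly_eval_cong)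
    fix i assume "i \<in> mvars p"
    then obtain j where "i = Suc j" using assms(1) by (cases i) auto
    then show "?s i - ?s (i - 1) = uvar i" by simp
  qed
  then have "frp p = 0"
    using val_Psi[OF assms(1), of ?s] by (simp add: assms(2) val_zero poly_eval_uvar)
  then show ?thesis by simp
qed

section \<open>Families of polynomials\<close>

definition poly_family :: "(nat \<Rightarrow> mpoly) \<Rightarrow> bool" where
  "poly_family p \<longleftrightarrow> finite {r. p r \<noteq> 0} \<and> (\<forall>r. mvars (p r) \<subseteq> {1..r})"

definition Psum :: "(nat \<Rightarrow> mpoly) \<Rightarrow> freealg" where
  "Psum p = (\<Sum>r\<in>{r. p r \<noteq> 0}. Psi r (p r))"

lemma Psum_superset: "finite S \<Longrightarrow> {r. p r \<noteq> 0} \<subseteq> S \<Longrightarrow> Psum p = (\<Sum>r\<in>S. Psi r (p r))"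
  unfolding Psum_def by (rule sum.mono_neutral_left) (auto simp: Psi_zero)

lemma poly_family_add: "poly_family p \<Longrightarrow> poly_family q \<Longrightarrow> poly_family (\<lambda>r. p r + q r)"
proof -
  assume pq: "poly_family p" "poly_family q"
  have "finite {r. p r + q r \<noteq> 0}"
    by (rule finite_subset[of _ "{r. p r \<noteq> 0} \<union> {r. q r \<noteq> 0}"]) (use pq in \<open>auto simp: poly_family_def\<close>)
  moreover have "mvars (p r + q r) \<subseteq> {1..r}" for r
    using mvars_add[of "p r" "q r"] pq unfolding poly_family_def by blast
  ultimately show ?thesis by (simp add: poly_family_def)
qed

lemma poly_family_qscale: "poly_family p \<Longrightarrow> poly_family (\<lambda>r. qscale c (p r))"
proof -
  assume p: "poly_family p"
  have "finite {r. qscale c (p r) \<noteq> 0}"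
    by (rule finite_subset[of _ "{r. p r \<noteq> 0}"]) (use p in \<open>auto simp: poly_family_def\<close>)
  moreover have "mvars (qscale c (p r)) \<subseteq> {1..r}" for r
    using mvars_qscale[of c "p r"] p unfolding poly_family_def by blast
  ultimately show ?thesis by (simp add: poly_family_def)
qed

lemma Psum_add:
  assumes "poly_family p" "poly_family q"
  shows "Psum (\<lambda>r. p r + q r) = Psum p + Psum q"
proof -
  let ?S = "{r. p r \<noteq> 0} \<union> {r. q r \<noteq> 0}"
  have S: "finite ?S" using assms by (simp add: poly_family_def)
  have "Psum (\<lambda>r. p r + q r) = (\<Sum>r\<in>?S. Psi r (p r + q r))" "Psum p = (\<Sum>r\<in>?S. Psi r (p r))"
    "Psum q = (\<Sum>r\<in>?S. Psi r (q r))"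
    by (rule Psum_superset[OF S]; auto)+
  then show ?thesis by (simp add: Psi_add sum.distrib)
qed

lemma Psum_qscale:
  assumes "poly_family p"
  shows "Psum (\<lambda>r. qscale c (p r)) = qscale c (Psum p)"
proof -
  let ?S = "{r. p r \<noteq> 0}"
  have S: "finite ?S" using assms by (simp add: poly_family_def)
  have "Psum (\<lambda>r. qscale c (p r)) = (\<Sum>r\<in>?S. Psi r (qscale c (p r)))" "Psum p = (\<Sum>r\<in>?S. Psi r (p r))"
    by (rule Psum_superset[OF S]; auto)+
  then show ?thesis by (simp add: Psi_qscale qscale_sum)
qed

text \<open>Depth separates the components, so a family can be recovered from its sum.\<close>

lemma dpart_Psum:
  assumes "poly_family p"
  shows "dpart r (Psum p) = Psi r (p r)"
proof -
  let ?S = "insert r {r. p r \<noteq> 0}"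
  have "finite ?S" using assms by (simp add: poly_family_def)
  then have "dpart r (Psum p) = (\<Sum>s\<in>?S. dpart r (Psi s (p s)))"
    by (subst Psum_superset[of ?S]) (auto simp: additive.sum[OF additive_gpart])
  also have "\<dots> = (\<Sum>s\<in>?S. if r = s then Psi s (p s) else 0)"
    by (simp add: gpart_graded[OF depth_Psi])
  also have "\<dots> = Psi r (p r)"
    using \<open>finite ?S\<close> by (subst sum.delta') auto
  finally show ?thesis .
qed

lemma Psum_inj:
  assumes "poly_family p" "poly_family q" "Psum p = Psum q"
  shows "p = q"
proof
  fix r
  have mv: "mvars (p r - q r) \<subseteq> {1..r}"
    using mvars_diff[of "p r" "q r"] assms(1,2) unfolding poly_family_def by blast
  have "Psi r (p r - q r) = dpart r (Psum p) - dpart r (Psum q)"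
    by (simp add: dpart_Psum assms(1,2) Psi_diff)
  then have "p r - q r = 0" using Psi_inj[OF mv] assms(3) by simp
  then show "p r = q r" by simp
qed

lemma poly_family_Xsum:
  assumes "poly_family p"
  shows "poly_family (\<lambda>r. - (Xsum r * p r))"
proof -
  have "finite {r. - (Xsum r * p r) \<noteq> 0}"
    by (rule finite_subset[of _ "{r. p r \<noteq> 0}"]) (use assms in \<open>auto simp: poly_family_def\<close>)
  moreover have "mvars (- (Xsum r * p r)) \<subseteq> {1..r}" for r
    using mvars_mult_le[OF mvars_Xsum, of "p r" r] assms by (simp add: poly_family_def)
  ultimately show ?thesis by (simp add: poly_family_def)
qed

lemma comm_gen_a_Psum:
  assumes "poly_family p"
  shows "comm gen_a (Psum p) = Psum (\<lambda>r. - (Xsum r * p r))"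
proof -
  let ?S = "{r. p r \<noteq> 0}"
  have S: "finite ?S" using assms by (simp add: poly_family_def)
  have "Psum (\<lambda>r. - (Xsum r * p r)) = (\<Sum>r\<in>?S. Psi r (- (Xsum r * p r)))"
    by (rule Psum_superset[OF S]) auto
  then show ?thesis
    by (simp add: Psum_def additive.sum[OF additive_comm_right] comm_gen_a_Psi Psi_uminus)
qed

text \<open>The family of [b, f]; bracketing with b raises depth by one, whence the index
  shift.\<close>

definition raise :: "(nat \<Rightarrow> mpoly) \<Rightarrow> nat \<Rightarrow> mpoly" where
  "raise p r = (case r of 0 \<Rightarrow> 0 | Suc s \<Rightarrow> shift (p s) - p s)"

lemma raise_support: "{r. raise p r \<noteq> 0} \<subseteq> Suc ` {r. p r \<noteq> 0}"
proof
  fix r assume r: "r \<in> {r. raise p r \<noteq> 0}"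
  then obtain s where s: "r = Suc s" by (cases r) (auto simp: raise_def)
  then have "p s \<noteq> 0" using r by (auto simp: raise_def additive.zero[OF additive_shift])
  then show "r \<in> Suc ` {r. p r \<noteq> 0}" using s by simp
qed

lemma poly_family_raise:
  assumes "poly_family p"
  shows "poly_family (raise p)"
proof -
  have "finite {r. raise p r \<noteq> 0}"
    by (rule finite_subset[OF raise_support]) (use assms in \<open>simp add: poly_family_def\<close>)
  moreover have "mvars (raise p r) \<subseteq> {1..r}" for r
  proof (cases r)
    case (Suc s)
    have p: "mvars (p s) \<subseteq> {1..s}" using assms by (simp add: poly_family_def)
    have "{1..s} \<subseteq> {1..Suc s}" by auto
    then show ?thesis
      using mvars_diff[of "shift (p s)" "p s"] mvars_shift[OF p] p unfolding raise_def Suc nat.case by blast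
  qed (simp add: raise_def)
  ultimately show ?thesis by (simp add: poly_family_def)
qed

lemma comm_gen_b_Psum:
  assumes "poly_family p"
  shows "comm gen_b (Psum p) = Psum (raise p)"
proof -
  have "Psum (raise p) = (\<Sum>r\<in>Suc ` {r. p r \<noteq> 0}. Psi r (raise p r))"
    by (rule Psum_superset[OF _ raise_support]) (use assms in \<open>simp add: poly_family_def\<close>)
  also have "\<dots> = (\<Sum>r\<in>{r. p r \<noteq> 0}. Psi (Suc r) (shift (p r) - p r))"
    by (simp add: sum.reindex raise_def)
  also have "\<dots> = comm gen_b (Psum p)"
    using assms by (simp add: Psum_def additive.sum[OF additive_comm_right] comm_gen_b_Psi poly_family_def)
  finally show ?thesis ..
qed

definition alternal_family :: "(nat \<Rightarrow> mpoly) \<Rightarrow> bool" where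
  "alternal_family p \<longleftrightarrow> poly_family p \<and> p 0 = 0 \<and> (\<forall>r. alternal_poly r (p r))"

lemma lookup_Psum_La:
  assumes "poly_family p" "p 0 = 0"
  shows "lookup (Psum p) [La] = 0"
proof -
  have "lookup (Psum p) [La] = lookup (dpart 0 (Psum p)) [La]"
    by (simp add: gpart_def lookup_restr)
  then show ?thesis by (simp add: dpart_Psum assms Psi_zero)
qed

text \<open>Lazard elimination: \<open>L\<close> is spanned by \<open>a\<close> and the alternal combinations of the \<open>c\<^sub>i\<close>. The
  elements whose bracket preserves this space form a Lie subalgebra containing \<open>a\<close> and \<open>b\<close>.\<close>

lemma lieL_decomp:
  assumes "x \<in> lieL"
  shows "\<exists>k p. alternal_family p \<and> x = qscale k gen_a + Psum p"
proof -
  define T0 where "T0 = {Psum p | p. alternal_family p}"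
  define T where "T = {qscale k gen_a + y | k y. y \<in> T0}"
  have T0_add: "x + y \<in> T0" if "x \<in> T0" "y \<in> T0" for x y
  proof -
    from that obtain p q where "x = Psum p" "y = Psum q" "alternal_family p" "alternal_family q"
      by (auto simp: T0_def)
    then show ?thesis
      unfolding T0_def
      by (auto intro!: exI[of _ "\<lambda>r. p r + q r"]
          simp: alternal_family_def Psum_add poly_family_add alternal_poly_add)
  qed
  have T0_scale: "qscale c x \<in> T0" if "x \<in> T0" for c x
  proof -
    from that obtain p where "x = Psum p" "alternal_family p" by (auto simp: T0_def)
    then show ?thesis
      unfolding T0_def
      by (auto intro!: exI[of _ "\<lambda>r. qscale c (p r)"]
          simp: alternal_family_def Psum_qscale poly_family_qscale alternal_poly_qscale)
  qed
  have a_T0: "comm gen_a x \<in> T0" if "x \<in> T0" for x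
  proof -
    from that obtain p where p: "x = Psum p" "alternal_family p" by (auto simp: T0_def)
    have "alternal_poly r (- (Xsum r * p r))" for r
      using p(2) alternal_poly_Xsum[of r "p r"]
      by (cases r) (auto simp: alternal_family_def alternal_poly_zero intro: alternal_poly_uminus)
    then have "alternal_family (\<lambda>r. - (Xsum r * p r))"
      using p(2) poly_family_Xsum by (simp add: alternal_family_def)
    then show ?thesis
      using p comm_gen_a_Psum[of p] by (auto simp: T0_def alternal_family_def)
  qed
  have b_T0: "comm gen_b x \<in> T0" if "x \<in> T0" for x
  proof -
    from that obtain p where p: "x = Psum p" "alternal_family p" by (auto simp: T0_def)
    have "alternal_poly r (raise p r)" for r
    proof (cases r)
      case (Suc s)
      then show ?thesis
        using p(2) alternal_poly_shift[of "p s" s]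
        by (cases s) (auto simp: raise_def alternal_family_def poly_family_def alternal_poly_zero
            additive.zero[OF additive_shift])
    qed (simp add: raise_def alternal_poly_zero)
    then have "alternal_family (raise p)"
      using p(2) poly_family_raise by (simp add: alternal_family_def) (simp add: raise_def)
    then show ?thesis
      using p comm_gen_b_Psum[of p] by (auto simp: T0_def alternal_family_def)
  qed
  \<comment> \<open>The letter b = c_1 is the constant 1 in depth 1.\<close>
  have b: "gen_b \<in> T0"
  proof -
    let ?p = "\<lambda>r. if r = 1 then 1 else (0 :: mpoly)"
    have eq: "{r. ?p r \<noteq> 0} = {1}" by auto
    have "Psum ?p = Psi 1 (single 0 1)"
      by (simp add: Psum_def eq)
    also have "\<dots> = gen_b"
      by (simp only: Psi_single) (simp add: exlist_def cgen_0)
    finally have "Psum ?p = gen_b" .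
    moreover have "alternal_family ?p"
      unfolding alternal_family_def poly_family_def eq
      by (intro conjI allI) (auto simp: alternal_poly_zero, auto simp: alternal_poly_def)
    ultimately show ?thesis unfolding T0_def by (intro CollectI exI[of _ ?p]) simp
  qed
  have T0_T: "x \<in> T" if "x \<in> T0" for x
    unfolding T_def using that by (intro CollectI exI[of _ 0] exI[of _ x]) simp
  have T_add: "x + y \<in> T" if "x \<in> T" "y \<in> T" for x y
  proof -
    from that obtain k x' l y' where "x = qscale k gen_a + x'" "y = qscale l gen_a + y'" "x' \<in> T0" "y' \<in> T0"
      by (auto simp: T_def)
    then show ?thesis
      unfolding T_def using T0_add
      by (intro CollectI exI[of _ "k + l"] exI[of _ "x' + y'"]) (simp add: qscale_left_add)
  qed
  have T_scale: "qscale c x \<in> T" if "x \<in> T" for c x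
  proof -
    from that obtain k x' where "x = qscale k gen_a + x'" "x' \<in> T0" by (auto simp: T_def)
    then show ?thesis
      unfolding T_def using T0_scale
      by (intro CollectI exI[of _ "c * k"] exI[of _ "qscale c x'"]) (simp add: qscale_add)
  qed
  have T_diff: "x - y \<in> T" if "x \<in> T" "y \<in> T" for x y
    using T_add[OF that(1) T_scale[OF that(2), of "-1"]] by (simp add: qscale_neg_one)
  have a: "gen_a \<in> T"
  proof -
    have "0 \<in> T0" using T0_scale[OF b, of 0] by simp
    then show ?thesis unfolding T_def by (intro CollectI exI[of _ 1] exI[of _ 0]) simp
  qed
  have N: "comm x t \<in> T" if "x \<in> lieL" "t \<in> T" for x t
    using that
  proof (induction arbitrary: t)
    case gen_a
    then obtain k y where "t = qscale k gen_a + y" "y \<in> T0" by (auto simp: T_def)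
    then show ?case by (simp add: comm_add_right comm_qscale_right comm_self a_T0 T0_T)
  next
    case gen_b
    then obtain k y where t: "t = qscale k gen_a + y" "y \<in> T0" by (auto simp: T_def)
    have "comm gen_b gen_a = qscale (-1) (comm gen_a gen_b)"
      by (simp add: comm_antisym[of gen_b] qscale_neg_one)
    then have "comm gen_b gen_a \<in> T0" using T0_scale[OF a_T0[OF b], of "-1"] by simp
    then show ?case
      using t by (simp add: comm_add_right comm_qscale_right b_T0 T0_T T_add T_scale)
  next
    case (comm x y)
    then show ?case by (simp add: comm_jacobi T_diff)
  qed (simp_all add: comm_add_left comm_qscale_left T_add T_scale)
  have "x \<in> T"
    using assms by induction (auto simp: a b T0_T T_add T_scale N)
  then show ?thesis by (auto simp: T_def T0_def)
qed

section \<open>Push-invariance as the solvability of [a,g] = [b,f]\<close>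

section \<open>Push-invariance\<close>

definition push_subst :: "nat \<Rightarrow> nat \<Rightarrow> mpoly" where
  "push_subst r i = (if i < r then Xv (Suc i) else - Xsum r)"

definition push_inv :: "nat \<Rightarrow> mpoly \<Rightarrow> bool" where
  "push_inv r p \<longleftrightarrow> sub (push_subst r) p = p"

lemma Xsum_Suc: "Xsum (Suc r) = Xsum r + Xv (Suc r)"
  by (simp add: Xsum_def)

text \<open>Congruence modulo D respects sums and products, so it is enough to compare constants and
  variables. This stands in for division by a linear form with remainder.\<close>

lemma dvd_diff_sub:
  assumes "\<And>c. D dvd Cst c - sub t (Cst c)" "\<And>i. (D :: mpoly) dvd Xv i - t i"
  shows "D dvd h - sub t h"
proof -
  let ?S = "{h. D dvd h - sub t h}"
  have mult: "x * y \<in> ?S" if "x \<in> ?S" "y \<in> ?S" for x y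
  proof -
    have "x * y - sub t (x * y) = x * (y - sub t y) + (x - sub t x) * sub t y"
      by (simp add: sub_simps algebra_simps)
    then show ?thesis using that by simp
  qed
  have one: "1 \<in> ?S" by (simp add: sub_simps)
  have X: "Xv i \<in> ?S" for i using assms(2) by (simp add: sub_simps)
  have pow: "Xv i ^ k \<in> ?S" for i k
    by (induction k) (use one mult X in auto)
  have prod: "(\<Prod>i\<in>I. Xv i ^ k i) \<in> ?S" for I :: "nat set" and k
    by (induction I rule: infinite_finite_induct) (use one mult pow in auto)
  have mono: "single m c \<in> ?S" for m c
  proof -
    have "single m c = Cst c * mpow Xv m" by (simp add: mpow_Xv mult_single)
    moreover have "mpow Xv m \<in> ?S" unfolding mpow_def by (rule prod)
    ultimately show ?thesis using mult[of "Cst c"] assms(1) by simp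
  qed
  have "h - sub t h = (\<Sum>m\<in>keys h. single m (lookup h m)
      - sub t (single m (lookup h m)))"
    by (rule additive_expand[of "\<lambda>h. h - sub t h"]) (simp add: additive_def sub_simps)
  then show ?thesis using mono by (auto intro!: dvd_sum)
qed

text \<open>The difference \<open>p - shift p\<close> is divisible by \<open>X\<^sub>1 + \<dots> + X\<^sub>r\<^sub>+\<^sub>1\<close> exactly when it vanishes at
  \<open>X\<^sub>r\<^sub>+\<^sub>1 = -(X\<^sub>1 + \<dots> + X\<^sub>r)\<close>.\<close>

lemma push_inv_iff:
  assumes p: "mvars p \<subseteq> {1..r}"
  shows "push_inv r p \<longleftrightarrow> (\<exists>q. mvars q \<subseteq> {1..Suc r} \<and> Xsum (Suc r) * q = p - shift p)"
proof -
  \<comment> \<open>\<open>t\<close> imposes X_1 + ... + X_{r+1} = 0; it fixes p and turns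
    \<open>shift p\<close> into the push of p.\<close>
  define t where "t = (\<lambda>i. if i = Suc r then - Xsum r else Xv i)"
  have tp: "sub t p = p"
  proof -
    have "sub t p = sub Xv p" using p by (intro cst.evl_cong) (auto simp: t_def)
    then show ?thesis by (simp add: sub_Xv)
  qed
  have tsh: "sub t (shift p) = sub (push_subst r) p"
    unfolding shift_def sub_sub using p
    by (intro cst.evl_cong) (auto simp: t_def push_subst_def sub_simps)
  have tX: "sub t (Xsum (Suc r)) = 0"
  proof -
    have "sub t (Xsum r) = sub Xv (Xsum r)"
      using mvars_Xsum[of r] by (intro cst.evl_cong) (auto simp: t_def)
    then show ?thesis by (simp add: Xsum_Suc sub_simps sub_Xv) (simp add: t_def)
  qed
  show ?thesis
  proof
    assume "push_inv r p"
    then have z: "sub t (p - shift p) = 0" by (simp add: sub_simps tp tsh push_inv_def)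
    have "Xsum (Suc r) dvd (p - shift p) - sub t (p - shift p)"
      by (rule dvd_diff_sub) (auto simp: sub_simps t_def Xsum_Suc add.commute)
    then obtain q where q: "p - shift p = Xsum (Suc r) * q" using z by (auto simp: dvd_def)
    \<comment> \<open>The quotient found might involve further variables; setting these to 0 does
      not disturb the equation.\<close>
    define P where "P = (\<lambda>i. if i \<in> {1..Suc r} then Xv i else 0)"
    have P: "sub P h = h" if "mvars h \<subseteq> {1..Suc r}" for h
    proof -
      have "sub P h = sub Xv h" using that by (intro cst.evl_cong) (auto simp: P_def)
      then show ?thesis by (simp add: sub_Xv)
    qed
    have "{1..r} \<subseteq> {1..Suc r}" by auto
    then have "mvars (p - shift p) \<subseteq> {1..Suc r}"
      using mvars_diff[of p "shift p"] mvars_shift[OF p] p by blast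
    then have "p - shift p = Xsum (Suc r) * sub P q"
      using arg_cong[OF q, of "sub P"] by (simp only: cst.evl_mult P mvars_Xsum)
    moreover have "mvars (sub P q) \<subseteq> {1..Suc r}"
      using mvars_sub[of P q] by (auto simp: P_def split: if_splits)
    ultimately show "\<exists>q. mvars q \<subseteq> {1..Suc r} \<and> Xsum (Suc r) * q = p - shift p" by metis
  next
    assume "\<exists>q. mvars q \<subseteq> {1..Suc r} \<and> Xsum (Suc r) * q = p - shift p"
    then obtain q where "Xsum (Suc r) * q = p - shift p" by blast
    then have "sub t (Xsum (Suc r) * q) = sub t (p - shift p)" by simp
    then show "push_inv r p" by (simp add: sub_simps tX tp tsh push_inv_def)
  qed
qed

lemma homog_shift:
  assumes "homog d p"
  shows "homog d (shift p)"
proof -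
  have "hom_part d (shift p) = shift (hom_part d p)"
    unfolding shift_def by (rule hom_part_sub) simp
  then show ?thesis using assms homog_hom_part[of d "shift p"] by (simp add: hom_part_homog)
qed

text \<open>\<open>Xsum\<close> is homogeneous of degree 1, and cancelling it leaves degree d - 1
  for q. For d = 0 this says that q has no monomials.\<close>

lemma homog_partner:
  assumes p: "homog d p" and q: "Xsum (Suc r) * q = p - shift p" and m: "m \<in> keys q"
  shows "Suc (mdeg m) = d"
proof (rule ccontr)
  assume neq: "Suc (mdeg m) \<noteq> d"
  have "Xsum (Suc r) * hom_part (mdeg m) q = hom_part (1 + mdeg m) (p - shift p)"
    using hom_part_mult_homog[OF homog_Xsum, of "mdeg m" "Suc r" q] q by simp
  also have "\<dots> = 0"
    using neq hom_part_homog[OF graded_diff[OF p homog_shift[OF p]]] by simp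
  finally have "hom_part (mdeg m) q = 0" using Xsum_nonzero[of "Suc r"] by simp
  then have "lookup (hom_part (mdeg m) q) m = 0" by simp
  then show False using m by (simp add: hom_part_eq_gpart gpart_def lookup_restr in_keys_iff)
qed

lemma push_inv_hom_part:
  assumes "push_inv r p"
  shows "push_inv r (hom_part d p)"
proof -
  have "hom_part d (sub (push_subst r) p) = sub (push_subst r) (hom_part d p)"
    by (rule hom_part_sub) (use graded_uminus[OF homog_Xsum] in \<open>simp add: push_subst_def\<close>)
  then show ?thesis using assms by (simp add: push_inv_def)
qed

section \<open>Cyclic sums, the divergence, and circ-constancy\<close>

section \<open>Traces of words with \<open>r\<close> letters \<open>b\<close>\<close>

text \<open>The cyclic sequence \<open>v\<^sub>r, v\<^sub>r\<^sub>-\<^sub>1, \<dots>, v\<^sub>1, v\<^sub>r, \<dots>\<close>.\<close>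

definition zidx :: "nat \<Rightarrow> nat \<Rightarrow> nat" where
  "zidx r j = r - j mod r"

abbreviation zeta :: "nat \<Rightarrow> nat \<Rightarrow> ratfun" where
  "zeta r j \<equiv> uvar (zidx r j)"

lemma zidx_period [simp]: "zidx r (j + r) = zidx r j" "zidx r (r + j) = zidx r j"
  by (simp_all add: zidx_def)

text \<open>The sequence has period r, which builds in z_r = z_0: letters a before the first b and
  after the last b are read in the same variable.\<close>

definition cyc_val :: "nat \<Rightarrow> freealg \<Rightarrow> ratfun" where
  "cyc_val r x = (\<Sum>i<r. val (\<lambda>j. zeta r (i + j)) (dpart r x))"

lemma additive_cyc_val: "additive (cyc_val r)"
  unfolding cyc_val_def by (intro additive_sum additive_comp[OF additive_val additive_gpart])

lemmas cyc_val_diff = additive.diff[OF additive_cyc_val]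

lemma dpart_qscale: "dpart r (qscale c x) = qscale c (dpart r x)"
  by (rule poly_mapping_eqI) (simp add: gpart_def lookup_restr lookup_qscale)

lemma cyc_val_qscale: "cyc_val r (qscale c x) = rf_const c * cyc_val r x"
  by (simp add: cyc_val_def dpart_qscale val_qscale sum_distrib_left)

lemma dpart_single: "dpart r (single w c) = (if count_list w Lb = r then single w c else 0)"
  by (simp add: gpart_def restr_single)

lemma sum_periodic:
  fixes g :: "nat \<Rightarrow> 'c::ab_group_add"
  assumes "g r = g 0"
  shows "(\<Sum>i<r. g (Suc i)) = (\<Sum>i<r. g i)"
proof -
  have "(\<Sum>i<Suc r. g i) = g 0 + (\<Sum>i<r. g (Suc i))" by (rule sum.lessThan_Suc_shift)
  then show ?thesis using assms by simp
qed

text \<open>Rotating a letter a keeps the monomial, since the first and last variables coincide;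
  rotating a letter b starts the cycle one step later, which the sum over i absorbs.\<close>

lemma cyc_val_tr_zero:
  assumes "tr x = 0"
  shows "cyc_val r x = 0"
proof (rule rotation_invariant_tr_zero[OF additive_cyc_val _ assms])
  fix l :: letter and w and c :: rat
  show "cyc_val r (single (w @ [l]) c) = cyc_val r (single (l # w) c)"
  proof (cases l)
    case La
    have "word_val (\<lambda>j. zeta r (i + j)) (w @ [La]) = word_val (\<lambda>j. zeta r (i + j)) (La # w)"
      if "count_list w Lb = r" for i
      using that by (simp add: word_val_append)
    then show ?thesis by (simp add: La cyc_val_def dpart_single val_single)
  next
    case Lb
    have "(\<Sum>i<r. word_val (\<lambda>j. zeta r (i + j)) (Lb # w)) = (\<Sum>i<r. word_val (\<lambda>j. zeta r (Suc i + j)) w)"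
      by simp
    also have "\<dots> = (\<Sum>i<r. word_val (\<lambda>j. zeta r (i + j)) w)"
      by (rule sum_periodic[of "\<lambda>i. word_val (\<lambda>j. zeta r (i + j)) w"]) simp
    finally show ?thesis
      by (auto simp: Lb cyc_val_def dpart_single val_single word_val_append simp flip: sum_distrib_left)
  qed
qed

fun cyc_expo :: "nat \<Rightarrow> nat \<Rightarrow> letter list \<Rightarrow> (nat \<Rightarrow>\<^sub>0 nat)" where
  "cyc_expo r i [] = 0"
| "cyc_expo r i (La # w) = single (zidx r i) 1 + cyc_expo r i w"
| "cyc_expo r i (Lb # w) = cyc_expo r (Suc i) w"

lemma word_val_zeta:
  "word_val (\<lambda>j. zeta r (i + j)) w = frp (single (cyc_expo r i w) 1)"
proof (induction r i w rule: cyc_expo.induct)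
  case (2 r i w)
  then show ?case
    by (simp add: frp_Xv[symmetric] Xv_def mult_single flip: frp_mult)
qed (simp_all add: frp_one)

text \<open>Every letter b closes a block of letters a, so the word has no final block. For j < r
  the index \<open>r - j\<close> is \<open>zidx r j\<close>.\<close>

definition word_of_expo :: "nat \<Rightarrow> nat \<Rightarrow> (nat \<Rightarrow>\<^sub>0 nat) \<Rightarrow> letter list" where
  "word_of_expo r i m = concat (map (\<lambda>j. replicate (lookup m (r - j)) La @ [Lb]) [i..<r])"

lemma cyc_expo_bound:
  assumes "w = [] \<or> last w = Lb" "count_list w Lb + i = r" "lookup (cyc_expo r i w) k \<noteq> 0"
  shows "k \<le> r - i"
  using assms
proof (induction r i w rule: cyc_expo.induct)
  case (2 r i w)
  then have w: "w \<noteq> []" "last w = Lb" by (auto split: if_splits)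
  then have "count_list w Lb \<noteq> 0" by (metis count_list_0_iff last_in_set)
  then have "i < r" using 2 by simp
  then show ?case using 2 w by (cases "k = r - i") (auto simp: lookup_add lookup_single zidx_def when_def)
next
  case (3 r i w)
  then have "k \<le> r - Suc i" by (intro "3.IH") (auto split: if_splits)
  then show ?case by simp
qed simp

text \<open>A word ending in b has no final letters a, which would wrap around the cycle; the blocks
  are then read in distinct variables, and the monomial determines the word.\<close>

lemma word_of_cyc_expo:
  assumes "w = [] \<or> last w = Lb" "count_list w Lb + i = r"
  shows "word_of_expo r i (cyc_expo r i w) = w"
  using assms
proof (induction r i w rule: cyc_expo.induct)
  case (1 r i)
  then show ?case by (simp add: word_of_expo_def)
next
  case (2 r i w)
  then have w: "w \<noteq> []" "last w = Lb" by (auto split: if_splits)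
  then have "count_list w Lb \<noteq> 0" by (metis count_list_0_iff last_in_set)
  then have i: "i < r" using 2 by simp
  have l0: "lookup (cyc_expo r i (La # w)) (r - i) = Suc (lookup (cyc_expo r i w) (r - i))"
    using i by (simp add: lookup_add lookup_single zidx_def)
  have "lookup (cyc_expo r i (La # w)) (r - j) = lookup (cyc_expo r i w) (r - j)"
    if "j \<in> set [Suc i..<r]" for j
  proof -
    have "r - i \<noteq> r - j" using i that by auto
    then show ?thesis using i by (simp add: lookup_add lookup_single zidx_def)
  qed
  then have "map (\<lambda>j. replicate (lookup (cyc_expo r i (La # w)) (r - j)) La @ [Lb]) [Suc i..<r] =
    map (\<lambda>j. replicate (lookup (cyc_expo r i w) (r - j)) La @ [Lb]) [Suc i..<r]"
    by (intro map_cong refl) (simp only:)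
  then have "word_of_expo r i (cyc_expo r i (La # w)) = La # word_of_expo r i (cyc_expo r i w)"
    unfolding word_of_expo_def upt_conv_Cons[OF i] by (simp only: list.map concat.simps l0 replicate_Suc append_Cons)
  then show ?case using 2 w by simp
next
  case (3 r i w)
  then have i: "i < r" by simp
  have w: "w = [] \<or> last w = Lb" using 3 by (auto split: if_splits)
  have "lookup (cyc_expo r (Suc i) w) (r - i) = 0"
    using cyc_expo_bound[OF w, of "Suc i" r "r - i"] 3 i by fastforce
  then have "word_of_expo r i (cyc_expo r i (Lb # w)) = Lb # word_of_expo r (Suc i) (cyc_expo r (Suc i) w)"
    unfolding word_of_expo_def using i by (simp add: upt_conv_Cons)
  then show ?case using 3 w by simp
qed

lemma cyc_expo_snoc_La:
  "cyc_expo r i (w @ [La]) = single (zidx r (i + count_list w Lb)) 1 + cyc_expo r i w"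
  by (induction r i w rule: cyc_expo.induct) (simp_all add: ac_simps)

lemma cyc_expo_snoc_Lb: "cyc_expo r i (w @ [Lb]) = cyc_expo r i w"
  by (induction r i w rule: cyc_expo.induct) simp_all

text \<open>Starting the cycle at i amounts to rotating the word past letters b, which does not
  change its cyclic class; so the starting point is immaterial.\<close>

lemma abs_word_of_cyc_expo:
  assumes "count_list w Lb = r" "r \<ge> 1"
  shows "abs_cyclic_word (word_of_expo r 0 (cyc_expo r i w)) = abs_cyclic_word w"
proof -
  let ?Q = "\<lambda>w i. abs_cyclic_word (word_of_expo r 0 (cyc_expo r i w)) = abs_cyclic_word w"
  have rot: "abs_cyclic_word (w @ [l]) = abs_cyclic_word (l # w)" for w and l :: letter
    using abs_cyclic_append[of w "[l]"] by simp
  \<comment> \<open>After r letters b the index is back at its start, so final letters a may be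
    moved to the front.\<close>
  have mv: "?Q (w @ replicate k La) i \<longleftrightarrow> ?Q (replicate k La @ w) i" if "count_list w Lb = r" for w k i
  proof -
    have "cyc_expo r i (w @ replicate k La) = cyc_expo r i (replicate k La @ w)"
    proof (induction k)
      case (Suc k)
      have "w @ replicate (Suc k) La = (w @ replicate k La) @ [La]"
        by (simp add: replicate_append_same)
      moreover have "count_list (w @ replicate k La) Lb = r"
        using that by (simp add: count_list_0_iff)
      ultimately show ?case by (simp only: cyc_expo_snoc_La Suc replicate_Suc append_Cons cyc_expo.simps zidx_period)
    qed simp
    then show ?thesis using abs_cyclic_append[of w "replicate k La"] by simp
  qed
  have decomp: "\<exists>v k. w = v @ Lb # replicate k La" if "count_list w Lb \<noteq> 0" for w
    using that
  proof (induction w rule: rev_induct)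
    case (snoc l w)
    show ?case
    proof (cases l)
      case La
      then obtain v k where "w = v @ Lb # replicate k La" using snoc by auto
      then show ?thesis by (intro exI[of _ v] exI[of _ "Suc k"]) (simp add: La replicate_append_same)
    next
      case Lb
      then show ?thesis by (intro exI[of _ w] exI[of _ 0]) simp
    qed
  qed simp
  have "\<forall>w. count_list w Lb = r \<longrightarrow> ?Q w i"
  proof (induction i)
    case 0
    show ?case
    proof (intro allI impI)
      fix w assume w: "count_list w Lb = r"
      then obtain v k where v: "w = (v @ [Lb]) @ replicate k La" using decomp[of w] assms(2) by auto
      then have c: "count_list (v @ [Lb]) Lb = r" using w by (simp add: count_list_0_iff)
      then have "count_list (replicate k La @ v @ [Lb]) Lb + 0 = r" by (simp add: count_list_0_iff)
      then have "?Q (replicate k La @ v @ [Lb]) 0" by (subst word_of_cyc_expo) auto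
      then show "?Q w 0" unfolding v mv[OF c] .
    qed
  next
    case (Suc i)
    show ?case
    proof (intro allI impI)
      fix w assume w: "count_list w Lb = r"
      then obtain v k where v: "w = (v @ [Lb]) @ replicate k La" using decomp[of w] assms(2) by auto
      then have c: "count_list (v @ [Lb]) Lb = r" using w by (simp add: count_list_0_iff)
      let ?v = "replicate k La @ v"
      have "count_list (Lb # ?v) Lb = r" using c by (simp add: count_list_0_iff)
      then have "?Q (Lb # ?v) i" using Suc by blast
      \<comment> \<open>A leading b only advances the starting index, and a final b changes
        nothing.\<close>
      then have "?Q (?v @ [Lb]) (Suc i)" by (simp only: cyc_expo.simps cyc_expo_snoc_Lb rot)
      then show "?Q w (Suc i)" unfolding v mv[OF c] by simp
    qed
  qed
  then show ?thesis using assms by blast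
qed

text \<open>\<open>z\<^sup>e \<mapsto> [a\<^bsup>e\<^sub>0\<^esup> b \<dots> a\<^bsup>e\<^sub>r\<^sub>-\<^sub>1\<^esup> b]\<close> recovers \<open>r\<close> times the trace from the cyclic sum.\<close>

lemma tr_dpart_zero:
  assumes r: "r \<ge> 1" and z: "cyc_val r x = 0"
  shows "tr (dpart r x) = 0"
proof -
  \<comment> \<open>\<open>t i\<close> is the polynomial behind \<open>val\<close> at the i-th
    rotation, to which \<open>\<Theta>\<close> can be applied.\<close>
  define t where "t i = lin_ext (\<lambda>w c. single (cyc_expo r i w) c)" for i
  define \<Theta> where "\<Theta> = lin_ext (\<lambda>m c. single (abs_cyclic_word (word_of_expo r 0 m)) c)"
  have at: "additive (t i)" for i unfolding t_def by (rule lin_ext_additive) (rule additive_single)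
  have a\<Theta>: "additive \<Theta>" unfolding \<Theta>_def by (rule lin_ext_additive) (rule additive_single)
  have "frp (t i y) = val (\<lambda>j. zeta r (i + j)) y" for i y
    by (rule additive_eqI[OF additive_comp[OF additive_frp at] additive_val])
      (simp add: t_def lin_ext_single additive_single val_single word_val_zeta mult_single
        flip: frp_Cst frp_mult)
  then have "frp (\<Sum>i<r. t i (dpart r x)) = 0"
    using z by (simp add: cyc_val_def frp_sum)
  then have "\<Theta> (\<Sum>i<r. t i (dpart r x)) = 0"
    using additive.zero[OF a\<Theta>] by simp
  moreover have "\<Theta> (\<Sum>i<r. t i y) = qscale (of_nat r) (tr y)" if "depth r y" for y
  proof (rule additive_eqI[of "\<lambda>y. \<Theta> (\<Sum>i<r. t i y)" "\<lambda>y. qscale (of_nat r) (tr y)"])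
    fix w c assume "w \<in> keys y"
    then have w: "count_list w Lb = r" using that by (simp add: graded_def)
    have "\<Theta> (\<Sum>i<r. t i (single w c)) =
        (\<Sum>i<r. single (abs_cyclic_word (word_of_expo r 0 (cyc_expo r i w))) c)"
      unfolding additive.sum[OF a\<Theta>] by (simp add: t_def \<Theta>_def lin_ext_single additive_single)
    \<comment> \<open>All r rotations give the same cyclic word, whence the factor r, which is
      divided out at the end.\<close>
    also have "\<dots> = qscale (of_nat r) (single (abs_cyclic_word w) c)"
      unfolding abs_word_of_cyc_expo[OF w r] sum_const_qscale card_lessThan ..
    finally show "\<Theta> (\<Sum>i<r. t i (single w c)) = qscale (of_nat r) (tr (single w c))"
      by (simp add: tr_single)
  qed (auto simp: additive_def additive.add[OF a\<Theta>] additive.add[OF at] sum.distrib tr_add qscale_add)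
  ultimately have "qscale (of_nat r) (tr (dpart r x)) = 0" using graded_gpart by metis
  then have "qscale (1 / of_nat r) (qscale (of_nat r) (tr (dpart r x))) = 0" by simp
  then show ?thesis using r by simp
qed

section \<open>The divergence of a push-invariant mould\<close>

lemma lookup_rcoef: "lookup (rcoef l x) w = lookup x (w @ [l])"
proof (rule additive_eqI[OF additive_comp[OF lookup_additive additive_rcoef] lookup_additive])
  fix v and c :: rat
  show "lookup (rcoef l (single v c)) w =
      lookup (single v c) (w @ [l])"
    by (cases v rule: rev_cases) (auto simp: rcoef_single lookup_single when_def)
qed

lemma depth_rcoef_La: "depth k x \<Longrightarrow> depth k (rcoef La x)"
  unfolding graded_def
proof
  fix w assume "\<forall>w\<in>keys x. count_list w Lb = k" "w \<in> keys (rcoef La x)"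
  moreover from this have "w @ [La] \<in> keys x" by (simp add: in_keys_iff lookup_rcoef)
  ultimately have "count_list (w @ [La]) Lb = k" by blast
  then show "count_list w Lb = k" by simp
qed

lemma depth_rcoef_Lb: "depth (Suc k) x \<Longrightarrow> depth k (rcoef Lb x)"
  unfolding graded_def
proof
  fix w assume "\<forall>w\<in>keys x. count_list w Lb = Suc k" "w \<in> keys (rcoef Lb x)"
  moreover from this have "w @ [Lb] \<in> keys x" by (simp add: in_keys_iff lookup_rcoef)
  ultimately have "count_list (w @ [Lb]) Lb = Suc k" by blast
  then show "count_list w Lb = k" by simp
qed

lemma depth_noconst: "depth k x \<Longrightarrow> k \<ge> 1 \<Longrightarrow> lookup x [] = 0"
  unfolding graded_def by (metis count_list.simps(1) in_keys_iff not_one_le_zero)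

text \<open>Removing a final b lowers depth by one, so f in depth r is paired with g in depth r +
  1.\<close>

lemma dpart_div_rep: "dpart r (div_rep f g) = div_rep (dpart r f) (dpart (Suc r) g)"
  by (rule poly_mapping_eqI) (simp add: div_rep_def gpart_def lookup_add lookup_rcoef lookup_restr)

abbreviation wpart :: "nat \<Rightarrow> freealg \<Rightarrow> freealg" where
  "wpart \<equiv> gpart length"

lemma wpart_div_rep: "wpart n (div_rep f g) = div_rep (wpart (Suc n) f) (wpart (Suc n) g)"
  by (rule poly_mapping_eqI) (simp add: div_rep_def gpart_def lookup_add lookup_rcoef lookup_restr)

lemma wpart_Psi:
  assumes "mvars p \<subseteq> {1..r}"
  shows "wpart (d + r) (Psi r p) = Psi r (hom_part d p)"
proof (rule additive_eqI[OF additive_comp[OF additive_gpart additive_Psi] additive_comp[OF additive_Psi additive_hom_part]])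
  fix m c assume m: "m \<in> keys p"
  then have "mvars (single m c) \<subseteq> {1..r}"
    using assms by (auto simp: mvars_def split: if_splits)
  then have "weight (mdeg m + r) (Psi r (single m c))"
    by (intro weight_Psi) (simp add: graded_def)
  then show "wpart (d + r) (Psi r (single m c)) = Psi r (hom_part d (single m c))"
    by (auto simp: gpart_graded hom_part_single Psi_zero)
qed

lemma tr_wpart:
  assumes "tr x = 0"
  shows "tr (wpart n x) = 0"
proof (rule rotation_invariant_tr_zero[OF additive_comp[OF additive_tr additive_gpart] _ assms])
  fix l :: letter and w and c :: rat
  show "tr (wpart n (single (w @ [l]) c)) = tr (wpart n (single (l # w) c))"
    using abs_cyclic_append[of w "[l]"] by (simp add: gpart_def restr_single tr_single)
qed

text \<open>The value of f at (0, s_0, ..., s_{r-1}), as the u_i are differences of neighbours.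
  Along \<open>zeta r\<close> it is also what \<open>swap\<close> makes of the mould.\<close>

definition nval :: "mpoly \<Rightarrow> (nat \<Rightarrow> ratfun) \<Rightarrow> ratfun" where
  "nval p s = poly_eval (\<lambda>i. if i = 1 then s 0 else s (i - 1) - s (i - 2)) p"

lemma sum_differences:
  "r \<ge> 1 \<Longrightarrow> (\<Sum>i=1..r. if i = 1 then s 0 else s (i - 1) - s (i - 2 :: nat)) = (s (r - 1) :: 'c::ab_group_add)"
proof (induction r rule: nat_induct_at_least)
  case (Suc r)
  then show ?case by (cases r) auto
qed simp

text \<open>Putting s_r = 0 kills f_a a, so f_b has the value f(s_0, ..., s_{r-1}, 0).
  Push-invariance then rotates the 0 from the last place to the first.\<close>

lemma val_rcoef_Lb_Psi:
  assumes p: "mvars p \<subseteq> {1..r}" and r: "r \<ge> 1" and push: "push_inv r p"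
  shows "val s (rcoef Lb (Psi r p)) = nval p s"
proof -
  let ?f = "Psi r p"
  define s' where "s' = s(r := 0)"
  let ?u = "\<lambda>i. if i = 1 then s 0 else s (i - 1) - s (i - 2)"
  have "lookup ?f [] = 0"
    by (rule depth_noconst[OF depth_Psi r])
  then have "?f = rcoef La ?f * gen_a + rcoef Lb ?f * gen_b"
    using rcoef_decomp[of ?f] by simp
  then have "val s' ?f = val s' (rcoef La ?f * gen_a) + val s' (rcoef Lb ?f * gen_b)"
    by (metis val_add)
  also have dLb: "depth (r - 1) (rcoef Lb ?f)"
    using depth_rcoef_Lb[of "r - 1" ?f] depth_Psi[of r p] r by simp
  have "val s' (rcoef La ?f * gen_a) + val s' (rcoef Lb ?f * gen_b) = val s' (rcoef Lb ?f)"
    by (simp add: val_mult[OF depth_rcoef_La[OF depth_Psi]] val_mult[OF dLb] val_gen) (simp add: s'_def)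
  also have "\<dots> = val s (rcoef Lb ?f)"
    by (rule val_cong[OF dLb]) (use r in \<open>auto simp: s'_def\<close>)
  finally have 1: "val s (rcoef Lb ?f) = poly_eval (\<lambda>i. s' i - s' (i - 1)) p"
    by (simp add: val_Psi[OF p])
  have "nval p s = poly_eval ?u (sub (push_subst r) p)"
    using push by (simp add: nval_def push_inv_def)
  also have "\<dots> = poly_eval (\<lambda>i. s' i - s' (i - 1)) p"
    unfolding poly_eval_sub
  proof (rule poly_eval_cong)
    fix i assume "i \<in> mvars p"
    then have i: "1 \<le> i" "i \<le> r" using p by auto
    show "poly_eval ?u (push_subst r i) = s' i - s' (i - 1)"
    proof (cases "i < r")
      case True
      then show ?thesis using i by (cases i) (simp_all add: push_subst_def poly_eval_simps s'_def)
    next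
      case False
      then have "i = r" using i by simp
      have "poly_eval ?u (Xsum r) = s (r - 1)"
        using sum_differences[OF r, of s] by (simp add: Xsum_def poly_eval_simps)
      moreover have "r - 1 \<noteq> r" using r by simp
      ultimately show ?thesis using \<open>i = r\<close> by (simp add: push_subst_def poly_eval_simps s'_def)
    qed
  qed
  finally show ?thesis using 1 by simp
qed

text \<open>Right coefficients of [a,g] = [b,f] give a g_b = b f_b - f, while f = f_a a + f_b b with
  s_r = s_0 gives s_0 f_a = f - f_b in values. In the sum f cancels; what remains is f_b read one
  step later minus f_b read at s.\<close>

lemma val_div_rep:
  assumes p: "mvars p \<subseteq> {1..r}" and r: "r \<ge> 1" and push: "push_inv r p"
    and g: "comm gen_a g = comm gen_b (Psi r p)" "lookup g [] = 0"
    and s: "s r = s 0"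
  shows "s 0 * val s (div_rep (Psi r p) g) = nval p (\<lambda>i. s (Suc i)) - nval p s"
proof -
  let ?f = "Psi r p"
  have f0: "lookup ?f [] = 0"
    by (rule depth_noconst[OF depth_Psi r])
  have "rcoef Lb (gen_a * g - g * gen_a) = rcoef Lb (gen_b * ?f - ?f * gen_b)"
    using g(1) by (simp add: comm_def)
  then have "gen_a * rcoef Lb g = gen_b * rcoef Lb ?f - ?f"
    by (simp add: rcoef_diff rcoef_mult g(2) f0)
  then have "val s (gen_a * rcoef Lb g) = val s (gen_b * rcoef Lb ?f - ?f)" by simp
  then have 1: "s 0 * val s (rcoef Lb g) = nval p (\<lambda>i. s (Suc i)) - val s ?f"
    by (simp add: val_diff val_mult[OF depth_gen(1)] val_mult[OF depth_gen(2)] val_gen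
        val_rcoef_Lb_Psi[OF p r push])
  have "?f = rcoef La ?f * gen_a + rcoef Lb ?f * gen_b"
    using rcoef_decomp[of ?f] f0 by simp
  then have "val s ?f = val s (rcoef La ?f * gen_a) + val s (rcoef Lb ?f * gen_b)"
    by (metis val_add)
  moreover have dLb: "depth (r - 1) (rcoef Lb ?f)"
    using depth_rcoef_Lb[of "r - 1" ?f] depth_Psi[of r p] r by simp
  ultimately have "s 0 * val s (rcoef La ?f) = val s ?f - nval p s"
    by (simp add: val_mult[OF depth_rcoef_La[OF depth_Psi]] val_mult[OF dLb] val_gen s
        val_rcoef_Lb_Psi[OF p r push] mult.commute)
  with 1 show ?thesis by (simp add: div_rep_def val_add distrib_left)
qed

lemma uvar_nonzero [simp]: "uvar i \<noteq> 0"
proof -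
  have "Xv i \<noteq> 0" by (simp add: Xv_def) (metis lookup_single_eq lookup_zero zero_neq_one)
  then show ?thesis by (simp flip: frp_Xv)
qed

lemma uvar_eq_iff [simp]: "uvar i = uvar j \<longleftrightarrow> i = j"
proof
  assume "uvar i = uvar j"
  then have "Xv i = Xv j" by (simp flip: frp_Xv)
  then have "mvars (Xv i) = mvars (Xv j)" by simp
  then show "i = j" by simp
qed simp

text \<open>Summation by parts around the cycle, applied to the quotients from
  \<open>val_div_rep\<close>.\<close>

lemma cyc_val_div_rep:
  assumes p: "mvars p \<subseteq> {1..r}" and r: "r \<ge> 1" and push: "push_inv r p"
    and g: "comm gen_a g = comm gen_b (Psi r p)" "depth (Suc r) g"
  shows "cyc_val r (div_rep (Psi r p) g) =
    (\<Sum>i<r. nval p (\<lambda>j. zeta r (i + j)) * (1 / zeta r (i + (r - 1)) - 1 / zeta r i))"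
proof -
  have g0: "lookup g [] = 0"
    by (rule depth_noconst[OF g(2)]) simp
  have d: "dpart r (div_rep (Psi r p) g) = div_rep (Psi r p) g"
    by (simp add: dpart_div_rep gpart_idem depth_Psi g(2))
  let ?N = "\<lambda>i. nval p (\<lambda>j. zeta r (i + j))"
  have "val (\<lambda>j. zeta r (i + j)) (div_rep (Psi r p) g) = (?N (Suc i) - ?N i) / zeta r i" for i
    using val_div_rep[OF p r push g(1) g0, of "\<lambda>j. zeta r (i + j)"] by (simp add: field_simps)
  then have "cyc_val r (div_rep (Psi r p) g) = (\<Sum>i<r. (?N (Suc i) - ?N i) / zeta r i)"
    by (simp add: cyc_val_def d)
  also have "\<dots> = (\<Sum>i<r. ?N (Suc i) / zeta r i) - (\<Sum>i<r. ?N i / zeta r i)"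
    by (simp add: diff_divide_distrib sum_subtractf)
  also have "(\<Sum>i<r. ?N (Suc i) / zeta r i) = (\<Sum>i<r. ?N (Suc i) / zeta r (Suc i + (r - 1)))"
    using r by simp
  also have "\<dots> = (\<Sum>i<r. ?N i / zeta r (i + (r - 1)))"
  proof (rule sum_periodic[of "\<lambda>i. ?N i / zeta r (i + (r - 1))"])
    have "zidx r (r + (r - 1)) = zidx r (0 + (r - 1))" using zidx_period(2)[of r "r - 1"] by simp
    then show "?N r / zeta r (r + (r - 1)) = ?N 0 / zeta r (0 + (r - 1))" by simp
  qed
  finally show ?thesis by (simp add: right_diff_distrib sum_subtractf)
qed

section \<open>Cyclic permutation of the swapped mould\<close>

text \<open>The factor of \<Delta> after \<open>swap\<close>: the sum of the u_i telescopes to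
  s_{r-1}, u_1 is s_0, and the other u_i are differences.\<close>

definition swap_den :: "nat \<Rightarrow> (nat \<Rightarrow> ratfun) \<Rightarrow> ratfun" where
  "swap_den r s = s (r - 1) * s 0 * (\<Prod>j=1..<r. s j - s (j - 1))"

lemma frp_divide: "q \<noteq> 0 \<Longrightarrow> frp p / frp q = Fract p q"
  by (simp add: frp_def)

lemma zidx_less: "j < r \<Longrightarrow> zidx r j = r - j"
  by (simp add: zidx_def)

lemma zidx_Suc_neq: "r \<ge> 2 \<Longrightarrow> zidx r (Suc j) \<noteq> zidx r j"
proof -
  assume r: "r \<ge> 2"
  then have "j mod r < r" "Suc j mod r < r" by auto
  moreover have "Suc j mod r \<noteq> j mod r"
    using r by (simp add: mod_Suc)
  ultimately show ?thesis unfolding zidx_def by linarith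
qed

lemma swap_den_zeta_nonzero: "r \<ge> 1 \<Longrightarrow> swap_den r (\<lambda>j. zeta r (i + j)) \<noteq> 0"
proof -
  have "zidx r (i + j) \<noteq> zidx r (i + (j - 1))" if "j \<in> {1..<r}" for j
    using zidx_Suc_neq[of r "i + (j - 1)"] that by auto
  then show "r \<ge> 1 \<Longrightarrow> swap_den r (\<lambda>j. zeta r (i + j)) \<noteq> 0"
    by (auto simp: swap_den_def)
qed

lemma swap_Delta_inv:
  assumes p: "mvars p \<subseteq> {1..r}" and r: "r \<ge> 1" and F: "F r = frp p"
  shows "swap (Delta_inv F) r = nval p (zeta r) / swap_den r (zeta r)"
proof -
  let ?D = "Xsum r * (\<Prod>i=1..r. Xv i)"
  let ?l = "uvar r # map (\<lambda>i. uvar (r - i) - uvar (r - i + 1)) [1..<r]"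
  let ?s = "\<lambda>i. if 1 \<le> i \<and> i \<le> length ?l then ?l ! (i - 1) else uvar i"
  let ?u = "\<lambda>i. if i = 1 then zeta r 0 else zeta r (i - 1) - zeta r (i - 2)"
  have su: "?s i = ?u i" if "i \<in> {1..r}" for i
  proof (cases "i = 1")
    case False
    define j where "j = i - 2"
    have j: "i = Suc (Suc j)" using that False by (auto simp: j_def)
    then have "j < length [1..<r]" "Suc j < r" using that by auto
    then show ?thesis using that unfolding j by (simp add: zidx_less)
  qed (use r in \<open>simp add: zidx_less\<close>)
  have l: "length ?l = r" using r by simp
  have "poly_eval ?s ?D = (\<Sum>i=1..r. ?s i) * (\<Prod>i=1..r. ?s i)"
    by (simp only: Xsum_def poly_eval_simps)
  also have "\<dots> = (\<Sum>i=1..r. ?u i) * (\<Prod>i=1..r. ?u i)"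
    by (intro arg_cong2[where f="(*)"] sum.cong prod.cong refl su)
  also have "(\<Sum>i=1..r. ?u i) = zeta r (r - 1)"
    by (rule sum_differences[OF r])
  also have "(\<Prod>i=1..r. ?u i) = zeta r 0 * (\<Prod>j=1..<r. zeta r j - zeta r (j - 1))"
  proof -
    have "(\<Prod>i=1..r. ?u i) = ?u 1 * (\<Prod>i=Suc 1..r. ?u i)"
      using r by (simp only: prod.atLeast_Suc_atMost)
    also have "(\<Prod>i=Suc 1..r. ?u i) = (\<Prod>j=1..<r. zeta r j - zeta r (j - 1))"
      by (rule prod.reindex_bij_witness[of _ Suc "\<lambda>i. i - 1"]) (auto simp: numeral_2_eq_2)
    finally show ?thesis by simp
  qed
  finally have D: "poly_eval ?s ?D = swap_den r (zeta r)"
    by (simp add: swap_den_def)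
  \<comment> \<open>The denominator survives the substitution, so the latter may be computed on this
    fraction.\<close>
  have nz: "poly_eval ?s ?D \<noteq> 0"
    unfolding D using swap_den_zeta_nonzero[OF r, of 0] by simp
  then have "?D \<noteq> 0" by (metis poly_eval_simps(5))
  have "Delta_inv F r = frp p / frp ?D"
    by (simp add: Delta_inv_def F Xsum_def frp_simps)
  also have "\<dots> = Fract p ?D" using \<open>?D \<noteq> 0\<close> by (rule frp_divide)
  finally have "mapply (Delta_inv F) ?l = rf_eval ?s (Fract p ?D)"
    using l by (simp only: mapply_def)
  also have "\<dots> = poly_eval ?s p / poly_eval ?s ?D" by (rule rf_eval_Fract[OF nz])
  also have "poly_eval ?s p = nval p (zeta r)"
    unfolding nval_def
  proof (rule poly_eval_cong)
    fix i assume "i \<in> mvars p"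
    then have "i \<in> {1..r}" using p by blast
    then show "?s i = ?u i" by (rule su)
  qed
  finally show ?thesis using r D by (simp add: swap_def)
qed

definition circ_subst :: "nat \<Rightarrow> nat \<Rightarrow> nat" where
  "circ_subst r i = (if i = 1 then r else if 1 \<le> i \<and> i \<le> r then i - 1 else i)"

lemma good_circ: "r \<ge> 1 \<Longrightarrow> good_subst (\<lambda>i. uvar (circ_subst r i))"
  by (rule good_substI[where s'="\<lambda>i. Xv (circ_subst r i)"
        and t="\<lambda>i. Xv (if i = r then 1 else if 1 \<le> i \<and> i < r then Suc i else i)"])
    (auto simp: frp_Xv sub_simps circ_subst_def)

lemma circ_conv:
  assumes r: "r \<ge> 1"
  shows "circ A r = rf_eval (\<lambda>i. uvar (circ_subst r i)) (A r)"
proof -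
  let ?l = "uvar r # map uvar [1..<r]"
  have "(\<lambda>i. if 1 \<le> i \<and> i \<le> length ?l then ?l ! (i - 1) else uvar i) = (\<lambda>i. uvar (circ_subst r i))"
  proof
    fix i
    show "(if 1 \<le> i \<and> i \<le> length ?l then ?l ! (i - 1) else uvar i) = uvar (circ_subst r i)"
      using r by (cases i) (auto simp: circ_subst_def nth_Cons split: nat.splits)
  qed
  moreover have "length ?l = r" using r by simp
  ultimately have "mapply A ?l = rf_eval (\<lambda>i. uvar (circ_subst r i)) (A r)"
    by (simp only: mapply_def)
  then show ?thesis using r by (simp add: circ_def)
qed

text \<open>Along the cyclic sequence \<open>circ\<close> is the step from j to j + 1, so its powers
  are rotations of one formula.\<close>

lemma circ_subst_zidx: "r \<ge> 1 \<Longrightarrow> circ_subst r (zidx r j) = zidx r (Suc j)"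
proof -
  assume r: "r \<ge> 1"
  then have "j mod r < r" by simp
  then show ?thesis using r by (auto simp: circ_subst_def zidx_def mod_Suc)
qed

lemma circ_power:
  assumes p: "mvars p \<subseteq> {1..r}" and r: "r \<ge> 1" and F: "F r = frp p"
  shows "(circ ^^ i) (swap (Delta_inv F)) r =
    nval p (\<lambda>j. zeta r (i + j)) / swap_den r (\<lambda>j. zeta r (i + j))"
proof (induction i)
  case 0
  then show ?case by (simp add: swap_Delta_inv[where F=F and p=p and r=r, OF assms])
next
  case (Suc i)
  note g = good_circ[OF r]
  have z: "rf_eval (\<lambda>i. uvar (circ_subst r i)) (zeta r j) = zeta r (Suc j)" for j
    by (simp add: rf_eval_uvar[OF g] circ_subst_zidx[OF r])
  have d: "rf_eval (\<lambda>i. uvar (circ_subst r i)) (zeta r j - zeta r k) = zeta r (Suc j) - zeta r (Suc k)" for j k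
    by (simp add: additive.diff[OF additive_rf_eval[OF g]] z)
  show ?case
    by (simp add: circ_conv[OF r] Suc nval_def swap_den_def rf_eval_divide[OF g] rf_eval_poly_eval[OF g]
        rf_eval_mult[OF g] rf_eval_prod[OF g] z d if_distrib cong: if_cong)
qed

definition cyc_prod :: "nat \<Rightarrow> ratfun" where
  "cyc_prod r = (\<Prod>j<r. zeta r (Suc j) - zeta r j)"

lemma cyc_prod_shift: "(\<Prod>j<r. zeta r (Suc (i + j)) - zeta r (i + j)) = cyc_prod r"
proof (induction i)
  case (Suc i)
  let ?h = "\<lambda>j. zeta r (Suc (i + j)) - zeta r (i + j)"
  have "?h 0 * (\<Prod>j<r. ?h (Suc j)) = (\<Prod>j<r. ?h j) * ?h r"
    using prod.lessThan_Suc_shift[of ?h r] prod.lessThan_Suc[of ?h r] by simp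
  moreover have "?h r = ?h 0" using zidx_period(1)[of r "Suc i"] by simp
  ultimately show ?case
  \<comment> \<open>The common factor can be cancelled unless it is 0; this happens only for r at
    most 1, where both products are computed directly.\<close>
  proof (cases "?h 0 = 0")
    case True
    then have "zidx r (Suc i) = zidx r i" by simp
    then have "\<not> r \<ge> 2" using zidx_Suc_neq by blast
    then have "r = 0 \<or> r = 1" by auto
    then show ?thesis by (auto simp: cyc_prod_def zidx_def)
  qed (use Suc in \<open>simp add: mult.commute\<close>)
qed (simp add: cyc_prod_def)

lemma cyc_prod_nonzero: "r \<ge> 2 \<Longrightarrow> cyc_prod r \<noteq> 0"
  by (simp add: cyc_prod_def zidx_Suc_neq)

abbreviation circ_sum :: "mould \<Rightarrow> nat \<Rightarrow> ratfun" where
  "circ_sum F r \<equiv> \<Sum>i<r. (circ ^^ i) (swap (Delta_inv F)) r"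

text \<open>\<open>swap_den\<close> contains every factor of the cyclic product but the one closing
  the cycle. Together with the two end values that factor leaves (z_i - z_{i+r-1}) / (z_{i+r-1}
  z_i), the difference of reciprocals in \<open>cyc_val_div_rep\<close>.\<close>

lemma circ_sum_cyc_prod:
  assumes p: "mvars p \<subseteq> {1..r}" and r: "r \<ge> 2" and push: "push_inv r p" and F: "F r = frp p"
    and g: "comm gen_a g = comm gen_b (Psi r p)" "depth (Suc r) g"
  shows "circ_sum F r * cyc_prod r = cyc_val r (div_rep (Psi r p) g)"
proof -
  have r1: "r \<ge> 1" using r by simp
  have "(circ ^^ i) (swap (Delta_inv F)) r * cyc_prod r =
     nval p (\<lambda>j. zeta r (i + j)) * (1 / zeta r (i + (r - 1)) - 1 / zeta r i)" for i
  proof -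
    let ?P = "\<Prod>j=1..<r. zeta r (i + j) - zeta r (i + (j - 1))"
    obtain r' where r': "r = Suc r'" using r by (cases r) auto
    have "cyc_prod r = (\<Prod>j<r'. zeta r (Suc (i + j)) - zeta r (i + j)) * (zeta r (i + r) - zeta r (i + r'))"
      by (subst cyc_prod_shift[of r i, symmetric]) (simp add: r')
    also have "(\<Prod>j<r'. zeta r (Suc (i + j)) - zeta r (i + j)) = ?P"
      by (rule prod.reindex_bij_witness[of _ "\<lambda>i. i - 1" Suc]) (auto simp: r')
    finally have c: "cyc_prod r = ?P * (zeta r i - zeta r (i + (r - 1)))"
      using zidx_period(1)[of r i] by (simp add: r')
    have "?P \<noteq> 0" using swap_den_zeta_nonzero[OF r1, of i] by (simp add: swap_den_def)
    then show ?thesis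
      unfolding circ_power[where F=F, OF p r1 F] swap_den_def c
      by (simp add: field_simps)
  qed
  then show ?thesis
    by (simp add: cyc_val_div_rep[OF p r1 push g] sum_distrib_right)
qed

lemma gen_c_cgen: "gen_c = - cgen 1"
  using comm_gen_a_cgen[of 0] by (simp add: gen_c_def cgen_0)

lemma depth_gen_c_power: "depth k (gen_c ^ k)"
proof (induction k)
  case (Suc k)
  have "depth 1 gen_c" by (simp add: gen_c_cgen graded_uminus depth_cgen del: One_nat_def)
  then show ?case using depth_mult[of 1 gen_c k, OF _ Suc] by simp
qed (simp add: graded_one list_zero)

lemma weight_gen_c_power: "weight (2 * k) (gen_c ^ k)"
proof (induction k)
  case (Suc k)
  have "weight 2 gen_c" using graded_uminus[OF weight_cgen[of 1]] by (simp add: gen_c_cgen numeral_2_eq_2)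
  then show ?case using weight_mult[of 2 gen_c, OF _ Suc] by simp
qed (simp add: graded_one list_zero)

lemma val_gen_c_power: "val s (gen_c ^ k) = (-1) ^ k * (\<Prod>j<k. s (Suc j) - s j)"
proof (induction k arbitrary: s)
  case (Suc k)
  have d: "depth 1 gen_c" using depth_gen_c_power[of 1] by simp
  have "val s gen_c = - (s 1 - s 0)"
    by (simp only: gen_c_cgen additive.minus[OF additive_val] val_cgen) simp
  then show ?case
    by (simp add: val_mult[OF d] Suc prod.lessThan_Suc_shift del: prod.lessThan_Suc)
      (simp add: algebra_simps)
qed (simp add: val_one)

lemma rf_const_of_nat: "rf_const (of_nat n) = of_nat n"
  by (induction n) (simp_all add: rf_const_simps rf.h_add)

text \<open>Every rotation contributes the same cyclic product, which explains the factor r in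
  circ-constancy; the sign comes from c = - \<open>cgen 1\<close>.\<close>

lemma cyc_val_gen_c_power: "cyc_val r (gen_c ^ r) = rf_const ((-1) ^ r * of_nat r) * cyc_prod r"
proof -
  have "rf_const ((-1) ^ r) = (-1) ^ r"
    by (induction r) (simp_all add: rf.h_mult rf_const_simps)
  then show ?thesis
    by (simp add: cyc_val_def gpart_idem[OF depth_gen_c_power] val_gen_c_power cyc_prod_shift
        rf.h_mult rf_const_of_nat)
qed

text \<open>Multiplication by the nonzero cyclic product turns a constant into a multiple of the
  cyclic value of c^r. The two constants differ by (-1)^r.\<close>

lemma circ_constant_iff_trace:
  assumes p: "mvars p \<subseteq> {1..r}" and r: "r \<ge> 2" and push: "push_inv r p" and F: "F r = frp p"
    and g: "comm gen_a g = comm gen_b (Psi r p)" "depth (Suc r) g"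
  shows "(\<exists>K. circ_sum F r = rf_const (K * of_nat r)) \<longleftrightarrow>
    (\<exists>K. cyc_val r (div_rep (Psi r p) g - qscale K (gen_c ^ r)) = 0)"
proof -
  let ?C = "\<Sum>i<r. (circ ^^ i) (swap (Delta_inv F)) r"
  have sq: "K * (-1) ^ r * (-1) ^ r = K" for K :: rat
    by (simp add: mult.assoc flip: power_mult_distrib)
  have "cyc_val r (div_rep (Psi r p) g - qscale K (gen_c ^ r)) = 0 \<longleftrightarrow> ?C = rf_const (K * (-1) ^ r * of_nat r)" for K
    using cyc_prod_nonzero[OF r]
    by (simp add: cyc_val_diff cyc_val_qscale cyc_val_gen_c_power rf.h_mult mult.assoc
        flip: circ_sum_cyc_prod[where F=F, OF assms])
  then show ?thesis by (metis sq)
qed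

section \<open>Passage between moulds and derivations\<close>

section \<open>Polynomial families and \<open>krv_ell\<close>\<close>

definition mould_of :: "(nat \<Rightarrow> mpoly) \<Rightarrow> mould" where
  "mould_of p = (\<lambda>r. frp (p r))"

definition krv_family :: "(nat \<Rightarrow> mpoly) \<Rightarrow> bool" where
  "krv_family p \<longleftrightarrow> alternal_family p \<and> (\<forall>r\<ge>1. push_inv r (p r)) \<and>
     circ_constant (swap (Delta_inv (mould_of p))) \<and>
     (\<forall>r. \<forall>m\<in>keys (p r). mdeg m + r \<ge> 3)"

lemma krv_familyD:
  assumes "krv_family p"
  shows "alternal_family p" "poly_family p" "p 0 = 0" "alternal_poly r (p r)" "mvars (p r) \<subseteq> {1..r}"
    "r \<ge> 1 \<Longrightarrow> push_inv r (p r)"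
    "r \<ge> 2 \<Longrightarrow> \<exists>K. circ_sum (mould_of p) r = rf_const (K * of_nat r)"
    "m \<in> keys (p r) \<Longrightarrow> mdeg m + r \<ge> 3"
  using assms by (auto simp: krv_family_def alternal_family_def poly_family_def circ_constant_def)

lemma ex_key:
  assumes "p \<noteq> 0"
  shows "\<exists>m. m \<in> keys p"
proof (rule ccontr)
  assume "\<nexists>m. m \<in> keys p"
  then have "p = 0" by (intro poly_mapping_eqI) (simp add: in_keys_iff)
  then show False using assms by simp
qed

lemma poly_moulds_iff: "F \<in> poly_moulds \<longleftrightarrow> (\<exists>p. F = mould_of p \<and> poly_family p)"
proof
  assume F: "F \<in> poly_moulds"
  then have "\<forall>r. \<exists>p. F r = frp p \<and> mvars p \<subseteq> {1..r}" by (simp add: poly_moulds_def frp_def)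
  then obtain p where p: "\<And>r. F r = frp (p r)" "\<And>r. mvars (p r) \<subseteq> {1..r}" by metis
  then have "F = mould_of p" by (simp add: mould_of_def fun_eq_iff)
  moreover have "poly_family p"
    using F p by (simp add: poly_moulds_def poly_family_def)
  ultimately show "\<exists>p. F = mould_of p \<and> poly_family p" by blast
next
  assume "\<exists>p. F = mould_of p \<and> poly_family p"
  then show "F \<in> poly_moulds"
    by (auto simp: poly_moulds_def poly_family_def mould_of_def frp_def[symmetric] intro!: exI)
qed

lemma alternal_mould_of:
  "alternal (mould_of p) \<longleftrightarrow> p 0 = 0 \<and> (\<forall>r. alternal_poly r (p r))"
proof -
  have ev: "mapply (mould_of p) (map uvar w) =
      poly_eval (\<lambda>i. if 1 \<le> i \<and> i \<le> r then uvar (w ! (i - 1)) else uvar i) (p r)"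
    if "w \<in> shuffles [1..<k + 1] [k + 1..<r + 1]" "k \<in> {1..r - 1}" for w k r
  proof -
    have l: "length w = r" by (rule shuffle_intervals(3)[OF that])
    have "(\<lambda>i. if 1 \<le> i \<and> i \<le> length (map uvar w) then map uvar w ! (i - 1) else uvar i) =
      (\<lambda>i. if 1 \<le> i \<and> i \<le> r then uvar (w ! (i - 1)) else uvar i)"
      by (rule ext) (use l in auto)
    then show ?thesis using l by (simp only: mapply_def length_map mould_of_def rf_eval_frp)
  qed
  have "(\<forall>k\<in>{1..r - 1}. (\<Sum>w\<in>shuffles [1..<k + 1] [k + 1..<r + 1]. mapply (mould_of p) (map uvar w)) = 0)
      \<longleftrightarrow> alternal_poly r (p r)" for r
    unfolding alternal_poly_def by (intro ball_cong refl arg_cong2[where f="(=)"] sum.cong ev)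
  moreover have "alternal_poly r (p r)" if "\<not> r \<ge> 2" for r
    using that by (auto simp: alternal_poly_def)
  moreover have "mould_of p 0 = 0 \<longleftrightarrow> p 0 = 0" by (simp add: mould_of_def)
  ultimately show ?thesis unfolding alternal_def by blast
qed

lemma push_mould_of:
  assumes p: "poly_family p"
  shows "push_invariant (mould_of p) \<longleftrightarrow> (\<forall>r\<ge>1. push_inv r (p r))"
proof -
  have "push (mould_of p) r = mould_of p r \<longleftrightarrow> push_inv r (p r)" if r: "r \<ge> 1" for r
  proof -
    let ?l = "map uvar [2..<r + 1] @ [- (\<Sum>i = 1..r. uvar i)]"
    let ?s = "\<lambda>i. if 1 \<le> i \<and> i \<le> length ?l then ?l ! (i - 1) else uvar i"
    have l: "length ?l = r" using r by (simp del: upt_Suc)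
    have "poly_eval ?s (p r) = poly_eval (\<lambda>i. frp (push_subst r i)) (p r)"
    proof (rule poly_eval_cong)
      fix i assume "i \<in> mvars (p r)"
      then have "i \<in> {1..r}" using p unfolding poly_family_def by blast
      then have i: "1 \<le> i" "i \<le> r" by auto
      show "?s i = frp (push_subst r i)"
      proof (cases "i < r")
        case True
        then have "map uvar [2..<r + 1] ! (i - 1) = uvar (Suc i)"
          using i by (subst nth_map) (auto simp del: upt_Suc)
        then show ?thesis using True i l by (simp add: nth_append push_subst_def frp_Xv del: upt_Suc)
      next
        case False
        then have "i = r" using i by simp
        then have "?l ! (i - 1) = - (\<Sum>i = 1..r. uvar i)"
          using r by (subst nth_append) (simp del: upt_Suc)
        then show ?thesis using \<open>i = r\<close> r l by (simp add: push_subst_def Xsum_def frp_simps del: upt_Suc)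
      qed
    qed
    then have "push (mould_of p) r = frp (sub (push_subst r) (p r))"
      using r l by (simp only: push_def mapply_def mould_of_def rf_eval_frp poly_eval_frp) simp
    then show ?thesis by (simp add: mould_of_def push_inv_def)
  qed
  moreover have "push (mould_of p) 0 = mould_of p 0" by (simp add: push_def)
  ultimately show ?thesis
    unfolding push_invariant_def fun_eq_iff by (metis less_one linorder_not_less)
qed

lemma krv_ell_iff: "F \<in> krv_ell \<longleftrightarrow> (\<exists>p. F = mould_of p \<and> krv_family p)"
proof -
  have "mould_of p \<in> krv_ell \<longleftrightarrow> krv_family p" if p: "poly_family p" for p
  proof -
    have "mould_of p \<in> poly_moulds" using p poly_moulds_iff by blast
    moreover have "poly_of (mould_of p r) = p r" for r by (simp add: mould_of_def)
    ultimately show ?thesis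
      using p by (auto simp: krv_ell_def krv_family_def alternal_family_def alternal_mould_of push_mould_of)
  qed
  then show ?thesis
    using krv_familyD(2) poly_moulds_iff by (metis (no_types, lifting) krv_ell_def mem_Collect_eq)
qed

lemma cword_conv: "cword w = qscale ((-1) ^ sum_list w) (prod_list (map (\<lambda>x. c_gen (x + 1)) w))"
  by (induction w) (simp_all add: cgen_def qscale_mult_left qscale_mult_right power_add mult.commute)

lemma lie_of_mould_of:
  assumes "poly_family p"
  shows "lie_of_mould (mould_of p) = Psum p"
proof -
  have "qscale ((-1) ^ ((mdeg m + r) + r) * lookup (p r) m)
            (prod_list (map (\<lambda>i. c_gen (lookup m i + 1)) [1..<r + 1])) =
        qscale (lookup (p r) m) (cword (exlist r m))"
    if "m \<in> keys (p r)" for m r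
  proof -
    have "keys m \<subseteq> {1..r}"
      using that assms by (auto simp: poly_family_def mvars_def)
    moreover have "(-1) ^ ((mdeg m + r) + r) = (-1 :: rat) ^ mdeg m"
      by (simp add: power_add mult.assoc flip: power_mult_distrib)
    moreover have "map (\<lambda>i. c_gen (lookup m i + 1)) [1..<r + 1] = map (\<lambda>x. c_gen (x + 1)) (exlist r m)"
      by (simp add: exlist_def del: upt_Suc)
    ultimately show ?thesis
      by (simp only: cword_conv sum_list_exlist qscale_qscale mult.commute)
  qed
  then show ?thesis
    by (simp add: lie_of_mould_def Psum_def Psi_def lin_ext_def mould_of_def)
qed

text \<open>An expression linear in p, from which the closure of circ-constancy under sums and
  multiples is read off.\<close>

lemma circ_sum_mould_of:
  assumes "mvars (p r) \<subseteq> {1..r}" "r \<ge> 2"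
  shows "circ_sum (mould_of p) r = (\<Sum>i<r. nval (p r) (\<lambda>j. zeta r (i + j)) / swap_den r (\<lambda>j. zeta r (i + j)))"
  using assms by (subst circ_power[where p="p r"]) (simp_all add: mould_of_def)

lemma circ_constant_add:
  assumes "krv_family p" "krv_family q"
  shows "circ_constant (swap (Delta_inv (mould_of (\<lambda>r. p r + q r))))"
  unfolding circ_constant_def
proof (intro allI impI)
  fix r :: nat assume r: "r \<ge> 2"
  note pq = krv_familyD(5)[OF assms(1), of r] krv_familyD(5)[OF assms(2), of r]
  have mv: "mvars (p r + q r) \<subseteq> {1..r}" using mvars_add[of "p r" "q r"] pq by blast
  obtain K L where "circ_sum (mould_of p) r = rf_const (K * of_nat r)" "circ_sum (mould_of q) r = rf_const (L * of_nat r)"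
    using krv_familyD(7)[OF assms(1) r] krv_familyD(7)[OF assms(2) r] by blast
  then have "circ_sum (mould_of (\<lambda>r. p r + q r)) r = rf_const ((K + L) * of_nat r)"
    unfolding circ_sum_mould_of[of p, OF pq(1) r] circ_sum_mould_of[of q, OF pq(2) r]
      circ_sum_mould_of[of "\<lambda>r. p r + q r", OF mv r]
    by (simp add: nval_def poly_eval_simps add_divide_distrib sum.distrib distrib_right rf.h_add)
  then show "\<exists>K. circ_sum (mould_of (\<lambda>r. p r + q r)) r = rf_const (K * of_nat r)" ..
qed

lemma circ_constant_qscale:
  assumes "krv_family p"
  shows "circ_constant (swap (Delta_inv (mould_of (\<lambda>r. qscale c (p r)))))"
  unfolding circ_constant_def
proof (intro allI impI)
  fix r :: nat assume r: "r \<ge> 2"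
  note p = krv_familyD(5)[OF assms(1), of r]
  have mv: "mvars (qscale c (p r)) \<subseteq> {1..r}" using mvars_qscale[of c "p r"] p by blast
  obtain K where "circ_sum (mould_of p) r = rf_const (K * of_nat r)"
    using krv_familyD(7)[OF assms(1) r] by blast
  then have "circ_sum (mould_of (\<lambda>r. qscale c (p r))) r = rf_const ((c * K) * of_nat r)"
    unfolding circ_sum_mould_of[of p, OF p r] circ_sum_mould_of[of "\<lambda>r. qscale c (p r)", OF mv r]
    by (simp add: nval_def poly_eval_simps rf.h_mult mult.assoc flip: sum_distrib_left times_divide_eq_right)
  then show "\<exists>K. circ_sum (mould_of (\<lambda>r. qscale c (p r))) r = rf_const (K * of_nat r)" ..
qed

lemma push_inv_qscale: "push_inv r p \<Longrightarrow> push_inv r (qscale c p)"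
  by (simp add: push_inv_def cst.evl_qscale flip: qscale_conv_mult)

lemma krv_family_add:
  assumes "krv_family p" "krv_family q"
  shows "krv_family (\<lambda>r. p r + q r)"
proof -
  note pq = krv_familyD[OF assms(1)] krv_familyD[OF assms(2)]
  have "mdeg m + r \<ge> 3" if "m \<in> keys (p r + q r)" for m r
    using that Poly_Mapping.keys_add[of "p r" "q r"] pq(8,16) by blast
  then show ?thesis
    using pq circ_constant_add[OF assms]
    by (auto simp: krv_family_def alternal_family_def poly_family_add alternal_poly_add push_inv_def sub_simps)
qed

lemma krv_family_qscale:
  assumes "krv_family p"
  shows "krv_family (\<lambda>r. qscale c (p r))"
proof -
  note p = krv_familyD[OF assms(1)]
  have "mdeg m + r \<ge> 3" if "m \<in> keys (qscale c (p r))" for m r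
    using that keys_qscale[of c "p r"] p(8) by blast
  then show ?thesis
    using p circ_constant_qscale[OF assms]
    by (auto simp: krv_family_def alternal_family_def poly_family_qscale alternal_poly_qscale
        push_inv_qscale)
qed

lemma krv_family_zero: "krv_family (\<lambda>r. 0)"
proof -
  have mv: "mvars (0 :: mpoly) \<subseteq> {1..r}" for r by simp
  have "(circ ^^ i) (swap (Delta_inv (mould_of (\<lambda>r. 0)))) r = 0" if "r \<ge> 2" for i r
    using that by (subst circ_power[OF mv]) (simp_all add: mould_of_def nval_def poly_eval_simps)
  then have "circ_constant (swap (Delta_inv (mould_of (\<lambda>r. 0))))"
    by (auto simp: circ_constant_def intro!: exI[of _ 0] simp: rf_const_simps)
  then show ?thesis
    by (simp add: krv_family_def alternal_family_def poly_family_def alternal_poly_zero push_inv_def sub_simps)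
qed

section \<open>Bihomogeneous components\<close>

lemma wpart_comm_gen:
  assumes "weight 1 l"
  shows "wpart (Suc n) (comm l x) = comm l (wpart n x)"
proof (rule additive_eqI[of "\<lambda>x. wpart (Suc n) (comm l x)" "\<lambda>x. comm l (wpart n x)"])
  fix w and c :: rat
  have w: "weight (length w) (single w c)" by (simp add: graded_def)
  then have "weight (Suc (length w)) (comm l (single w c))"
    using weight_mult[OF assms w] weight_mult[OF w assms] by (simp add: comm_def graded_diff)
  then show "wpart (Suc n) (comm l (single w c)) = comm l (wpart n (single w c))"
    by (auto simp: gpart_graded[OF w] gpart_graded)
qed (auto simp: additive_def additive.add[OF additive_gpart] comm_add_right)

lemma depth_div_rep: "depth r f \<Longrightarrow> depth (Suc r) g \<Longrightarrow> depth r (div_rep f g)"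
  by (simp add: div_rep_def graded_add depth_rcoef_La depth_rcoef_Lb)

text \<open>The cyclic sum is first turned into a trace, which splits by weight. The divergence
  lowers weight by one and c^r has weight 2r, so the component of weight d + r meets c^r only if d +
  r = 2r + 1; otherwise its constant is 0.\<close>

lemma trace_hom_part:
  fixes d :: nat
  assumes p: "mvars p \<subseteq> {1..r}" and r: "r \<ge> 1" and g: "depth (Suc r) g"
    and cyc: "cyc_val r (div_rep (Psi r p) g - qscale K (gen_c ^ r)) = 0"
  defines "K' \<equiv> if d + r = Suc (2 * r) then K else 0"
  shows "tr (div_rep (Psi r (hom_part d p)) (wpart (d + r) g) - qscale K' (gen_c ^ r)) = 0"
proof -
  obtain n where n: "d + r = Suc n" using r by (cases r) auto
  let ?x = "div_rep (Psi r p) g - qscale K (gen_c ^ r)"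
  have "depth r ?x"
    by (intro graded_diff depth_div_rep depth_Psi g graded_qscale depth_gen_c_power)
  then have "tr ?x = 0" using tr_dpart_zero[OF r cyc] by (simp add: gpart_idem)
  then have "tr (wpart n ?x) = 0" by (rule tr_wpart)
  moreover have "wpart n (qscale K (gen_c ^ r)) = qscale K' (gen_c ^ r)"
    by (auto simp: K'_def n gpart_graded[OF graded_qscale[OF weight_gen_c_power]])
  ultimately show ?thesis
    by (simp add: additive.diff[OF additive_gpart] wpart_div_rep n[symmetric] wpart_Psi[OF p])
qed

text \<open>The quotient from \<open>push_inv_iff\<close> supplies the element g with [a,g] =
  [b,f].\<close>

lemma partner_comm:
  assumes "mvars p \<subseteq> {1..r}" "Xsum (Suc r) * q = p - shift p"
  shows "comm gen_a (Psi (Suc r) q) = comm gen_b (Psi r p)"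
  by (simp add: comm_gen_a_Psi comm_gen_b_Psi[OF assms(1)] assms(2) Psi_diff)

definition family_part :: "nat \<Rightarrow> nat \<Rightarrow> (nat \<Rightarrow> mpoly) \<Rightarrow> nat \<Rightarrow> mpoly" where
  "family_part r d p = (\<lambda>s. if s = r then hom_part d (p r) else 0)"

lemma mould_part_mould_of: "mould_part r d (mould_of p) = mould_of (family_part r d p)"
  by (auto simp: mould_part_def mould_of_def family_part_def frp_zero fun_eq_iff frp_def[symmetric])

text \<open>The rational functions in circ-constancy are not split by degree directly: the condition
  is translated into a trace, cut to one weight there, and translated back.\<close>

lemma krv_family_part:
  assumes "krv_family p"
  shows "krv_family (family_part r d p)"
proof -
  note p = krv_familyD[OF assms]
  have mv: "mvars (family_part r d p s) \<subseteq> {1..s}" for s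
    using mvars_hom_part[of d "p r"] p(5)[of r] by (auto simp: family_part_def)
  have "finite {s. family_part r d p s \<noteq> 0}"
    by (rule finite_subset[of _ "{r}"]) (auto simp: family_part_def)
  then have fam: "poly_family (family_part r d p)" using mv by (simp add: poly_family_def)
  have alt: "alternal_poly s (family_part r d p s)" for s
    using alternal_poly_hom_part[OF p(4)] by (simp add: family_part_def alternal_poly_zero)
  have push: "push_inv s (family_part r d p s)" if "s \<ge> 1" for s
    using that push_inv_hom_part[OF p(6)] by (auto simp: family_part_def push_inv_def sub_simps)
  have z: "family_part r d p 0 = 0"
    using p(3) by (auto simp: family_part_def additive.zero[OF additive_hom_part])
  have deg: "mdeg m + s \<ge> 3" if "m \<in> keys (family_part r d p s)" for m s
    using that p(8) by (auto simp: family_part_def hom_part_eq_gpart gpart_def keys_restr split: if_splits)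
  have "\<exists>K. circ_sum (mould_of (family_part r d p)) s = rf_const (K * of_nat s)"
    if s: "s \<ge> 2" for s
  proof (cases "s = r")
    case True
    with s have r: "r \<ge> 2" "r \<ge> 1" by auto
    obtain q where q: "Xsum (Suc r) * q = p r - shift (p r)"
      using push_inv_iff[OF p(5)] p(6)[OF r(2)] by blast
    let ?g = "Psi (Suc r) q"
    have g: "comm gen_a ?g = comm gen_b (Psi r (p r))" "depth (Suc r) ?g"
      by (rule partner_comm[OF p(5) q]) (rule depth_Psi)
    have "mould_of p r = frp (p r)" by (simp add: mould_of_def)
    then obtain K where "cyc_val r (div_rep (Psi r (p r)) ?g - qscale K (gen_c ^ r)) = 0"
      using circ_constant_iff_trace[OF p(5) r(1) p(6)[OF r(2)] _ g] p(7)[OF r(1)] by blast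
    from trace_hom_part[OF p(5) r(2) g(2) this, of d] obtain K' where
      "tr (div_rep (Psi r (hom_part d (p r))) (wpart (d + r) ?g) - qscale K' (gen_c ^ r)) = 0" by blast
    then have "\<exists>K. cyc_val r (div_rep (Psi r (hom_part d (p r))) (wpart (d + r) ?g) - qscale K (gen_c ^ r)) = 0"
      using cyc_val_tr_zero by blast
    moreover have "comm gen_a (wpart (d + r) ?g) = comm gen_b (Psi r (hom_part d (p r)))"
      using arg_cong[OF g(1), of "wpart (Suc (d + r))"]
      by (simp add: wpart_comm_gen[OF weight_gen(1)] wpart_comm_gen[OF weight_gen(2)] wpart_Psi[OF p(5)])
    moreover have "mvars (hom_part d (p r)) \<subseteq> {1..r}"
      using mv[of r] by (simp add: family_part_def)
    moreover have "mould_of (family_part r d p) r = frp (hom_part d (p r))"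
      by (simp add: mould_of_def family_part_def)
    ultimately show ?thesis
      using circ_constant_iff_trace[of "hom_part d (p r)" r "mould_of (family_part r d p)" "wpart (d + r) ?g"]
        r push_inv_hom_part[OF p(6)[OF r(2)]] graded_gpart_other[OF g(2)] True by simp
  next
    case False
    then have "mould_of (family_part r d p) s = frp 0" by (simp add: mould_of_def family_part_def)
    then have "(circ ^^ i) (swap (Delta_inv (mould_of (family_part r d p)))) s = 0" for i
      using s by (subst circ_power[where p=0]) (simp_all add: nval_def poly_eval_simps)
    then show ?thesis by (auto intro!: exI[of _ 0] simp: rf_const_simps)
  qed
  then have "circ_constant (swap (Delta_inv (mould_of (family_part r d p))))"
    by (simp add: circ_constant_def)
  then show ?thesis
    using fam alt push z deg by (simp add: krv_family_def alternal_family_def)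
qed

lemma Psum_family_part: "Psum (family_part r d p) = Psi r (hom_part d (p r))"
  by (subst Psum_superset[of "{r}"]) (auto simp: family_part_def)

lemma corresponds_zero: "corresponds r d 0 0"
  by (simp add: corresponds_def der11_wt_def der11_def derivations_zero_mem lieL_wt_iff lieL_bi_iff
      lieL_zero graded_zero graded_zero lie_of_mould_def)

lemma ex_corresponds:
  assumes "krv_family p"
  shows "\<exists>u\<in>krv11. corresponds r d (mould_of (family_part r d p)) u"
proof (cases "hom_part d (p r) = 0")
  case True
  then have "mould_of (family_part r d p) = 0"
    by (auto simp: mould_of_def family_part_def frp_zero fun_eq_iff)
  moreover have "0 \<in> krv11" by (simp add: krv11_eq der.span_zero)
  ultimately show ?thesis using corresponds_zero[of r d] by auto
next
  case False
  define p' where "p' = hom_part d (p r)"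
  have p'0: "p' \<noteq> 0" using False by (simp add: p'_def)
  have r: "r \<ge> 1"
    using False krv_familyD(3)[OF assms] additive.zero[OF additive_hom_part] by (cases r) auto
  note fam = krv_family_part[OF assms, of r d]
  have e: "family_part r d p r = p'" by (simp add: family_part_def p'_def)
  note alt = krv_familyD(4)[OF fam, of r, unfolded e] and mv = krv_familyD(5)[OF fam, of r, unfolded e]
    and push = krv_familyD(6)[OF fam r, unfolded e]
  have hom: "homog d p'" by (simp add: p'_def homog_hom_part)
  obtain m where "m \<in> keys p'" using ex_key[OF p'0] by blast
  then have dr: "d + r \<ge> 3" using krv_familyD(8)[OF fam, of _ r, unfolded e] hom by (auto simp: graded_def)
  obtain q where q: "mvars q \<subseteq> {1..Suc r}" "Xsum (Suc r) * q = p' - shift p'"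
    using push_inv_iff[OF mv] push by blast
  let ?f = "Psi r p'" and ?g = "Psi (Suc r) q"
  have comm: "comm gen_a ?g = comm gen_b ?f" by (rule partner_comm[OF mv q(2)])
  have "alternal_poly (Suc r) (Xsum (Suc r) * q)"
    using alternal_poly_uminus[OF alternal_poly_shift[OF mv r alt]] by (simp add: q(2))
  then have "alternal_poly (Suc r) q" by (simp add: alternal_poly_Xsum)
  then have L: "?f \<in> lieL" "?g \<in> lieL"
    using Psi_lieL[OF mv r alt] Psi_lieL[OF q(1)] by auto
  have wf: "weight (d + r) ?f" by (rule weight_Psi[OF hom mv])
  have wg: "weight (d + r) ?g"
  proof (cases d)
    \<comment> \<open>In degree 0 the equation forces q = 0, as q would have degree -1.\<close>
    case 0
    then have "q = 0" using homog_partner[OF hom q(2)] ex_key[of q] by auto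
    then show ?thesis by (simp add: Psi_zero graded_zero)
  next
    case (Suc d')
    then have "homog d' q" using homog_partner[OF hom q(2)] by (auto simp: graded_def)
    then show ?thesis using weight_Psi[OF _ q(1)] Suc by fastforce
  qed
  define u where "u = der_ext ?f ?g"
  have ug: "u gen_a = ?f" "u gen_b = ?g" by (simp_all add: u_def)
  have ud: "u \<in> derivations" unfolding u_def by (rule der_ext_derivations[OF L])
  have "u gen_c = 0"
    using comm comm_antisym[of ?f gen_b] by (simp add: derivations_gen_c[OF ud] ug)
  then have u11: "u \<in> der11_wt (d + r)"
    using ud L wf wg by (simp add: der11_wt_def der11_def ug lieL_wt_iff)
  have "mould_of (family_part r d p) r = frp p'" by (simp add: mould_of_def e)
  have "\<exists>K. cyc_val r (div_rep ?f ?g - qscale K (gen_c ^ r)) = 0 \<and> (r < 2 \<longrightarrow> K = 0)"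
  proof (cases "r \<ge> 2")
    case True
    then show ?thesis
      using circ_constant_iff_trace[where F="mould_of (family_part r d p)", OF mv True push \<open>mould_of (family_part r d p) r = frp p'\<close> comm depth_Psi]
        krv_familyD(7)[OF fam True] by auto
  next
    \<comment> \<open>In depth 1 there is a single variable, the two reciprocals cancel, and the
      trace condition holds with constant 0.\<close>
    case False
    then have "r = 1" using r by simp
    then have "cyc_val r (div_rep ?f ?g) = 0"
      using cyc_val_div_rep[OF mv r push comm depth_Psi] by simp
    then show ?thesis by (intro exI[of _ 0]) simp
  qed
  then obtain K where K: "cyc_val r (div_rep ?f ?g - qscale K (gen_c ^ r)) = 0" by blast
  define K' where "K' = (if d + r = Suc (2 * r) then K else 0)"
  have "tr (div_rep ?f ?g - qscale K' (gen_c ^ r)) = 0"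
    using trace_hom_part[OF mv r depth_Psi K, of d]
    by (simp add: K'_def hom_part_homog[OF hom] gpart_graded[OF wg])
  then have "divergence u = qscale K' (tr (gen_c ^ r))"
    by (simp add: divergence_eq[OF ud] ug tr_diff tr_qscale)
  \<comment> \<open>Where the constant survives, the weight is 2r + 1: it is odd, and the power of c
    that \<open>krv_gens\<close> attaches to it is c^r.\<close>
  moreover have "(d + r - 1) div 2 = r \<and> odd (d + r)" if "K' \<noteq> 0"
    using that by (auto simp: K'_def split: if_splits)
  ultimately have "(even (d + r) \<longrightarrow> K' = 0) \<and> divergence u = qscale K' (tr (gen_c ^ ((d + r - 1) div 2)))"
    by (cases "K' = 0") auto
  then have "u \<in> krv_gens (d + r)"
    using u11 by (auto simp: krv_gens_def)
  then have "u \<in> krv11" using dr unfolding krv11_eq by (intro der.span_base) auto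
  moreover have "corresponds r d (mould_of (family_part r d p)) u"
    using u11 L wf wg depth_Psi[of r p'] depth_Psi[of "Suc r" q]
    by (simp add: corresponds_def ug lieL_bi_iff lie_of_mould_of[OF krv_familyD(2)[OF fam]]
        Psum_family_part flip: p'_def)
  ultimately show ?thesis by blast
qed

section \<open>The isomorphism\<close>

text \<open>A derivation killing \<open>c\<close> is determined by its value on \<open>a\<close> up to multiples of \<open>b \<mapsto> a\<close>,
  because the centralizer of \<open>a\<close> in \<open>L\<close> is spanned by \<open>a\<close>.\<close>

definition der11_reduced :: "(freealg \<Rightarrow> freealg) set" where
  "der11_reduced = {u \<in> der11. lookup (u gen_a) [La] = 0 \<and> lookup (u gen_b) [La] = 0}"

lemma lookup_gen_a_La: "lookup gen_a [La] = 1"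
  by (simp add: gen_a_def)

text \<open>Modulo multiples of a, \<open>lieL_decomp\<close> turns ad(a) into multiplication by -
  \<open>Xsum\<close>, which is injective in every depth at least 1.\<close>

lemma centralizer_gen_a:
  assumes "h \<in> lieL" "comm gen_a h = 0" "lookup h [La] = 0"
  shows "h = 0"
proof -
  obtain k p where p: "alternal_family p" "h = qscale k gen_a + Psum p"
    using lieL_decomp[OF assms(1)] by blast
  then have fam: "poly_family p" "p 0 = 0" by (auto simp: alternal_family_def)
  have "k = 0"
    using assms(3) p(2) lookup_Psum_La[OF fam] by (simp add: lookup_add lookup_qscale lookup_gen_a_La)
  then have "Psum (\<lambda>r. - (Xsum r * p r)) = 0"
    using assms(2) p(2) comm_gen_a_Psum[OF fam(1)] by simp
  also have "0 = Psum (\<lambda>r. 0)" by (simp add: Psum_def)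
  finally have eq: "(\<lambda>r. - (Xsum r * p r)) = (\<lambda>r. 0)"
    by (rule Psum_inj[OF poly_family_Xsum[OF fam(1)], rotated]) (simp add: poly_family_def)
  have "p r = 0" for r
    using fun_cong[OF eq, of r] Xsum_nonzero[of r] fam(2) by (cases r) auto
  then show ?thesis using p(2) \<open>k = 0\<close> by (simp add: Psum_def)
qed

lemma der11_reduced_eqI:
  assumes "u \<in> der11_reduced" "v \<in> der11_reduced" "u gen_a = v gen_a"
  shows "u = v"
proof -
  have d: "u \<in> derivations" "v \<in> derivations" "u gen_c = 0" "v gen_c = 0"
    using assms by (auto simp: der11_reduced_def der11_def)
  have "comm gen_a (w gen_b) = - comm (w gen_a) gen_b" if "w \<in> derivations" "w gen_c = 0" for w
    using derivations_gen_c[OF that(1)] that(2) by (simp add: eq_neg_iff_add_eq_0 add.commute)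
  then have 1: "comm gen_a (u gen_b - v gen_b) = 0"
    using d assms(3) by (simp add: comm_diff_right)
  have 2: "u gen_b - v gen_b \<in> lieL"
    by (intro lieL_diff derivations_in d)
  have 3: "lookup (u gen_b - v gen_b) [La] = 0"
    using assms by (simp add: der11_reduced_def lookup_minus)
  have "u gen_b - v gen_b = 0" by (rule centralizer_gen_a[OF 2 1 3])
  then show ?thesis using derivations_eqI[OF d(1,2) assms(3)] by simp
qed

lemma subspace_der11_reduced: "der.subspace der11_reduced"
proof -
  have "0 \<in> der11_reduced"
    using der.subspace_0[OF der11_subspace] by (simp add: der11_reduced_def)
  then show ?thesis
    unfolding der.subspace_def
    using der.subspace_add[OF der11_subspace] der.subspace_scale[OF der11_subspace]
    by (auto simp: der11_reduced_def lookup_add) (auto simp: der_scale_def lookup_qscale)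
qed

lemma corresponds_reduced:
  assumes "corresponds r d (mould_of p) u" "poly_family p" "p 0 = 0"
  shows "u \<in> der11_reduced"
proof -
  have "lookup (u gen_a) [La] = 0"
    using assms lookup_Psum_La[OF assms(2,3)] by (simp add: corresponds_def lie_of_mould_of)
  \<comment> \<open>u(b) has depth r + 1, never 0, which rules out a summand b -> a.\<close>
  moreover have "lookup (u gen_b) [La] = 0"
  proof (rule ccontr)
    assume "lookup (u gen_b) [La] \<noteq> 0"
    then have "[La] \<in> keys (u gen_b)" by (simp add: in_keys_iff)
    then have "count_list [La] Lb = r + 1"
      using assms(1) unfolding corresponds_def lieL_bi_iff graded_def by blast
    then show False by simp
  qed
  ultimately show ?thesis
    using assms(1) by (simp add: der11_reduced_def corresponds_def der11_wt_def)
qed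

text \<open>Comparing families in [a,g] = [b,f] exhibits g as the quotient asked for by
  \<open>push_inv_iff\<close>, and the depth components of the divergence give
  circ-constancy.\<close>

lemma krv_gens_family:
  assumes u: "u \<in> krv_gens n" and n: "n \<ge> 3"
  shows "u \<in> der11_reduced \<and> (\<exists>p. krv_family p \<and> u gen_a = Psum p)"
proof -
  have d: "u \<in> der11" "u \<in> derivations" "u gen_c = 0"
    and L: "u gen_a \<in> lieL" "u gen_b \<in> lieL" and w: "weight n (u gen_a)" "weight n (u gen_b)"
    using u by (auto simp: krv_gens_def der11_wt_def der11_def lieL_wt_iff)
  obtain K where K: "even n \<longrightarrow> K = 0" "divergence u = qscale K (tr (gen_c ^ ((n - 1) div 2)))"
    using u by (auto simp: krv_gens_def)
  let ?m = "(n - 1) div 2"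
  \<comment> \<open>Weight at least 3 excludes the word a, hence the summand a in
    \<open>lieL_decomp\<close>.\<close>
  have La: "lookup x [La] = 0" if "weight n x" for x
  proof (rule ccontr)
    assume "lookup x [La] \<noteq> 0"
    then have "[La] \<in> keys x" by (simp add: in_keys_iff)
    then have "length [La] = n" using that unfolding graded_def by blast
    then show False using n by simp
  qed
  have red: "u \<in> der11_reduced" using d w La by (simp add: der11_reduced_def)
  have ex: "\<exists>p. alternal_family p \<and> x = Psum p" if x: "x \<in> lieL" "weight n x" for x
  proof -
    obtain k p where p: "alternal_family p" "x = qscale k gen_a + Psum p"
      using lieL_decomp[OF x(1)] by blast
    then have "k = 0"
      using La[OF x(2)] lookup_Psum_La[of p]
      by (simp add: lookup_add lookup_qscale lookup_gen_a_La alternal_family_def)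
    then show ?thesis using p by auto
  qed
  obtain p q where p: "alternal_family p" "u gen_a = Psum p" and q: "alternal_family q" "u gen_b = Psum q"
    using ex[OF L(1) w(1)] ex[OF L(2) w(2)] by blast
  have fam: "poly_family p" "poly_family q" using p q by (auto simp: alternal_family_def)
  have mv: "mvars (p r) \<subseteq> {1..r}" for r using fam by (simp add: poly_family_def)
  have "comm (u gen_a) gen_b + comm gen_a (u gen_b) = 0"
    using d derivations_gen_c by metis
  then have ab: "comm gen_a (u gen_b) = comm gen_b (u gen_a)"
    by (simp add: comm_antisym[of gen_b] eq_neg_iff_add_eq_0 add.commute)
  then have "Psum (\<lambda>r. - (Xsum r * q r)) = Psum (raise p)"
    using p q fam by (simp add: comm_gen_a_Psum comm_gen_b_Psum)
  then have "(\<lambda>r. - (Xsum r * q r)) = raise p"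
    using Psum_inj poly_family_Xsum poly_family_raise fam by blast
  then have "- (Xsum (Suc r) * q (Suc r)) = shift (p r) - p r" for r
    by (drule_tac fun_cong[of _ _ "Suc r"]) (simp add: raise_def)
  then have part: "Xsum (Suc r) * q (Suc r) = p r - shift (p r)" for r
    by (metis minus_diff_eq minus_minus)
  have push: "push_inv r (p r)" for r
    using push_inv_iff[OF mv[of r]] part[of r] fam(2) by (auto simp: poly_family_def)
  \<comment> \<open>The weight of u(a) passes to each depth component, where it is degree plus
    depth.\<close>
  have deg: "mdeg m + r = n" if "m \<in> keys (p r)" for m r
  proof (rule ccontr)
    assume neq: "mdeg m + r \<noteq> n"
    have "weight n (Psi r (p r))"
      unfolding dpart_Psum[OF fam(1), symmetric] using w(1) p(2)
      by (simp add: graded_def gpart_def keys_restr)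
    then have "Psi r (hom_part (mdeg m) (p r)) = 0"
      using wpart_Psi[OF mv[of r], of "mdeg m"] neq by (simp add: gpart_graded)
    then have "hom_part (mdeg m) (p r) = 0"
      using mvars_hom_part[of "mdeg m" "p r"] mv[of r] by (intro Psi_inj[of _ r]) auto
    then have "lookup (hom_part (mdeg m) (p r)) m = 0" by simp
    then show False using that by (simp add: hom_part_eq_gpart gpart_def lookup_restr in_keys_iff)
  qed
  have "tr (div_rep (u gen_a) (u gen_b) - qscale K (gen_c ^ ?m)) = 0"
    using K(2) divergence_eq[OF d(2)] by (simp add: tr_diff tr_qscale)
  then have cyc: "cyc_val r (div_rep (u gen_a) (u gen_b) - qscale K (gen_c ^ ?m)) = 0" for r
    by (rule cyc_val_tr_zero)
  have "\<exists>K. circ_sum (mould_of p) r = rf_const (K * of_nat r)"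
    if r: "r \<ge> 2" for r
  proof -
    \<comment> \<open>The power of c lives in the single depth \<open>?m\<close>; in the other
      depths the constant is 0.\<close>
    define K' where "K' = (if r = ?m then K else 0)"
    let ?f = "Psi r (p r)" and ?g = "Psi (Suc r) (q (Suc r))"
    have "dpart r (div_rep (u gen_a) (u gen_b) - qscale K (gen_c ^ ?m)) = div_rep ?f ?g - qscale K' (gen_c ^ r)"
      by (auto simp: additive.diff[OF additive_gpart] dpart_div_rep p(2) q(2) dpart_Psum fam K'_def
          dpart_qscale gpart_graded[OF depth_gen_c_power])
    also have "\<dots> = dpart r (div_rep ?f ?g - qscale K' (gen_c ^ r))"
      by (intro gpart_idem[symmetric] graded_diff depth_div_rep depth_Psi graded_qscale depth_gen_c_power)
    finally have "cyc_val r (div_rep ?f ?g - qscale K' (gen_c ^ r)) = 0"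
      using cyc[of r] by (simp add: cyc_val_def)
    moreover have "mould_of p r = frp (p r)" by (simp add: mould_of_def)
    ultimately show ?thesis
      using circ_constant_iff_trace[OF mv[of r] r push[of r] _ partner_comm[OF mv[of r] part[of r]] depth_Psi]
      by blast
  qed
  then have "krv_family p"
    using p(1) push deg n by (auto simp: krv_family_def circ_constant_def)
  then show ?thesis using red p(2) by blast
qed

lemma krv11_family: "u \<in> krv11 \<Longrightarrow> u \<in> der11_reduced \<and> (\<exists>p. krv_family p \<and> u gen_a = Psum p)"
proof -
  let ?S = "{u \<in> der11_reduced. \<exists>p. krv_family p \<and> u gen_a = Psum p}"
  have "der.subspace ?S"
    unfolding der.subspace_def
  proof (intro conjI ballI allI)
    show "0 \<in> ?S"
      using der.subspace_0[OF subspace_der11_reduced] krv_family_zero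
      by (auto intro!: exI[of _ "\<lambda>r. 0"] simp: Psum_def)
  next
    fix u v assume "u \<in> ?S" "v \<in> ?S"
    then obtain p q where "krv_family p" "u gen_a = Psum p" "krv_family q" "v gen_a = Psum q"
      "u \<in> der11_reduced" "v \<in> der11_reduced" by blast
    then show "u + v \<in> ?S"
      using der.subspace_add[OF subspace_der11_reduced] krv_family_add
      by (auto intro!: exI[of _ "\<lambda>r. p r + q r"] simp: Psum_add krv_familyD(2))
  next
    fix c u assume "u \<in> ?S"
    then obtain p where "krv_family p" "u gen_a = Psum p" "u \<in> der11_reduced" by blast
    then show "der_scale c u \<in> ?S"
      using der.subspace_scale[OF subspace_der11_reduced] krv_family_qscale
      by (auto intro!: exI[of _ "\<lambda>r. qscale c (p r)"] simp: Psum_qscale krv_familyD(2))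
        (simp add: der_scale_def)
  qed
  moreover have "(\<Union>n\<in>{3..}. krv_gens n) \<subseteq> ?S"
    using krv_gens_family by auto
  ultimately have "krv11 \<subseteq> ?S"
    unfolding krv11_eq by (rule der.span_minimal[rotated])
  then show "u \<in> krv11 \<Longrightarrow> u \<in> der11_reduced \<and> (\<exists>p. krv_family p \<and> u gen_a = Psum p)" by blast
qed

lemma krv11_eqI: "u \<in> krv11 \<Longrightarrow> v \<in> krv11 \<Longrightarrow> u gen_a = v gen_a \<Longrightarrow> u = v"
  using krv11_family der11_reduced_eqI by blast

lemma corresponds_unique:
  assumes "krv_family p"
  shows "\<exists>!u. corresponds r d (mould_of (family_part r d p)) u"
proof -
  note fam = krv_familyD(2,3)[OF krv_family_part[OF assms, of r d]]
  have "u = v" if "corresponds r d (mould_of (family_part r d p)) u"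
    "corresponds r d (mould_of (family_part r d p)) v" for u v
    using that corresponds_reduced[OF _ fam]
    by (intro der11_reduced_eqI) (auto simp: corresponds_def)
  then show ?thesis using ex_corresponds[OF assms, of r d] by blast
qed

lemma additive_apply: "additive (\<lambda>u :: 'k \<Rightarrow> 'm::ab_group_add. u x)"
  by (simp add: additive_def)

lemma der_of_mould_of:
  assumes "krv_family p"
  shows "der_of_mould (mould_of p) \<in> krv11" "der_of_mould (mould_of p) gen_a = Psum p"
proof -
  note p = krv_familyD[OF assms]
  define U where "U = (\<lambda>(r, d). THE u. corresponds r d (mould_part r d (mould_of p)) u)"
  let ?S = "{(r, d). mould_part r d (mould_of p) \<noteq> 0}"
  have part: "mould_part r d (mould_of p) \<noteq> 0 \<longleftrightarrow> hom_part d (p r) \<noteq> 0" for r d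
    unfolding mould_part_mould_of by (auto simp: mould_of_def family_part_def fun_eq_iff frp_zero)
  have U: "U (r, d) \<in> krv11 \<and> U (r, d) gen_a = Psi r (hom_part d (p r))" for r d
  proof -
    let ?F = "mould_of (family_part r d p)"
    obtain u where u: "u \<in> krv11" "corresponds r d ?F u" using ex_corresponds[OF assms] by blast
    then have "(THE u. corresponds r d ?F u) = u"
      using corresponds_unique[OF assms, of r d] by blast
    moreover have "u gen_a = Psi r (hom_part d (p r))"
      using u(2) krv_familyD(2)[OF krv_family_part[OF assms]]
      by (simp add: corresponds_def lie_of_mould_of Psum_family_part)
    ultimately show ?thesis using u(1) by (simp add: U_def mould_part_mould_of)
  qed
  have der: "der_of_mould (mould_of p) = (\<Sum>x\<in>?S. U x)"
    unfolding der_of_mould_def U_def by (rule sum.cong) auto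
  show "der_of_mould (mould_of p) \<in> krv11"
    unfolding der krv11_eq using U by (intro der.span_sum) (auto simp: krv11_eq)
  \<comment> \<open>A finite index set fibred over the depth; it contains all nonzero components and
    lets the sum be taken depth by depth.\<close>
  let ?T = "Sigma {r. p r \<noteq> 0} (\<lambda>r. mdeg ` keys (p r))"
  have T: "finite ?T" using p(2) by (auto simp: poly_family_def)
  have "?S \<subseteq> ?T"
  proof (clarsimp simp: part)
    fix r d assume h: "hom_part d (p r) \<noteq> 0"
    then obtain m where "m \<in> keys (hom_part d (p r))"
      using ex_key by blast
    then have "m \<in> keys (p r)" "mdeg m = d"
      by (auto simp: hom_part_eq_gpart gpart_def keys_restr)
    then show "p r \<noteq> 0 \<and> d \<in> mdeg ` keys (p r)" by auto
  qed
  have "der_of_mould (mould_of p) gen_a = (\<Sum>x\<in>?S. U x gen_a)"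
    unfolding der by (rule additive.sum[OF additive_apply])
  also have "\<dots> = (\<Sum>(r, d)\<in>?S. Psi r (hom_part d (p r)))"
    using U by (intro sum.cong) auto
  also have "\<dots> = (\<Sum>(r, d)\<in>?T. Psi r (hom_part d (p r)))"
    by (rule sum.mono_neutral_left[OF T \<open>?S \<subseteq> ?T\<close>]) (auto simp: part Psi_zero)
  also have "\<dots> = (\<Sum>r\<in>{r. p r \<noteq> 0}. \<Sum>d\<in>mdeg ` keys (p r). Psi r (hom_part d (p r)))"
    using p(2) by (subst sum.Sigma) (auto simp: poly_family_def)
  also have "\<dots> = Psum p"
    unfolding Psum_def
    by (simp add: additive.sum[OF additive_Psi, symmetric] sum_hom_part)
  finally show "der_of_mould (mould_of p) gen_a = Psum p" .
qed

lemma mould_of_add: "mould_of p + mould_of q = mould_of (\<lambda>r. p r + q r)"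
  and mould_of_scale: "mould_scale c (mould_of p) = mould_of (\<lambda>r. qscale c (p r))"
  by (auto simp: mould_of_def mould_scale_def fun_eq_iff frp_simps)

lemma bij_der_of_mould: "bij_betw der_of_mould krv_ell krv11"
proof (rule bij_betw_imageI)
  show "inj_on der_of_mould krv_ell"
  proof (rule inj_onI)
    fix F G assume "F \<in> krv_ell" "G \<in> krv_ell" and eq: "der_of_mould F = der_of_mould G"
    then obtain p q where p: "F = mould_of p" "krv_family p" and q: "G = mould_of q" "krv_family q"
      by (auto simp: krv_ell_iff)
    have "Psum p = Psum q" using eq der_of_mould_of(2) p q by metis
    then have "p = q" using Psum_inj krv_familyD(2) p q by blast
    then show "F = G" using p q by simp
  qed
  have "u \<in> der_of_mould ` krv_ell" if u: "u \<in> krv11" for u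
  proof -
    obtain p where p: "krv_family p" "u gen_a = Psum p" using krv11_family[OF u] by blast
    then have "der_of_mould (mould_of p) = u"
      using u der_of_mould_of[OF p(1)] by (intro krv11_eqI) auto
    then show ?thesis using p(1) krv_ell_iff by blast
  qed
  then show "der_of_mould ` krv_ell = krv11"
    using der_of_mould_of(1) by (auto simp: krv_ell_iff)
qed

lemma krv_ell_add: "F \<in> krv_ell \<Longrightarrow> G \<in> krv_ell \<Longrightarrow> F + G \<in> krv_ell"
  using krv_family_add mould_of_add by (auto simp: krv_ell_iff)

lemma krv_ell_scale: "F \<in> krv_ell \<Longrightarrow> mould_scale c F \<in> krv_ell"
  using krv_family_qscale mould_of_scale by (auto simp: krv_ell_iff)

lemma der_of_mould_add:
  assumes "F \<in> krv_ell" "G \<in> krv_ell"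
  shows "der_of_mould (F + G) = der_of_mould F + der_of_mould G"
proof -
  obtain p q where p: "F = mould_of p" "krv_family p" and q: "G = mould_of q" "krv_family q"
    using assms by (auto simp: krv_ell_iff)
  show ?thesis
    unfolding p(1) q(1) mould_of_add
    using der_of_mould_of[OF p(2)] der_of_mould_of[OF q(2)] der_of_mould_of[OF krv_family_add[OF p(2) q(2)]]
    by (intro krv11_eqI) (auto simp: Psum_add krv_familyD(2) p q krv11_def der.span_add)
qed

lemma der_of_mould_scale:
  assumes "F \<in> krv_ell"
  shows "der_of_mould (mould_scale c F) = der_scale c (der_of_mould F)"
proof -
  obtain p where p: "F = mould_of p" "krv_family p"
    using assms by (auto simp: krv_ell_iff)
  have "der_scale c (der_of_mould (mould_of p)) gen_a = Psum (\<lambda>r. qscale c (p r))"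
    by (simp add: der_scale_def der_of_mould_of[OF p(2)] Psum_qscale krv_familyD(2)[OF p(2)])
  then show ?thesis
    unfolding p(1) mould_of_scale
    using der_of_mould_of[OF p(2)] der_of_mould_of[OF krv_family_qscale[OF p(2)]]
    by (intro krv11_eqI) (auto simp: krv11_def der.span_scale)
qed

text \<open>The bracket of derivations stays in \<open>krv11\<close>, so its value on a comes from a
  family; injectivity of \<open>Psum\<close> makes this family unique, as the definite description
  requires.\<close>

lemma mould_bracket_krv_ell:
  assumes "F \<in> krv_ell" "G \<in> krv_ell"
  shows "mould_bracket F G \<in> krv_ell"
    and "der_of_mould (mould_bracket F G) = der_bracket (der_of_mould F) (der_of_mould G)"
proof -
  let ?u = "der_bracket (der_of_mould F) (der_of_mould G)"
  have u: "?u \<in> krv11"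
    using assms bij_der_of_mould krv11_bracket bij_betwE by blast
  then obtain p where p: "krv_family p" "?u gen_a = Psum p" using krv11_family by blast
  have "mould_bracket F G = mould_of p"
    unfolding mould_bracket_def
  proof (rule the_equality)
    show "mould_of p \<in> poly_moulds \<and> lie_of_mould (mould_of p) = ?u gen_a"
      using p krv_familyD(2)[OF p(1)] by (auto simp: poly_moulds_iff lie_of_mould_of)
  next
    fix H assume H: "H \<in> poly_moulds \<and> lie_of_mould H = ?u gen_a"
    then obtain q where q: "H = mould_of q" "poly_family q" by (auto simp: poly_moulds_iff)
    then have "Psum q = Psum p" using H p(2) by (simp add: lie_of_mould_of)
    then show "H = mould_of p" using Psum_inj[OF q(2) krv_familyD(2)[OF p(1)]] q(1) by simp
  qed
  then show "mould_bracket F G \<in> krv_ell" "der_of_mould (mould_bracket F G) = ?u"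
    using p u der_of_mould_of[OF p(1)] by (auto simp: krv_ell_iff intro!: krv11_eqI)
qed

lemma vector_space_mould_scale: "vector_space mould_scale"
  by standard (auto simp: mould_scale_def fun_eq_iff rf.h_add rf.h_mult rf.h_one algebra_simps)

lemma subspace_krv_ell: "module.subspace mould_scale krv_ell"
proof -
  interpret mould: vector_space mould_scale by (rule vector_space_mould_scale)
  have "mould_of (\<lambda>r. 0) = 0" by (auto simp: mould_of_def frp_zero fun_eq_iff)
  then have "0 \<in> krv_ell" using krv_family_zero krv_ell_iff by metis
  then show ?thesis
    unfolding mould.subspace_def using krv_ell_add krv_ell_scale by blast
qed

text \<open>Each axiom is checked after applying the injective map f, where it becomes the axiom in
  V.\<close>

lemma lie_algebra_on_transport:
  assumes V: "lie_algebra_on sc V br" and W: "vector_space sc'" "module.subspace sc' W"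
    and iso: "lie_iso_on sc' W br' sc V br f" and br': "\<And>x y. x \<in> W \<Longrightarrow> y \<in> W \<Longrightarrow> br' x y \<in> W"
  shows "lie_algebra_on sc' W br'"
proof -
  interpret W: vector_space sc' by (rule W(1))
  have inj: "x = y" if "x \<in> W" "y \<in> W" "f x = f y" for x y
    using iso that unfolding lie_iso_on_def bij_betw_def inj_on_def by blast
  have fV: "f x \<in> V" if "x \<in> W" for x
    using iso that unfolding lie_iso_on_def by (blast dest: bij_betwE)
  have f: "f (x + y) = f x + f y" "f (br' x y) = br (f x) (f y)" "f (sc' k x) = sc k (f x)"
    if "x \<in> W" "y \<in> W" for x y k
    using iso that unfolding lie_iso_on_def by auto
  have cl: "x + y \<in> W" "sc' k x \<in> W" "0 \<in> W" if "x \<in> W" "y \<in> W" for x y k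
    using that W(2) W.subspace_add W.subspace_scale W.subspace_0 by auto
  have f0: "f 0 = 0" using f(1)[of 0 0] W.subspace_0[OF W(2)] by simp
  have V':
    "\<And>x y z. x \<in> V \<Longrightarrow> y \<in> V \<Longrightarrow> z \<in> V \<Longrightarrow> br (x + y) z = br x z + br y z"
    "\<And>x y z. x \<in> V \<Longrightarrow> y \<in> V \<Longrightarrow> z \<in> V \<Longrightarrow> br x (y + z) = br x y + br x z"
    "\<And>k x y. x \<in> V \<Longrightarrow> y \<in> V \<Longrightarrow> br (sc k x) y = sc k (br x y)"
    "\<And>k x y. x \<in> V \<Longrightarrow> y \<in> V \<Longrightarrow> br x (sc k y) = sc k (br x y)"
    "\<And>x. x \<in> V \<Longrightarrow> br x x = 0"
    "\<And>x y z. x \<in> V \<Longrightarrow> y \<in> V \<Longrightarrow> z \<in> V \<Longrightarrow> br x (br y z) + br y (br z x) + br z (br x y) = 0"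
    using V unfolding lie_algebra_on_def by blast+
  show ?thesis
    unfolding lie_algebra_on_def
  proof (intro conjI ballI allI W)
    fix x y z k assume x: "x \<in> W" and y: "y \<in> W" and z: "z \<in> W"
    show "br' x y \<in> W" by (rule br'[OF x y])
    show "br' (x + y) z = br' x z + br' y z"
      by (rule inj) (simp_all add: x y z f cl br' fV V')
    show "br' x (y + z) = br' x y + br' x z"
      by (rule inj) (simp_all add: x y z f cl br' fV V')
    show "br' (sc' k x) y = sc' k (br' x y)"
      by (rule inj) (simp_all add: x y z f(2) f(3)[OF _ x] cl(2)[OF _ x] br' fV V')
    show "br' x (sc' k y) = sc' k (br' x y)"
      by (rule inj) (simp_all add: x y z f(2) f(3)[OF _ x] cl(2)[OF _ x] br' fV V')
    show "br' x x = 0"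
      by (rule inj) (simp_all add: x f cl(3)[OF x x] br' fV V' f0)
    show "br' x (br' y z) + br' y (br' z x) + br' z (br' x y) = 0"
      by (rule inj) (simp_all add: x y z f cl(1) cl(3)[OF x x] br' fV V' f0)
  qed
qed

theorem mainTheorem1:
  shows "lie_algebra_on der_scale krv11 der_bracket \<and>
         lie_algebra_on mould_scale krv_ell mould_bracket \<and>
         (\<forall>F \<in> krv_ell. \<forall>r d. mould_part r d F \<in> krv_ell \<and>
                               (\<exists>!u. corresponds r d (mould_part r d F) u)) \<and>
         lie_iso_on mould_scale krv_ell mould_bracket der_scale krv11 der_bracket der_of_mould"
proof (intro conjI)
  show iso: "lie_iso_on mould_scale krv_ell mould_bracket der_scale krv11 der_bracket der_of_mould"
    unfolding lie_iso_on_def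
    using bij_der_of_mould der_of_mould_add der_of_mould_scale mould_bracket_krv_ell(2) by blast
  show "lie_algebra_on der_scale krv11 der_bracket" by (rule lie_algebra_krv11)
  then show "lie_algebra_on mould_scale krv_ell mould_bracket"
    using vector_space_mould_scale subspace_krv_ell iso mould_bracket_krv_ell(1)
    by (rule lie_algebra_on_transport)
  show "\<forall>F \<in> krv_ell. \<forall>r d. mould_part r d F \<in> krv_ell \<and>
                               (\<exists>!u. corresponds r d (mould_part r d F) u)"
  proof (intro ballI allI)
    fix F r d assume "F \<in> krv_ell"
    then obtain p where "F = mould_of p" "krv_family p" by (auto simp: krv_ell_iff)
    then show "mould_part r d F \<in> krv_ell \<and> (\<exists>!u. corresponds r d (mould_part r d F) u)"
      using krv_family_part corresponds_unique by (auto simp: mould_part_mould_of krv_ell_iff)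
  qed
qed

end
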